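(* Let $\rho: G\to Q$ be a surjective homomorphism of discrete groups with kernel $N$. Let $A,B\leq G$ be subgroups such that $gAg^{-1}\cap B=\{1\}$ for all $g\in N$. Then $$\mathrm{cd}(A\times_Q B)\leq \mathsf{TC}[\rho:G\to Q],$$ where $A\times_Q B=\{(a,b)\in A\times B \mid \rho(a)=\rho(b)\}$ is the fibred product of $\rho|_A:A\to Q$ and $\rho|_B:B\to Q$.
   Context: All invariants below take values in $\{0,1,2,\ldots\}\cup\{\infty\}$. Cohomological dimension: for a discrete group $\pi$, $\mathrm{cd}(\pi)$ is the minimal length of a projective resolution of $\mathbb{Z}$ by $\mathbb{Z}\pi$-modules, equivalently the largest $k$ such that $H^k(\pi;M)\neq 0$ for some $\mathbb{Z}\pi$-module $M$ (and $\infty$ if no such bound exists). Sectional category of a map: for a map $p:E\to B$ of topological spaces, $\mathsf{secat}(p)$ is the smallest $k$ such that $B$ admits a cover by open sets $U_0,\ldots,U_k$, each of which admits a map $\sigma_i:U_i\to E$ with $p\circ\sigma_i$ homotopic to the inclusion $U_i\hookrightarrow B$ (and $\infty$ if no such $k$ exists). Sectional category of a homomorphism: a $K(\pi,1)$ space is a connected space, of the homotopy type of a CW-complex, with fundamental group $\pi$ and trivial higher homotopy groups. A pointed map $f:X\to Y$ realizes a group homomorphism $\varphi:G_1\to G_2$ if $X$ is a $K(G_1,1)$, $Y$ is a $K(G_2,1)$ and $f$ induces $\varphi$ on fundamental groups. Every homomorphism can be realized, and $\mathsf{secat}(\varphi):=\mathsf{secat}(f)$ for any $f$ realizing $\varphi$;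 this is independent of the choice of $f$. Parametrised topological complexity of a homomorphism: for a group homomorphism $\varphi:G\to Q$, let $G\times_Q G=\{(g,h)\in G\times G\mid \varphi(g)=\varphi(h)\}$ and let $\Delta:G\to G\times_Q G$, $\Delta(g)=(g,g)$, be the diagonal homomorphism. Then $\mathsf{TC}[\varphi:G\to Q]:=\mathsf{secat}(\Delta:G\to G\times_Q G)$. *)

theory Defs
  imports
    "HOL-Library.Extended_Nat"
    "HOL-Algebra.Elementary_Groups"
    "HOL-Algebra.Module"
    "HOL-Analysis.Analysis"
begin

section \<open>Group cohomology and cohomological dimension\<close>

text \<open>
  A module over the integral group ring of \<open>G\<close> is an abelian group with a linear \<open>G\<close>-action.
  It is carried by the record type of \<open>HOL-Algebra.Module\<close>: the action is
  \<open>\<odot>\<close>, the additive structure is that of \<open>abelian_group\<close>, and the (irrelevant) ring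
  multiplication and unit of the record are not used. The library locale \<open>module\<close> itself
  is not applicable, since it requires a commutative ring of scalars.
\<close>

definition group_ring_module :: "'g monoid \<Rightarrow> ('g, 'm) module \<Rightarrow> bool" where
  "group_ring_module G M \<longleftrightarrow>
     abelian_group M \<and>
     (\<forall>g\<in>carrier G. \<forall>m\<in>carrier M. g \<odot>\<^bsub>M\<^esub> m \<in> carrier M) \<and>
     (\<forall>g\<in>carrier G. \<forall>m\<in>carrier M. \<forall>n\<in>carrier M.
        g \<odot>\<^bsub>M\<^esub> (m \<oplus>\<^bsub>M\<^esub> n) = g \<odot>\<^bsub>M\<^esub> m \<oplus>\<^bsub>M\<^esub> g \<odot>\<^bsub>M\<^esub> n) \<and>
     (\<forall>m\<in>carrier M. \<one>\<^bsub>G\<^esub> \<odot>\<^bsub>M\<^esub> m = m) \<and>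
     (\<forall>g\<in>carrier G. \<forall>h\<in>carrier G. \<forall>m\<in>carrier M.
        (g \<otimes>\<^bsub>G\<^esub> h) \<odot>\<^bsub>M\<^esub> m = g \<odot>\<^bsub>M\<^esub> (h \<odot>\<^bsub>M\<^esub> m))"

text \<open>
  \<open>H\<^sup>k(G; M)\<close> is computed by the inhomogeneous (bar) cochains: functions from
  \<open>k\<close>-tuples of elements of \<open>G\<close>, represented as lists of length \<open>k\<close>, to \<open>M\<close>.
\<close>

definition tuples :: "'g monoid \<Rightarrow> nat \<Rightarrow> 'g list set" where
  "tuples G k = {xs. length xs = k \<and> set xs \<subseteq> carrier G}"

definition cochain_group :: "'g monoid \<Rightarrow> ('g, 'm) module \<Rightarrow> nat \<Rightarrow> ('g list \<Rightarrow> 'm) monoid" where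
  "cochain_group G M k =
     \<lparr>carrier = tuples G k \<rightarrow>\<^sub>E carrier M,
      monoid.mult = (\<lambda>c d. \<lambda>xs\<in>tuples G k. c xs \<oplus>\<^bsub>M\<^esub> d xs),
      one = (\<lambda>xs\<in>tuples G k. \<zero>\<^bsub>M\<^esub>)\<rparr>"

text \<open>\<open>merge_at G i (x\<^sub>1, \<dots>, x\<^sub>n) = (x\<^sub>1, \<dots>, x\<^sub>i x\<^sub>i\<^sub>+\<^sub>1, \<dots>, x\<^sub>n)\<close>
  for \<open>1 \<le> i < n\<close>; list positions start at \<open>0\<close>.\<close>

definition merge_at :: "'g monoid \<Rightarrow> nat \<Rightarrow> 'g list \<Rightarrow> 'g list" where
  "merge_at G i xs = take (i - 1) xs @ [xs ! (i - 1) \<otimes>\<^bsub>G\<^esub> xs ! i] @ drop (i + 1) xs"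

definition coboundary ::
    "'g monoid \<Rightarrow> ('g, 'm) module \<Rightarrow> nat \<Rightarrow> ('g list \<Rightarrow> 'm) \<Rightarrow> 'g list \<Rightarrow> 'm" where
  "coboundary G M k c =
     (\<lambda>xs\<in>tuples G (Suc k).
        hd xs \<odot>\<^bsub>M\<^esub> c (tl xs)
        \<oplus>\<^bsub>M\<^esub> (\<Oplus>\<^bsub>M\<^esub>i\<in>{1..k}. add_pow M ((-1::int) ^ i) (c (merge_at G i xs)))
        \<oplus>\<^bsub>M\<^esub> add_pow M ((-1::int) ^ Suc k) (c (butlast xs)))"

definition cocycles :: "'g monoid \<Rightarrow> ('g, 'm) module \<Rightarrow> nat \<Rightarrow> ('g list \<Rightarrow> 'm) set" where
  "cocycles G M k =
     kernel (cochain_group G M k) (cochain_group G M (Suc k)) (coboundary G M k)"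

definition coboundaries :: "'g monoid \<Rightarrow> ('g, 'm) module \<Rightarrow> nat \<Rightarrow> ('g list \<Rightarrow> 'm) set" where
  "coboundaries G M k =
     (case k of 0 \<Rightarrow> {\<one>\<^bsub>cochain_group G M 0\<^esub>}
      | Suc j \<Rightarrow> coboundary G M j ` carrier (cochain_group G M j))"

definition group_cohomology ::
    "'g monoid \<Rightarrow> ('g, 'm) module \<Rightarrow> nat \<Rightarrow> ('g list \<Rightarrow> 'm) set monoid" where
  "group_cohomology G M k =
     (cochain_group G M k)\<lparr>carrier := cocycles G M k\<rparr> Mod coboundaries G M k"

text \<open>
  HOL cannot quantify over types inside a definition, so the coefficient modules range over all
  modules whose elements are taken from the type \<open>'m\<close>. A bound \<open>cd TYPE('m) G \<le> n\<close>
  with \<open>'m\<close> a type variable is the bound for all coefficient modules whatsoever.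
\<close>

definition cd :: "'m itself \<Rightarrow> 'g monoid \<Rightarrow> enat" where
  "cd _ G = (SUP k \<in> {k. \<exists>M :: ('g, 'm) module. group_ring_module G M \<and>
                carrier (group_cohomology G M k) \<noteq> {\<one>\<^bsub>group_cohomology G M k\<^esub>}}. enat k)"

section \<open>Homotopy groups\<close>

definition cube :: "nat \<Rightarrow> (nat \<Rightarrow> real) topology" where
  "cube n = subtopology (Euclidean_space n) {s. \<forall>i<n. 0 \<le> s i \<and> s i \<le> 1}"

definition cube_boundary :: "nat \<Rightarrow> (nat \<Rightarrow> real) set" where
  "cube_boundary n = {s \<in> topspace (cube n). \<exists>i<n. s i = 0 \<or> s i = 1}"

text \<open>Maps of pairs from \<open>(I\<^sup>n, \<partial>I\<^sup>n)\<close> to \<open>(X, x)\<close>; for \<open>n = 1\<close> these are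
  the loops at \<open>x\<close>. Values outside the cube are irrelevant: functions that agree on the cube
  are related by \<open>spheroid_rel\<close>.\<close>

definition spheroids :: "nat \<Rightarrow> 'u topology \<Rightarrow> 'u \<Rightarrow> ((nat \<Rightarrow> real) \<Rightarrow> 'u) set" where
  "spheroids n X x = {f. continuous_map (cube n) X f \<and> (\<forall>s\<in>cube_boundary n. f s = x)}"

definition spheroid_rel ::
    "nat \<Rightarrow> 'u topology \<Rightarrow> 'u \<Rightarrow> (((nat \<Rightarrow> real) \<Rightarrow> 'u) \<times> ((nat \<Rightarrow> real) \<Rightarrow> 'u)) set" where
  "spheroid_rel n X x =
     {(f, g). f \<in> spheroids n X x \<and> g \<in> spheroids n X x \<and>
              homotopic_with (\<lambda>h. \<forall>s\<in>cube_boundary n. h s = x) (cube n) X f g}"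

definition spheroid_concat ::
    "((nat \<Rightarrow> real) \<Rightarrow> 'u) \<Rightarrow> ((nat \<Rightarrow> real) \<Rightarrow> 'u) \<Rightarrow> (nat \<Rightarrow> real) \<Rightarrow> 'u" where
  "spheroid_concat f g s =
     (if s 0 \<le> 1/2 then f (s(0 := 2 * s 0)) else g (s(0 := 2 * s 0 - 1)))"

text \<open>Meaningful for \<open>n \<ge> 1\<close> only.\<close>

definition homotopy_group ::
    "nat \<Rightarrow> 'u topology \<Rightarrow> 'u \<Rightarrow> ((nat \<Rightarrow> real) \<Rightarrow> 'u) set monoid" where
  "homotopy_group n X x =
     \<lparr>carrier = spheroids n X x // spheroid_rel n X x,
      monoid.mult = (\<lambda>C D. \<Union>f\<in>C. \<Union>g\<in>D. spheroid_rel n X x `` {spheroid_concat f g}),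
      one = spheroid_rel n X x `` {\<lambda>_. x}\<rparr>"

abbreviation fundamental_group ::
    "'u topology \<Rightarrow> 'u \<Rightarrow> ((nat \<Rightarrow> real) \<Rightarrow> 'u) set monoid" where
  "fundamental_group \<equiv> homotopy_group 1"

text \<open>The map on fundamental groups induced by \<open>f : (X, x) \<rightarrow> (Y, y)\<close>; it depends on
  \<open>X\<close> and \<open>x\<close> only through its argument.\<close>

definition pi1_map ::
    "'v topology \<Rightarrow> 'v \<Rightarrow> ('u \<Rightarrow> 'v) \<Rightarrow> ((nat \<Rightarrow> real) \<Rightarrow> 'u) set \<Rightarrow> ((nat \<Rightarrow> real) \<Rightarrow> 'v) set" where
  "pi1_map Y y f C = (\<Union>g\<in>C. spheroid_rel 1 Y y `` {f \<circ> g})"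

section \<open>CW-complexes and Eilenberg--MacLane spaces\<close>

definition disc :: "nat \<Rightarrow> (nat \<Rightarrow> real) topology" where
  "disc n = subtopology (Euclidean_space n) {s. (\<Sum>i<n. (s i)\<^sup>2) \<le> 1}"

definition open_disc :: "nat \<Rightarrow> (nat \<Rightarrow> real) set" where
  "open_disc n = {s \<in> topspace (disc n). (\<Sum>i<n. (s i)\<^sup>2) < 1}"

definition disc_boundary :: "nat \<Rightarrow> (nat \<Rightarrow> real) set" where
  "disc_boundary n = {s \<in> topspace (disc n). (\<Sum>i<n. (s i)\<^sup>2) = 1}"

text \<open>
  Whitehead's definition. \<open>\<Phi>\<close> is the set of characteristic maps, each paired with the
  dimension of its cell: the open cells partition the space, the boundary of a cell lies in a
  finite union of cells of lower dimension (closure finiteness), and the space carries the weak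
  topology with respect to the characteristic maps.
\<close>

definition CW_complex :: "'u topology \<Rightarrow> bool" where
  "CW_complex X \<longleftrightarrow>
     Hausdorff_space X \<and>
     (\<exists>\<Phi> :: (nat \<times> ((nat \<Rightarrow> real) \<Rightarrow> 'u)) set.
        (\<forall>(n, \<phi>)\<in>\<Phi>. continuous_map (disc n) X \<phi> \<and> inj_on \<phi> (open_disc n)) \<and>
        (\<forall>u\<in>topspace X. \<exists>!c. c \<in> \<Phi> \<and> u \<in> snd c ` open_disc (fst c)) \<and>
        (\<forall>(n, \<phi>)\<in>\<Phi>. \<exists>\<Psi>\<subseteq>\<Phi>. finite \<Psi> \<and> (\<forall>(m, \<psi>)\<in>\<Psi>. m < n) \<and>
            \<phi> ` disc_boundary n \<subseteq> (\<Union>(m, \<psi>)\<in>\<Psi>. \<psi> ` open_disc m)) \<and>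
        (\<forall>S\<subseteq>topspace X.
            (\<forall>(n, \<phi>)\<in>\<Phi>. closedin (disc n) {s \<in> topspace (disc n). \<phi> s \<in> S}) \<longrightarrow> closedin X S))"

text \<open>The CW-complex is taken over the same type \<open>'u\<close>; see the remark before
  \<open>secat_hom\<close>.\<close>

definition has_CW_homotopy_type :: "'u topology \<Rightarrow> bool" where
  "has_CW_homotopy_type X \<longleftrightarrow>
     (\<exists>K :: 'u topology. CW_complex K \<and> X homotopy_equivalent_space K)"

definition K_pi_1 :: "'g monoid \<Rightarrow> 'u topology \<Rightarrow> 'u \<Rightarrow> bool" where
  "K_pi_1 G X x \<longleftrightarrow>
     x \<in> topspace X \<and> connected_space X \<and> has_CW_homotopy_type X \<and>
     G \<cong> fundamental_group X x \<and>
     (\<forall>n\<ge>2. trivial_group (homotopy_group n X x))"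

section \<open>Sectional category and parametrised topological complexity\<close>

definition secat :: "'e topology \<Rightarrow> 'b topology \<Rightarrow> ('e \<Rightarrow> 'b) \<Rightarrow> enat" where
  "secat E B p =
     (INF k \<in> {k. \<exists>U :: nat \<Rightarrow> 'b set.
                 (\<Union>i\<le>k. U i) = topspace B \<and>
                 (\<forall>i\<le>k. openin B (U i) \<and>
                    (\<exists>\<sigma>. continuous_map (subtopology B (U i)) E \<sigma> \<and>
                         homotopic_with (\<lambda>_. True) (subtopology B (U i)) B (p \<circ> \<sigma>) id))}. enat k)"

text \<open>The isomorphisms \<open>\<alpha>\<close>, \<open>\<beta>\<close> are the identifications of \<open>G1\<close>, \<open>G2\<close>
  with the fundamental groups under which \<open>f\<close> induces \<open>\<phi>\<close>.\<close>

definition realizes ::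
    "'u topology \<Rightarrow> 'u \<Rightarrow> 'v topology \<Rightarrow> 'v \<Rightarrow> ('u \<Rightarrow> 'v) \<Rightarrow>
     'g monoid \<Rightarrow> 'h monoid \<Rightarrow> ('g \<Rightarrow> 'h) \<Rightarrow> bool" where
  "realizes X x Y y f G1 G2 \<phi> \<longleftrightarrow>
     K_pi_1 G1 X x \<and> K_pi_1 G2 Y y \<and> continuous_map X Y f \<and> f x = y \<and>
     (\<exists>\<alpha>\<in>iso G1 (fundamental_group X x). \<exists>\<beta>\<in>iso G2 (fundamental_group Y y).
        \<forall>g\<in>carrier G1. pi1_map Y y f (\<alpha> g) = \<beta> (\<phi> g))"

text \<open>
  The sectional category of a homomorphism is \<open>secat f\<close> for any realization \<open>f\<close>. All of
  these values agree, so the infimum below is over a set with at most one element, and it is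
  that element as soon as the type \<open>'u\<close> of points is large enough for a realization to
  exist. An inequality \<open>n \<le> secat_hom TYPE('u) G1 G2 \<phi>\<close> with \<open>'u\<close> a type variable says
  \<open>n \<le> secat f\<close> for every realization \<open>f\<close> over every type. Taking both spaces, and the
  CW-complexes they are homotopy equivalent to, over one type is no restriction, because
  finitely many types embed into their disjoint sum.
\<close>

definition secat_hom :: "'u itself \<Rightarrow> 'g monoid \<Rightarrow> 'h monoid \<Rightarrow> ('g \<Rightarrow> 'h) \<Rightarrow> enat" where
  "secat_hom _ G1 G2 \<phi> =
     Inf {secat X Y f | (X :: 'u topology) x (Y :: 'u topology) y f. realizes X x Y y f G1 G2 \<phi>}"

lemma le_secat_hom_iff:
  "n \<le> secat_hom TYPE('u) G1 G2 \<phi> \<longleftrightarrow>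
     (\<forall>(X :: 'u topology) x (Y :: 'u topology) y f.
        realizes X x Y y f G1 G2 \<phi> \<longrightarrow> n \<le> secat X Y f)"
  unfolding secat_hom_def le_Inf_iff by blast

definition fibre_product ::
    "'g monoid \<Rightarrow> ('g \<Rightarrow> 'q) \<Rightarrow> 'h monoid \<Rightarrow> ('h \<Rightarrow> 'q) \<Rightarrow> ('g \<times> 'h) monoid" where
  "fibre_product G \<phi> H \<psi> =
     (G \<times>\<times> H)\<lparr>carrier := {(g, h). g \<in> carrier G \<and> h \<in> carrier H \<and> \<phi> g = \<psi> h}\<rparr>"

definition TC :: "'u itself \<Rightarrow> 'g monoid \<Rightarrow> ('g \<Rightarrow> 'q) \<Rightarrow> enat" where
  "TC U G \<phi> = secat_hom U G (fibre_product G \<phi> G \<phi>) (\<lambda>g. (g, g))"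

end

theory Submission
  imports Defs "HOL-Homology.Homology"
begin

text \<open>Let \<open>H\<close> be the fibre product of \<open>A\<close> and \<open>B\<close>, a subgroup of \<open>P\<close>, the fibre product of
  \<open>G\<close> with itself. By the hypothesis on \<open>A\<close> and \<open>B\<close>, every conjugate in \<open>P\<close> of the diagonal meets
  \<open>H\<close> trivially. Let \<open>U 0, \<dots>, U k\<close> be an open cover of a \<open>K(P, 1)\<close> space \<open>Y\<close> with partial sections up to
  homotopy. Loops in \<open>U i\<close> are conjugate to elements of the diagonal, so the covering of \<open>Y\<close> with group \<open>H\<close>
  is trivial over \<open>U i\<close>: there is a locally constant \<open>H\<close>-equivariant function to \<open>H\<close> on the preimage of
  \<open>U i\<close>.

  As \<open>Y\<close> is aspherical, the simplices of the homogeneous bar complex of \<open>H\<close> can be mapped to \<open>Y\<close>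
  compatibly with faces and with the action. Replace each of them by a chain of simplices that are small for the
  cover, and these by flags of their faces; a face \<open>f\<close> is sent to the value, at a vertex of \<open>f\<close>, of the function
  that belongs to the first \<open>U i\<close> containing \<open>f\<close>. This gives an \<open>H\<close>-equivariant chain endomorphism of the
  bar complex which is equivariantly homotopic to the identity. In degrees above \<open>k\<close> a flag has two
  successive faces with the same \<open>i\<close>, hence with the same value, so the endomorphism vanishes
  after normalisation. Thus \<open>H\<close> has no cohomology in degrees above \<open>k\<close>.\<close>

section \<open>The homogeneous bar complex\<close>

text \<open>No covering space is constructed. \<open>Y\<close> only has the homotopy type of a
  CW-complex, so it need not be locally path-connected, and the part of a covering over
  \<open>U i\<close> may have path components that are not open. Points of the universal covering
  are therefore encoded as pairs of a point of \<open>Y\<close> and an element of \<open>P\<close>,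
  and the functions over \<open>U i\<close> are only required to be constant along paths. This is
  enough, because they are compared only within singular simplices whose image lies in a single
  \<open>U i\<close>.

  Equivariance is obtained without equivariant choices: the maps and chains attached to a tuple are
  chosen by predicates that do not change under left translation of the tuple, so the choices are
  invariant, and the group acts through the labels alone.

  The successive faces with equal index come from monotonicity: a face lies in every
  \<open>U i\<close> that contains the whole simplex, so the least index can only drop along a flag.
  With values in \<open>{0..k}\<close> it cannot drop strictly more than \<open>k\<close>
  times.\<close>

definition del :: "nat \<Rightarrow> 'a list \<Rightarrow> 'a list" where
  "del j l = take j l @ drop (Suc j) l"

lemma length_del: "j < length l \<Longrightarrow> length (del j l) = length l - 1"
  by (auto simp: del_def)

lemma set_del: "set (del j l) \<subseteq> set l"
  by (auto simp: del_def dest: in_set_takeD in_set_dropD)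

lemma del_in_tuples: "l \<in> tuples H (Suc n) \<Longrightarrow> j \<le> n \<Longrightarrow> del j l \<in> tuples H n"
  using set_del[of j l] by (auto simp: tuples_def length_del)

lemma del_0: "del 0 (h # l) = l" and del_Suc: "del (Suc j) (h # l) = h # del j l"
  by (simp_all add: del_def)

lemma del_map: "del j (map a l) = map a (del j l)"
  by (simp add: del_def take_map drop_map)

lemma nth_del: "j < length l \<Longrightarrow> i < length l - 1 \<Longrightarrow> del j l ! i = (if i < j then l ! i else l ! Suc i)"
  by (auto simp: del_def nth_append)

lemma del_del:
  assumes "i \<le> j" "Suc j < length l"
  shows "del i (del (Suc j) l) = del j (del i l)"
  using assms by (intro nth_equalityI) (auto simp: length_del nth_del)

text \<open>The index pairs split into two halves, matched by \<open>(i, j)\<close> and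
  \<open>(Suc j, i)\<close>; matched terms agree and carry opposite signs. The form is free of
  \<open>del\<close> so that it also covers singular chains pushed forward along faces.\<close>

lemma alternating_double_sum:
  fixes f :: "nat \<Rightarrow> nat \<Rightarrow> 'a \<Rightarrow>\<^sub>0 int"
  assumes "\<And>i j. i \<le> j \<Longrightarrow> j \<le> p \<Longrightarrow> f (Suc j) i = f i j"
  shows "(\<Sum>j\<le>Suc p. \<Sum>i\<le>p. frag_cmul ((-1) ^ (j + i)) (f j i)) = 0"
proof -
  have eql: "{..Suc p} \<times> {..p} \<inter> {(x, y). y < x} = (\<lambda>(j,i). (Suc i, j)) ` {(i,j). i \<le> j \<and> j \<le> p}"
    by (auto simp: image_def) (metis Suc_le_mono less_Suc_eq_le less_imp_Suc_add le_add1)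
  have eqr: "{..Suc p} \<times> {..p} - {(x, y). y < x} = {(i,j). i \<le> j \<and> j \<le> p}"
    by auto
  have eq0: "frag_cmul (-1) a = b \<Longrightarrow> a + b = 0" for a b :: "'a \<Rightarrow>\<^sub>0 int"
    by (simp add: neg_eq_iff_add_eq_0)
  show ?thesis
    apply (simp add: sum.cartesian_product sum.Int_Diff [of "_ \<times> _" _ "{(x,y). y < x}"] del: sum.atMost_Suc)
    apply (rule eq0)
    unfolding frag_cmul_sum prod.case_distrib [of "frag_cmul (-1)"] frag_cmul_cmul eql eqr
    apply (subst sum.reindex)
     apply (force simp: inj_on_def)
    apply (rule sum.cong)
     apply (auto simp: add.commute assms)
    done
qed

text \<open>Degrees count list entries: a list of length \<open>m + 1\<close> is an
  \<open>m\<close>-simplex. The empty list spans the augmentation, so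
  \<open>bd [h] = frag_of []\<close>.\<close>

definition bd :: "'a list \<Rightarrow> 'a list \<Rightarrow>\<^sub>0 int" where
  "bd l = (\<Sum>j<length l. frag_cmul ((-1) ^ j) (frag_of (del j l)))"

abbreviation BD :: "('a list \<Rightarrow>\<^sub>0 int) \<Rightarrow> 'a list \<Rightarrow>\<^sub>0 int" where
  "BD \<equiv> frag_extend bd"

definition prepend :: "'a \<Rightarrow> ('a list \<Rightarrow>\<^sub>0 int) \<Rightarrow> 'a list \<Rightarrow>\<^sub>0 int" where
  "prepend h = frag_extend (\<lambda>l. frag_of (h # l))"

lemma prepend_simps:
  "prepend h 0 = 0" "prepend h (x + y) = prepend h x + prepend h y" "prepend h (x - y) = prepend h x - prepend h y"
  "prepend h (- x) = - prepend h x" "prepend h (frag_cmul a x) = frag_cmul a (prepend h x)"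
  "prepend h (frag_of l) = frag_of (h # l)"
  by (simp_all add: prepend_def frag_extend_add frag_extend_diff frag_extend_minus frag_extend_cmul)

lemma prepend_sum: "finite I \<Longrightarrow> prepend h (sum f I) = (\<Sum>i\<in>I. prepend h (f i))"
  by (simp add: prepend_def frag_extend_sum o_def)

lemma bd_Nil [simp]: "bd [] = 0"
  by (simp add: bd_def)

lemma bd_Cons: "bd (h # l) = frag_of l - prepend h (bd l)"
  by (simp add: bd_def prepend_sum prepend_simps del_0 del_Suc sum.lessThan_Suc_shift flip: sum_negf
           del: sum.lessThan_Suc)

lemma frag_extend_comp: "frag_extend f (frag_extend g x) = frag_extend (\<lambda>a. frag_extend f (g a)) x"
  by (rule frag_induction [of x UNIV]) (auto simp: frag_extend_diff)

lemma frag_extend_fun_diff: "frag_extend (\<lambda>a. f a - g a) x = frag_extend f x - frag_extend g x"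
  by (rule frag_induction [of x UNIV]) (auto simp: frag_extend_diff)

text \<open>Coning with any fixed apex is a contracting homotopy of the augmented complex. Every
  later construction fills a cycle by choosing an apex.\<close>

lemma BD_prepend: "BD (prepend h x) = x - prepend h (BD x)"
  by (rule frag_induction [of x UNIV]) (auto simp: frag_extend_diff prepend_simps bd_Cons)

lemma BD_bd: "BD (bd l) = 0"
  by (induction l) (simp_all add: bd_Cons frag_extend_diff BD_prepend prepend_simps)

lemma keys_frag_extend_subset:
  assumes "\<And>a. a \<in> Poly_Mapping.keys x \<Longrightarrow> Poly_Mapping.keys (f a) \<subseteq> T"
  shows "Poly_Mapping.keys (frag_extend f x) \<subseteq> T"
  using keys_frag_extend[of f x] assms by blast

lemma keys_bd:
  assumes "l \<in> tuples H (Suc n)"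
  shows "Poly_Mapping.keys (bd l) \<subseteq> tuples H n"
proof -
  have "Poly_Mapping.keys (bd l) \<subseteq> (\<Union>j<length l. Poly_Mapping.keys (frag_cmul ((-1) ^ j) (frag_of (del j l))))"
    unfolding bd_def by (rule keys_sum)
  also have "\<dots> \<subseteq> tuples H n"
    using assms del_in_tuples[OF assms] by (fastforce simp: tuples_def[of _ "Suc n"])
  finally show ?thesis .
qed

lemma keys_BD:
  assumes "Poly_Mapping.keys x \<subseteq> tuples H (Suc n)"
  shows "Poly_Mapping.keys (BD x) \<subseteq> tuples H n"
  using assms keys_bd by (intro keys_frag_extend_subset) blast

lemma keys_prepend:
  assumes "h \<in> carrier H" "Poly_Mapping.keys x \<subseteq> tuples H n"
  shows "Poly_Mapping.keys (prepend h x) \<subseteq> tuples H (Suc n)"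
  unfolding prepend_def using assms by (intro keys_frag_extend_subset) (auto simp: tuples_def subset_iff)

text \<open>With \<open>a\<close> a left translation this is the action of the group on the bar
  complex.\<close>

definition relabel :: "('a \<Rightarrow> 'b) \<Rightarrow> ('a list \<Rightarrow>\<^sub>0 int) \<Rightarrow> 'b list \<Rightarrow>\<^sub>0 int" where
  "relabel a = frag_extend (\<lambda>l. frag_of (map a l))"

lemma relabel_simps:
  "relabel a 0 = 0" "relabel a (x + y) = relabel a x + relabel a y"
  "relabel a (x - y) = relabel a x - relabel a y"
  "relabel a (frag_cmul c x) = frag_cmul c (relabel a x)"
  "relabel a (frag_of l) = frag_of (map a l)"
  by (simp_all add: relabel_def frag_extend_add frag_extend_diff frag_extend_cmul)

lemma relabel_prepend: "relabel a (prepend h x) = prepend (a h) (relabel a x)"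
  by (rule frag_induction [of x UNIV]) (auto simp: relabel_simps prepend_simps)

lemma relabel_bd: "relabel a (bd l) = bd (map a l)"
  by (induction l) (simp_all add: bd_Cons relabel_simps relabel_prepend)

lemma keys_relabel:
  assumes "\<And>x. x \<in> carrier H \<Longrightarrow> a x \<in> carrier K" "Poly_Mapping.keys x \<subseteq> tuples H n"
  shows "Poly_Mapping.keys (relabel a x) \<subseteq> tuples K n"
  unfolding relabel_def using assms by (intro keys_frag_extend_subset) (auto simp: tuples_def subset_iff)

text \<open>The chain endomorphism \<open>nrm\<close> is built by coning off with the first vertex, which forces it to
  kill all tuples with two equal neighbours.\<close>

primrec nrm :: "nat \<Rightarrow> 'a list \<Rightarrow> 'a list \<Rightarrow>\<^sub>0 int" where
  "nrm 0 l = frag_of []"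
| "nrm (Suc n) l = prepend (hd l) (frag_extend (nrm n) (bd l))"

lemma BD_nrm: "length l = Suc n \<Longrightarrow> BD (nrm (Suc n) l) = frag_extend (nrm n) (bd l)"
proof (induction n arbitrary: l)
  case 0
  then obtain h where "l = [h]" by (metis length_0_conv length_Suc_conv)
  then show ?case by (simp add: bd_Cons prepend_simps)
next
  case (Suc n)
  \<comment> \<open>An ad hoc structure with carrier \<open>UNIV\<close>, for which
    \<open>tuples ?U\<close> records nothing but the length of a list.\<close>
  let ?U = "\<lparr>carrier = UNIV, monoid.mult = undefined, one = undefined\<rparr>"
  have k: "Poly_Mapping.keys (bd l) \<subseteq> tuples ?U (Suc n)"
    using Suc.prems by (intro keys_bd) (auto simp: tuples_def)
  have "BD (frag_extend (nrm (Suc n)) (bd l)) = frag_extend (\<lambda>l. BD (nrm (Suc n) l)) (bd l)"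
    by (rule frag_extend_comp)
  also have "\<dots> = frag_extend (\<lambda>l. frag_extend (nrm n) (bd l)) (bd l)"
    using k by (intro frag_extend_eq Suc.IH) (auto simp: tuples_def)
  also have "\<dots> = 0"
    using BD_bd[of l] by (simp flip: frag_extend_comp)
  finally show ?case
    by (simp add: nrm.simps(2)[of "Suc n"] BD_prepend prepend_simps del: nrm.simps)
qed

lemma keys_nrm: "l \<in> tuples H n \<Longrightarrow> Poly_Mapping.keys (nrm n l) \<subseteq> tuples H n"
proof (induction n arbitrary: l)
  case (Suc n)
  then have "hd l \<in> carrier H" by (cases l) (auto simp: tuples_def)
  then show ?case
    unfolding nrm.simps using keys_bd[OF Suc.prems] Suc.IH
    by (intro keys_prepend keys_frag_extend_subset) auto
qed (simp add: tuples_def)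

lemma relabel_nrm: "length l = n \<Longrightarrow> relabel a (nrm n l) = nrm n (map a l)"
proof (induction n arbitrary: l)
  case (Suc n)
  let ?U = "\<lparr>carrier = UNIV, monoid.mult = undefined, one = undefined\<rparr>"
  have k: "Poly_Mapping.keys (bd l) \<subseteq> tuples ?U n"
    using Suc.prems by (intro keys_bd) (auto simp: tuples_def)
  have "relabel a (frag_extend (nrm n) (bd l)) = frag_extend (\<lambda>l. relabel a (nrm n l)) (bd l)"
    unfolding relabel_def by (rule frag_extend_comp)
  also have "\<dots> = frag_extend (\<lambda>l. nrm n (map a l)) (bd l)"
    using k by (intro frag_extend_eq Suc.IH) (auto simp: tuples_def)
  also have "\<dots> = frag_extend (nrm n) (relabel a (bd l))"
    by (simp add: relabel_def frag_extend_comp)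
  finally show ?case using Suc.prems by (cases l) (simp_all add: relabel_prepend relabel_bd)
qed (simp add: relabel_simps)

text \<open>If the entries \<open>i\<close> and \<open>Suc i\<close> agree, all faces other than
  these two still have equal neighbours and vanish by induction, while the two remaining faces are
  the same list with opposite signs.\<close>

lemma nrm_eq_0:
  assumes "\<not> distinct_adj l"
  shows "nrm (length l) l = 0"
  using assms
proof (induction "length l" arbitrary: l)
  case 0
  then show ?case by simp
next
  case (Suc n)
  obtain i where i: "Suc i < length l" "l ! i = l ! Suc i"
    using Suc.prems by (auto simp: distinct_adj_conv_nth)
  have ni: "n = Suc (n - 1)" "i < n" using i Suc(2) by linarith+
  have len: "length (del j l) = n" if "j \<le> n" for j
    using that Suc(2) by (simp add: length_del)
  have deg: "nrm n (del j l) = 0" if "j \<le> n" "j \<noteq> i" "j \<noteq> Suc i" for j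
  proof -
    have "\<not> distinct_adj (del j l)"
    proof (cases "j < i")
      case True
      then have "del j l ! (i - 1) = del j l ! (Suc (i - 1))"
        using i Suc(2) that ni True by (cases i) (auto simp: nth_del)
      then show ?thesis using True ni len[OF that(1)]
        by (auto simp: distinct_adj_conv_nth intro!: exI[of _ "i - 1"])
    next
      case False
      then have "del j l ! i = del j l ! Suc i"
        using i Suc(2) that ni by (simp add: nth_del)
      then show ?thesis using False ni len[OF that(1)] that
        by (auto simp: distinct_adj_conv_nth intro!: exI[of _ i])
    qed
    then show ?thesis using Suc.hyps(1)[of "del j l"] len[OF that(1)] by simp
  qed
  have same: "del i l = del (Suc i) l"
    using i Suc(2) ni by (intro nth_equalityI) (auto simp: length_del nth_del less_Suc_eq)
  have "frag_extend (nrm n) (bd l) = (\<Sum>j<length l. frag_cmul ((-1) ^ j) (nrm n (del j l)))"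
    by (simp add: bd_def frag_extend_sum frag_extend_cmul o_def)
  also have "\<dots> = (\<Sum>j\<in>{i, Suc i}. frag_cmul ((-1) ^ j) (nrm n (del j l)))"
    using i deg Suc(2) by (intro sum.mono_neutral_right) auto
  also have "\<dots> = 0"
    by (simp add: same flip: frag_cmul_distrib)
  finally show ?case using Suc(2)[symmetric] by (simp add: prepend_simps)
qed

section \<open>Group cohomology\<close>

locale plain_group = group G for G :: "'g monoid" (structure)
begin

text \<open>From homogeneous to inhomogeneous coordinates; \<open>pprod g\<close> goes back. The
  differences describe the orbit of a tuple under left translation, and \<open>pprod \<one>\<close>
  is the representative of the orbit that starts at the unit.\<close>

fun diffs :: "'g list \<Rightarrow> 'g list" where
  "diffs (a # b # l) = (inv a \<otimes> b) # diffs (b # l)"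
| "diffs _ = []"

fun pprod :: "'g \<Rightarrow> 'g list \<Rightarrow> 'g list" where
  "pprod g [] = [g]"
| "pprod g (x # xs) = g # pprod (g \<otimes> x) xs"

lemma length_pprod [simp]: "length (pprod g xs) = Suc (length xs)"
  by (induction g xs rule: pprod.induct) auto

lemma hd_pprod [simp]: "hd (pprod g xs) = g" and pprod_neq_Nil [simp]: "pprod g xs \<noteq> []"
  by (cases xs; simp)+

lemma pprod_in_tuples: "g \<in> carrier G \<Longrightarrow> xs \<in> tuples G n \<Longrightarrow> pprod g xs \<in> tuples G (Suc n)"
  by (induction g xs arbitrary: n rule: pprod.induct) (auto simp: tuples_def)

lemma diffs_pprod:
  "g \<in> carrier G \<Longrightarrow> set xs \<subseteq> carrier G \<Longrightarrow> diffs (pprod g xs) = xs"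
proof (induction xs arbitrary: g)
  case (Cons x xs)
  obtain ys where ys: "pprod (g \<otimes> x) xs = (g \<otimes> x) # ys"
    by (metis hd_pprod list.collapse pprod_neq_Nil)
  show ?case
    using Cons.IH[of "g \<otimes> x"] Cons.prems by (simp add: ys m_assoc[symmetric])
qed simp

lemma pprod_diffs:
  "set l \<subseteq> carrier G \<Longrightarrow> l \<noteq> [] \<Longrightarrow> pprod (hd l) (diffs l) = l"
  by (induction l rule: diffs.induct) (auto simp: m_assoc[symmetric])

lemma diffs_in_tuples: "l \<in> tuples G (Suc n) \<Longrightarrow> diffs l \<in> tuples G n"
  by (induction l arbitrary: n rule: diffs.induct) 
     (auto simp: tuples_def length_Suc_conv)

lemma map_pprod:
  "h \<in> carrier G \<Longrightarrow> g \<in> carrier G \<Longrightarrow> set xs \<subseteq> carrier G \<Longrightarrow>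
     map ((\<otimes>) h) (pprod g xs) = pprod (h \<otimes> g) xs"
  by (induction xs arbitrary: g) (auto simp: m_assoc)

lemma diffs_map: 
  "h \<in> carrier G \<Longrightarrow> set l \<subseteq> carrier G \<Longrightarrow> diffs (map ((\<otimes>) h) l) = diffs l"
  by (induction l rule: diffs.induct) (auto simp: inv_mult_group m_assoc inv_solve_left')

lemma map_in_tuples: "h \<in> carrier G \<Longrightarrow> l \<in> tuples G n \<Longrightarrow> map ((\<otimes>) h) l \<in> tuples G n"
  by (auto simp: tuples_def)

lemma del_last_pprod: "length xs = Suc n \<Longrightarrow> del (Suc n) (pprod g xs) = pprod g (butlast xs)"
proof (induction xs arbitrary: g n)
  case (Cons x xs)
  show ?case
  proof (cases n)
    case 0
    then show ?thesis using Cons.prems by (simp add: del_def)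
  next
    case (Suc m)
    then show ?thesis using Cons.prems Cons.IH[of m] by (auto simp: del_Suc)
  qed
qed simp

lemma merge_at_Cons: "0 < i \<Longrightarrow> merge_at G (Suc i) (x # xs) = x # merge_at G i xs"
  by (cases i) (auto simp: merge_at_def)

text \<open>Removing an inner vertex multiplies the two differences on either side of it, which is
  the inner term of the inhomogeneous coboundary.\<close>

lemma del_merge_at:
  "1 \<le> i \<Longrightarrow> i < length xs \<Longrightarrow> g \<in> carrier G \<Longrightarrow> set xs \<subseteq> carrier G \<Longrightarrow>
     del i (pprod g xs) = pprod g (merge_at G i xs)"
proof (induction xs arbitrary: g i)
  case (Cons x xs)
  show ?case
  proof (cases "i = 1")
    case True
    then obtain y ys where "xs = y # ys"
      using Cons.prems by (cases xs) auto
    then show ?thesis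
      using True Cons.prems by (simp add: del_def merge_at_def m_assoc)
  next
    case False
    then obtain j where j: "i = Suc j" "1 \<le> j"
      using Cons.prems by (cases i) auto
    then show ?thesis
      using Cons.prems Cons.IH[of j "g \<otimes> x"] by (simp add: del_Suc merge_at_Cons)
  qed
qed simp

lemma merge_at_in_tuples:
  "1 \<le> i \<Longrightarrow> i \<le> n \<Longrightarrow> xs \<in> tuples G (Suc n) \<Longrightarrow> merge_at G i xs \<in> tuples G n"
  by (auto simp: tuples_def merge_at_def dest: in_set_takeD in_set_dropD
    intro!: m_closed subsetD[OF _ nth_mem])

end

lemma keys_diff_subset:
  "Poly_Mapping.keys x \<subseteq> T \<Longrightarrow> Poly_Mapping.keys y \<subseteq> T \<Longrightarrow> Poly_Mapping.keys (x - y) \<subseteq> T"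
  using keys_diff[of x y] by blast

lemma hom_lincomb:
  assumes "abelian_group M" and \<phi>: "\<phi> \<in> hom (free_Abelian_group S) (add_monoid M)"
    and "finite I" "\<And>i. i \<in> I \<Longrightarrow> l i \<in> S"
  shows "\<phi> (\<Sum>i\<in>I. frag_cmul (a i) (frag_of (l i))) = (\<Oplus>\<^bsub>M\<^esub>i\<in>I. add_pow M (a i) (\<phi> (frag_of (l i))))"
proof -
  interpret M: abelian_group M by fact
  interpret \<phi>: group_hom "free_Abelian_group S" "add_monoid M" \<phi>
    using \<phi> M.a_group by (simp add: group_hom_def group_hom_axioms_def)
  have c: "\<phi> x \<in> carrier M" if "Poly_Mapping.keys x \<subseteq> S" for x
    using \<phi>.hom_closed that by simp
  have cm: "\<phi> (frag_cmul n (frag_of s)) = add_pow M n (\<phi> (frag_of s))" if "s \<in> S" for n :: int and s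
    using \<phi>.hom_int_pow[of "frag_of s" n] that by (simp add: add_pow_def)
  show ?thesis
    using assms(3,4)
  proof (induction I rule: finite_induct)
    case empty
    then show ?case using \<phi>.hom_one by simp
  next
    case (insert i I)
    have k: "Poly_Mapping.keys (\<Sum>i\<in>I. frag_cmul (a i) (frag_of (l i))) \<subseteq> S"
      using insert.prems by (intro order_trans[OF keys_sum]) auto
    have f: "(\<lambda>i. add_pow M (a i) (\<phi> (frag_of (l i)))) \<in> I \<rightarrow> carrier M"
      using insert.prems c by (auto intro!: M.add.int_pow_closed)
    have k': "Poly_Mapping.keys (frag_cmul (a i) (frag_of (l i))) \<subseteq> S"
      using insert.prems by (intro subsetI) auto
    have "\<phi> (frag_cmul (a i) (frag_of (l i)) + (\<Sum>i\<in>I. frag_cmul (a i) (frag_of (l i))))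
        = \<phi> (frag_cmul (a i) (frag_of (l i))) \<oplus>\<^bsub>M\<^esub> \<phi> (\<Sum>i\<in>I. frag_cmul (a i) (frag_of (l i)))"
      using \<phi>.hom_mult[of "frag_cmul (a i) (frag_of (l i))" "\<Sum>i\<in>I. frag_cmul (a i) (frag_of (l i))"] k k'
      by simp
    then show ?case
      using insert f c by (simp add: M.finsum_insert cm)
  qed
qed

text \<open>\<open>S\<close> is homotopic to the identity, by \<open>E\<close>, because coning off with the first vertex is
  equivariant. An equivariant cocycle in a degree above \<open>N\<close> is therefore a coboundary.\<close>

locale equivariant_contraction = plain_group G for G :: "'g monoid" (structure) +
  fixes S :: "nat \<Rightarrow> 'g list \<Rightarrow> 'g list \<Rightarrow>\<^sub>0 int" and N :: nat
  assumes S_Nil: "S 0 [] = frag_of []"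
    and S_bd: "l \<in> tuples G (Suc n) \<Longrightarrow> BD (S (Suc n) l) = frag_extend (S n) (bd l)"
    and keys_S: "l \<in> tuples G n \<Longrightarrow> Poly_Mapping.keys (S n l) \<subseteq> tuples G n"
    and S_map: "h \<in> carrier G \<Longrightarrow> l \<in> tuples G n \<Longrightarrow> S n (map ((\<otimes>) h) l) = relabel ((\<otimes>) h) (S n l)"
    and S_eq_0: "l \<in> tuples G n \<Longrightarrow> N < n \<Longrightarrow> S n l = 0"
begin

primrec E :: "nat \<Rightarrow> 'g list \<Rightarrow> 'g list \<Rightarrow>\<^sub>0 int" where
  "E 0 l = 0"
| "E (Suc n) l = prepend (hd l) (frag_of l - S (Suc n) l - frag_extend (E n) (bd l))"

lemma keys_E: "l \<in> tuples G n \<Longrightarrow> Poly_Mapping.keys (E n l) \<subseteq> tuples G (Suc n)"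
proof (induction n arbitrary: l)
  case (Suc n)
  have h: "hd l \<in> carrier G" using Suc.prems by (cases l) (auto simp: tuples_def)
  have "Poly_Mapping.keys (frag_extend (E n) (bd l)) \<subseteq> tuples G (Suc n)"
    using keys_bd[OF Suc.prems] Suc.IH by (intro keys_frag_extend_subset) auto
  then have "Poly_Mapping.keys (frag_of l - S (Suc n) l - frag_extend (E n) (bd l)) \<subseteq> tuples G (Suc n)"
    using keys_S[OF Suc.prems] Suc.prems
    by (intro order_trans[OF keys_diff] Un_least) auto
  then show ?case
    unfolding E.simps by (intro keys_prepend h)
qed simp

text \<open>The chain that \<open>E\<close> cones off is a cycle, by the induction hypothesis,
  \<open>S_bd\<close> and \<open>BD_bd\<close>, so taking the boundary merely strips the apex. The
  induction can start with \<open>E 0 = 0\<close> because \<open>S\<close> fixes the generator of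
  the augmentation.\<close>

lemma homotopy_E:
  "l \<in> tuples G (Suc n) \<Longrightarrow> BD (E (Suc n) l) = frag_of l - S (Suc n) l - frag_extend (E n) (bd l)"
proof (induction n arbitrary: l)
  case 0
  then obtain h where l: "l = [h]" by (auto simp: tuples_def length_Suc_conv)
  have "BD (S (Suc 0) l) = frag_of []"
    using S_bd[OF 0] S_Nil by (simp add: l bd_Cons prepend_simps)
  then show ?case by (simp add: l BD_prepend bd_Cons prepend_simps frag_extend_diff S_Nil)
next
  case (Suc n)
  have "BD (frag_extend (E (Suc n)) (bd l)) = frag_extend (\<lambda>l. BD (E (Suc n) l)) (bd l)"
    by (rule frag_extend_comp)
  also have "\<dots> = frag_extend (\<lambda>l. frag_of l - S (Suc n) l - frag_extend (E n) (bd l)) (bd l)"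
    using keys_bd[OF Suc.prems] Suc.IH by (intro frag_extend_eq) auto
  also have "\<dots> = bd l - frag_extend (S (Suc n)) (bd l)"
    using BD_bd[of l] by (simp add: frag_extend_fun_diff flip: frag_extend_comp frag_expansion)
  finally have "BD (frag_of l - S (Suc (Suc n)) l - frag_extend (E (Suc n)) (bd l)) = 0"
    using S_bd[OF Suc.prems] by (simp add: frag_extend_diff del: E.simps)
  then show ?case
    unfolding E.simps(2)[of "Suc n"] BD_prepend by (simp add: prepend_simps del: E.simps)
qed

lemma E_map: "h \<in> carrier G \<Longrightarrow> l \<in> tuples G n \<Longrightarrow> E n (map ((\<otimes>) h) l) = relabel ((\<otimes>) h) (E n l)"
proof (induction n arbitrary: l)
  case (Suc n)
  have "frag_extend (E n) (bd (map ((\<otimes>) h) l)) = frag_extend (\<lambda>l. E n (map ((\<otimes>) h) l)) (bd l)"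
    by (simp add: relabel_def frag_extend_comp flip: relabel_bd)
  also have "\<dots> = frag_extend (\<lambda>l. relabel ((\<otimes>) h) (E n l)) (bd l)"
    using keys_bd[OF Suc.prems(2)] Suc.IH Suc.prems by (intro frag_extend_eq) auto
  also have "\<dots> = relabel ((\<otimes>) h) (frag_extend (E n) (bd l))"
    by (simp add: relabel_def frag_extend_comp)
  finally show ?case
    using Suc.prems S_map[OF Suc.prems]
    by (cases l) (auto simp: tuples_def relabel_prepend relabel_simps)
qed (simp add: relabel_simps)

end

context plain_group
begin

text \<open>An equivariant cochain is determined by its values on tuples that start at the unit. On
  these, the homogeneous boundary becomes the inhomogeneous formula face by face.\<close>

lemma coboundary_eq:
  fixes M :: "('g, 'm) module"
  assumes M: "group_ring_module G M" and \<phi>: "\<phi> \<in> hom (free_Abelian_group (tuples G (Suc n))) (add_monoid M)"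
    and equiv: "\<And>h l. h \<in> carrier G \<Longrightarrow> l \<in> tuples G (Suc n) \<Longrightarrow>
        \<phi> (frag_of (map ((\<otimes>) h) l)) = h \<odot>\<^bsub>M\<^esub> \<phi> (frag_of l)"
    and c: "\<And>xs. xs \<in> tuples G n \<Longrightarrow> c xs = \<phi> (frag_of (pprod \<one> xs))"
    and xs: "xs \<in> tuples G (Suc n)"
  shows "coboundary G M n c xs = \<phi> (bd (pprod \<one> xs))"
proof -
  interpret M: abelian_group M using M by (simp add: group_ring_module_def)
  let ?l = "pprod \<one> xs"
  have l: "?l \<in> tuples G (Suc (Suc n))"
    using xs by (simp add: pprod_in_tuples)
  have cl: "\<phi> (frag_of l) \<in> carrier M" if "l \<in> tuples G (Suc n)" for l
    using hom_in_carrier[OF \<phi>, of "frag_of l"] that by simp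
  define t where "t = (\<lambda>j. add_pow M ((-1::int) ^ j) (\<phi> (frag_of (del j ?l))))"
  have t: "t j \<in> carrier M" if "j \<le> Suc n" for j
    unfolding t_def using that l by (intro M.add.int_pow_closed cl del_in_tuples)
  have "\<phi> (bd ?l) = (\<Oplus>\<^bsub>M\<^esub>j\<in>{..<length ?l}. t j)"
    unfolding bd_def t_def using M.abelian_group_axioms \<phi>
  proof (rule hom_lincomb)
    show "del j ?l \<in> tuples G (Suc n)" if "j \<in> {..<length ?l}" for j
      using that l xs by (intro del_in_tuples) (auto simp: tuples_def)
  qed simp
  also have "{..<length ?l} = insert 0 (insert (Suc n) {1..n})"
    using xs by (auto simp: tuples_def)
  also have "(\<Oplus>\<^bsub>M\<^esub>j\<in>insert 0 (insert (Suc n) {1..n}). t j) = t 0 \<oplus>\<^bsub>M\<^esub> (t (Suc n) \<oplus>\<^bsub>M\<^esub> (\<Oplus>\<^bsub>M\<^esub>j\<in>{1..n}. t j))"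
    using t by (subst M.finsum_insert; (subst M.finsum_insert)?) (auto simp: Pi_iff)
  also have "\<dots> = t 0 \<oplus>\<^bsub>M\<^esub> (\<Oplus>\<^bsub>M\<^esub>j\<in>{1..n}. t j) \<oplus>\<^bsub>M\<^esub> t (Suc n)"
    using t by (simp add: M.a_ac Pi_iff)
  also have "t (Suc n) = add_pow M ((-1::int) ^ Suc n) (c (butlast xs))"
  proof -
    have "butlast xs \<in> tuples G n"
      using xs by (auto simp: tuples_def dest: in_set_butlastD)
    then show ?thesis
      using xs del_last_pprod[of xs n \<one>] c by (simp add: tuples_def t_def)
  qed
  also have "(\<Oplus>\<^bsub>M\<^esub>j\<in>{1..n}. t j) = (\<Oplus>\<^bsub>M\<^esub>j\<in>{1..n}. add_pow M ((-1::int) ^ j) (c (merge_at G j xs)))"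
  proof -
    have "t j = add_pow M ((-1::int) ^ j) (c (merge_at G j xs))" if "j \<in> {1..n}" for j
      using that xs del_merge_at[of j xs \<one>] c merge_at_in_tuples[of j n xs]
      by (auto simp: tuples_def t_def)
    then show ?thesis
      using t by (intro M.finsum_cong') (auto, metis le_SucI)
  qed
  \<comment> \<open>The zeroth face no longer starts at the unit; translating it back by
    equivariance produces the action of \<open>hd xs\<close>.\<close>
  also have "t 0 = hd xs \<odot>\<^bsub>M\<^esub> c (tl xs)"
  proof -
    obtain y ys where ys: "xs = y # ys" "y \<in> carrier G" "ys \<in> tuples G n"
      using xs by (cases xs) (auto simp: tuples_def)
    then have "del 0 ?l = map ((\<otimes>) y) (pprod \<one> ys)"
      using map_pprod[of y \<one> ys] by (simp add: del_0 tuples_def)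
    then have "\<phi> (frag_of (del 0 ?l)) = y \<odot>\<^bsub>M\<^esub> c ys"
      using ys equiv c pprod_in_tuples[of \<one> ys n] by simp
    moreover have "y \<odot>\<^bsub>M\<^esub> c ys \<in> carrier M"
      using M ys c cl pprod_in_tuples[of \<one> ys n] by (simp add: group_ring_module_def)
    ultimately show ?thesis using ys by (simp add: M.add.int_pow_1 t_def)
  qed
  finally show ?thesis using xs by (simp add: coboundary_def)
qed

lemma equivariant_hom:
  fixes M :: "('g, 'm) module"
  assumes M: "group_ring_module G M" and \<phi>: "\<phi> \<in> hom (free_Abelian_group (tuples G n)) (add_monoid M)"
    and equiv: "\<And>l. l \<in> tuples G n \<Longrightarrow> \<phi> (frag_of (map ((\<otimes>) h) l)) = h \<odot>\<^bsub>M\<^esub> \<phi> (frag_of l)"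
    and h: "h \<in> carrier G" and x: "Poly_Mapping.keys x \<subseteq> tuples G n"
  shows "\<phi> (relabel ((\<otimes>) h) x) = h \<odot>\<^bsub>M\<^esub> \<phi> x"
proof -
  interpret M: abelian_group M using M by (simp add: group_ring_module_def)
  interpret \<phi>: group_hom "free_Abelian_group (tuples G n)" "add_monoid M" \<phi>
    using \<phi> M.a_group by (simp add: group_hom_def group_hom_axioms_def)
  have add: "h \<odot>\<^bsub>M\<^esub> (a \<oplus>\<^bsub>M\<^esub> b) = h \<odot>\<^bsub>M\<^esub> a \<oplus>\<^bsub>M\<^esub> h \<odot>\<^bsub>M\<^esub> b" "h \<odot>\<^bsub>M\<^esub> a \<in> carrier M"
    if "a \<in> carrier M" "b \<in> carrier M" for a b
    using M h that by (auto simp: group_ring_module_def)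
  have act_zero: "h \<odot>\<^bsub>M\<^esub> \<zero>\<^bsub>M\<^esub> = \<zero>\<^bsub>M\<^esub>"
    using add[of "\<zero>\<^bsub>M\<^esub>" "\<zero>\<^bsub>M\<^esub>"] by simp
  have minus: "\<phi> (a - b) = \<phi> a \<ominus>\<^bsub>M\<^esub> \<phi> b" if "Poly_Mapping.keys a \<subseteq> tuples G n" "Poly_Mapping.keys b \<subseteq> tuples G n" for a b
    using \<phi>.hom_mult[of a "- b"] \<phi>.hom_inv[of b] that 
    by (simp add: a_minus_def a_inv_def)
  have c: "\<phi> a \<in> carrier M" if "Poly_Mapping.keys a \<subseteq> tuples G n" for a
    using \<phi>.hom_closed that by simp
  have sub: "h \<odot>\<^bsub>M\<^esub> (a \<ominus>\<^bsub>M\<^esub> b) = h \<odot>\<^bsub>M\<^esub> a \<ominus>\<^bsub>M\<^esub> h \<odot>\<^bsub>M\<^esub> b" if "a \<in> carrier M" "b \<in> carrier M" for a b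
  proof -
    have "h \<odot>\<^bsub>M\<^esub> (a \<ominus>\<^bsub>M\<^esub> b) \<oplus>\<^bsub>M\<^esub> h \<odot>\<^bsub>M\<^esub> b = h \<odot>\<^bsub>M\<^esub> a"
      using that add(1)[of "a \<ominus>\<^bsub>M\<^esub> b" b] by (simp add: a_minus_def M.a_assoc M.l_neg)
    then show ?thesis
      using that add(2) by (metis M.add.inv_solve_right M.minus_closed a_minus_def)
  qed
  show ?thesis
    using x
  proof (induction rule: free_Abelian_group_induct[consumes 1, case_names zero diff of])
    case zero
    then show ?case using \<phi>.hom_one act_zero by (simp add: relabel_simps)
  next
    case (diff x y)
    then show ?case
      using keys_relabel[of G "(\<otimes>) h" G] h by (simp add: relabel_simps minus sub c)
  next
    case (of a)
    then show ?case using equiv by (simp add: relabel_simps)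
  qed
qed

end

text \<open>Let \<open>\<phi>\<close> be the equivariant form of \<open>c\<close>. Since
  \<open>\<phi>\<close> vanishes on boundaries and \<open>S (Suc n)\<close> is zero, applying
  \<open>\<phi>\<close> to the homotopy \<open>E\<close> shows that \<open>\<phi>\<close> is the
  coboundary of its composite with \<open>E n\<close>. The bound is \<open>N \<le> n\<close> because
  cochains of degree \<open>n\<close> live on lists of length \<open>Suc n\<close>.\<close>

theorem (in equivariant_contraction) cocycle_is_coboundary:
  fixes M :: "('g, 'm) module"
  assumes M: "group_ring_module G M" and n: "N \<le> n" and n0: "n = Suc n'"
    and c: "c \<in> carrier (cochain_group G M n)"
    and cocycle: "coboundary G M n c = \<one>\<^bsub>cochain_group G M (Suc n)\<^esub>"
  shows "\<exists>b\<in>carrier (cochain_group G M n'). coboundary G M n' b = c"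
proof -
  interpret M: abelian_group M using M by (simp add: group_ring_module_def)
  \<comment> \<open>The homogeneous form of \<open>c\<close>: equivariant, and equal to
    \<open>c xs\<close> at \<open>pprod \<one> xs\<close>.\<close>
  let ?C = "\<lambda>l. hd l \<odot>\<^bsub>M\<^esub> c (diffs l)"
  have act: "g \<odot>\<^bsub>M\<^esub> m \<in> carrier M" if "g \<in> carrier G" "m \<in> carrier M" for g m
    using M that by (simp add: group_ring_module_def)
  have hd: "hd l \<in> carrier G" if "l \<in> tuples G (Suc m)" for l m
    using that by (cases l) (auto simp: tuples_def)
  have c': "c xs \<in> carrier M" if "xs \<in> tuples G n" for xs
    using c that by (auto simp: cochain_group_def)
  have "?C ` tuples G (Suc n) \<subseteq> carrier (add_monoid M)"
    using hd act c' diffs_in_tuples by auto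
  then obtain \<phi> where \<phi>: "\<phi> \<in> hom (free_Abelian_group (tuples G (Suc n))) (add_monoid M)"
      and \<phi>_of: "\<And>l. l \<in> tuples G (Suc n) \<Longrightarrow> \<phi> (frag_of l) = ?C l"
    by (rule comm_group.free_Abelian_group_universal[OF M.a_comm_group]) blast
  have equiv: "\<phi> (frag_of (map ((\<otimes>) h) l)) = h \<odot>\<^bsub>M\<^esub> \<phi> (frag_of l)"
    if "h \<in> carrier G" "l \<in> tuples G (Suc n)" for h l
  proof -
    have "hd (map ((\<otimes>) h) l) = h \<otimes> hd l"
      using that by (cases l) (auto simp: tuples_def)
    then show ?thesis
      using that M hd[OF that(2)] diffs_in_tuples[OF that(2)] c' diffs_map[of h l] map_in_tuples[of h l]
      by (simp add: \<phi>_of group_ring_module_def tuples_def)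
  qed
  have bd0: "\<phi> (bd l) = \<zero>\<^bsub>M\<^esub>" if l: "l \<in> tuples G (Suc (Suc n))" for l
  proof -
    let ?xs = "diffs l"
    have xs: "?xs \<in> tuples G (Suc n)" using l by (rule diffs_in_tuples)
    have p: "pprod \<one> ?xs \<in> tuples G (Suc (Suc n))"
      using xs by (simp add: pprod_in_tuples)
    have "l = map ((\<otimes>) (hd l)) (pprod \<one> ?xs)"
      using map_pprod[of "hd l" \<one> ?xs] pprod_diffs[of l] l hd[OF l] xs
      by (cases l) (auto simp: tuples_def)
    then have "\<phi> (bd l) = \<phi> (relabel ((\<otimes>) (hd l)) (bd (pprod \<one> ?xs)))"
      by (metis relabel_bd)
    also have "\<dots> = hd l \<odot>\<^bsub>M\<^esub> \<phi> (bd (pprod \<one> ?xs))"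
      using M \<phi> equiv hd[OF l] keys_bd[OF p] by (intro equivariant_hom) auto
    also have "\<phi> (bd (pprod \<one> ?xs)) = coboundary G M n c ?xs"
      using M \<phi> equiv
    proof (rule coboundary_eq[symmetric])
      show "c ys = \<phi> (frag_of (pprod \<one> ys))" if "ys \<in> tuples G n" for ys
        using that \<phi>_of pprod_in_tuples[of \<one> ys n] diffs_pprod[of \<one> ys] c'[OF that] M
        by (simp add: tuples_def group_ring_module_def)
    qed (use xs in auto)
    also have "\<dots> = \<zero>\<^bsub>M\<^esub>"
      using xs by (simp add: cocycle cochain_group_def)
    finally show ?thesis
      using equivariant_hom[OF M \<phi>, of "hd l" 0] equiv hd[OF l] M.a_group \<phi> hom_one[OF \<phi>]
      by (simp add: relabel_simps)
  qed
  have BD0: "\<phi> (BD x) = \<zero>\<^bsub>M\<^esub>" if "Poly_Mapping.keys x \<subseteq> tuples G (Suc (Suc n))" for x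
    using that
  proof (induction rule: free_Abelian_group_induct[consumes 1, case_names zero diff of])
    case zero
    then show ?case using hom_one[OF \<phi>] M.a_group by simp
  next
    case (diff x y)
    have "\<phi> (BD (x - y) + BD y) = \<phi> (BD (x - y)) \<oplus>\<^bsub>M\<^esub> \<phi> (BD y)"
      using hom_mult[OF \<phi>, of "BD (x - y)" "BD y"] keys_BD[OF diff(1)] keys_BD[OF diff(2)]
      by (simp add: frag_extend_diff keys_diff_subset)
    moreover have "\<phi> (BD (x - y)) \<in> carrier M"
      using hom_in_carrier[OF \<phi>, of "BD (x - y)"] keys_BD[OF diff(1)] keys_BD[OF diff(2)]
      by (simp add: frag_extend_diff keys_diff_subset)
    ultimately show ?case using diff by (simp add: frag_extend_diff)
  next
    case (of l)
    then show ?case using bd0 by simp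
  qed
  define \<psi> where "\<psi> x = \<phi> (frag_extend (E n) x)" for x
  have \<psi>: "\<psi> \<in> hom (free_Abelian_group (tuples G n)) (add_monoid M)"
  proof (rule homI)
    have k: "Poly_Mapping.keys (frag_extend (E n) x) \<subseteq> tuples G (Suc n)"
      if "x \<in> carrier (free_Abelian_group (tuples G n))" for x
      using that keys_E by (intro keys_frag_extend_subset) auto
    show "\<psi> x \<in> carrier (add_monoid M)" if "x \<in> carrier (free_Abelian_group (tuples G n))" for x
      using hom_in_carrier[OF \<phi>, of "frag_extend (E n) x"] k[OF that] by (simp add: \<psi>_def)
    show "\<psi> (x \<otimes>\<^bsub>free_Abelian_group (tuples G n)\<^esub> y) = \<psi> x \<otimes>\<^bsub>add_monoid M\<^esub> \<psi> y"
      if "x \<in> carrier (free_Abelian_group (tuples G n))" "y \<in> carrier (free_Abelian_group (tuples G n))" for x y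
      using hom_mult[OF \<phi>, of "frag_extend (E n) x" "frag_extend (E n) y"] k that
      by (simp add: \<psi>_def frag_extend_add)
  qed
  define b where "b = (\<lambda>xs\<in>tuples G n'. \<psi> (frag_of (pprod \<one> xs)))"
  have "b \<in> carrier (cochain_group G M n')"
    using hom_in_carrier[OF \<psi>] pprod_in_tuples[of \<one> _ n']
    by (auto simp: b_def cochain_group_def n0)
  moreover have "coboundary G M n' b = c"
  proof (rule extensionalityI)
    show "coboundary G M n' b \<in> extensional (tuples G n)"
      by (simp add: coboundary_def n0)
    show "c \<in> extensional (tuples G n)"
      using c by (auto simp: cochain_group_def PiE_iff)
    fix xs assume xs: "xs \<in> tuples G n"
    let ?l = "pprod \<one> xs"
    have l: "?l \<in> tuples G (Suc n)" using xs by (simp add: pprod_in_tuples)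
    have "coboundary G M n' b xs = \<psi> (bd ?l)"
    proof (rule coboundary_eq[OF M \<psi>[unfolded n0]])
      show "\<psi> (frag_of (map ((\<otimes>) h) l)) = h \<odot>\<^bsub>M\<^esub> \<psi> (frag_of l)"
        if "h \<in> carrier G" "l \<in> tuples G (Suc n')" for h l
        unfolding \<psi>_def frag_extend_of E_map[OF that[folded n0]]
        using that keys_E[of l n] n0 by (intro equivariant_hom[OF M \<phi>] equiv) auto
    qed (use xs n0 in \<open>auto simp: b_def\<close>)
    also have "\<dots> = \<phi> (frag_of ?l - BD (E (Suc n) ?l))"
    proof -
      have "frag_extend (E n) (bd ?l) = frag_of ?l - BD (E (Suc n) ?l)"
        unfolding homotopy_E[OF l] using S_eq_0[OF l] n by (simp del: E.simps)
      then show ?thesis unfolding \<psi>_def by (rule arg_cong)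
    qed
    also have "\<dots> = \<phi> (frag_of ?l)"
    proof -
      have k: "Poly_Mapping.keys (BD (E (Suc n) ?l)) \<subseteq> tuples G (Suc n)"
        using keys_BD[OF keys_E[OF l]] .
      have k': "Poly_Mapping.keys (frag_of ?l - BD (E (Suc n) ?l)) \<subseteq> tuples G (Suc n)"
        using k l by (intro order_trans[OF keys_diff] Un_least) auto
      have "\<phi> (frag_of ?l - BD (E (Suc n) ?l) + BD (E (Suc n) ?l))
          = \<phi> (frag_of ?l - BD (E (Suc n) ?l)) \<oplus>\<^bsub>M\<^esub> \<phi> (BD (E (Suc n) ?l))"
        using hom_mult[OF \<phi>, of "frag_of ?l - BD (E (Suc n) ?l)" "BD (E (Suc n) ?l)"] k k' by simp
      moreover have "\<phi> (frag_of ?l - BD (E (Suc n) ?l)) \<in> carrier M"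
        using hom_in_carrier[OF \<phi>] k' by simp
      ultimately show ?thesis
        using BD0[OF keys_E[OF l]] by simp
    qed
    also have "\<dots> = c xs"
      using \<phi>_of[OF l] diffs_pprod[of \<one> xs] xs c'[OF xs] M
      by (simp add: tuples_def group_ring_module_def)
    finally show "coboundary G M n' b xs = c xs" .
  qed
  ultimately show ?thesis by blast
qed

context plain_group
begin

lemma cochain_group_simps:
  "carrier (cochain_group G M n) = tuples G n \<rightarrow>\<^sub>E carrier M"
  "c \<otimes>\<^bsub>cochain_group G M n\<^esub> d = (\<lambda>xs\<in>tuples G n. c xs \<oplus>\<^bsub>M\<^esub> d xs)"
  "\<one>\<^bsub>cochain_group G M n\<^esub> = (\<lambda>xs\<in>tuples G n. \<zero>\<^bsub>M\<^esub>)"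
  by (simp_all add: cochain_group_def)

lemma comm_group_cochain_group:
  assumes "abelian_group M"
  shows "comm_group (cochain_group G M n)"
proof -
  interpret M: abelian_group M by fact
  show ?thesis
  proof (rule comm_groupI)
    fix c assume c: "c \<in> carrier (cochain_group G M n)"
    show "\<exists>d\<in>carrier (cochain_group G M n). d \<otimes>\<^bsub>cochain_group G M n\<^esub> c = \<one>\<^bsub>cochain_group G M n\<^esub>"
      using c by (intro bexI[of _ "\<lambda>xs\<in>tuples G n. \<ominus>\<^bsub>M\<^esub> c xs"])
        (auto simp: cochain_group_simps PiE_iff fun_eq_iff M.l_neg)
  qed (auto simp: cochain_group_simps PiE_iff fun_eq_iff M.a_ac extensional_def)
qed

lemma coboundary_hom:
  fixes M :: "('g, 'm) module"
  assumes M: "group_ring_module G M"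
  shows "coboundary G M n \<in> hom (cochain_group G M n) (cochain_group G M (Suc n))"
proof (rule homI)
  interpret M: abelian_group M using M by (simp add: group_ring_module_def)
  have act: "g \<odot>\<^bsub>M\<^esub> m \<in> carrier M" if "g \<in> carrier G" "m \<in> carrier M" for g m
    using M that by (simp add: group_ring_module_def)
  have tup: "tl xs \<in> tuples G n" "hd xs \<in> carrier G" "butlast xs \<in> tuples G n"
    if "xs \<in> tuples G (Suc n)" for xs
    using that by (cases xs; auto simp: tuples_def dest: in_set_butlastD split: if_splits)+
  show "coboundary G M n c \<in> carrier (cochain_group G M (Suc n))"
    if "c \<in> carrier (cochain_group G M n)" for c
    using PiE_mem[OF that[unfolded cochain_group_simps]] tup merge_at_in_tuples act
    unfolding coboundary_def cochain_group_simps
    by (auto intro!: M.add.m_closed M.finsum_closed M.add.int_pow_closed act)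
  fix c d assume c: "c \<in> carrier (cochain_group G M n)" and d: "d \<in> carrier (cochain_group G M n)"
  then have c': "c xs \<in> carrier M" "d xs \<in> carrier M" if "xs \<in> tuples G n" for xs
    using that by (auto simp: cochain_group_simps)
  show "coboundary G M n (c \<otimes>\<^bsub>cochain_group G M n\<^esub> d)
      = coboundary G M n c \<otimes>\<^bsub>cochain_group G M (Suc n)\<^esub> coboundary G M n d"
  proof (rule extensionalityI[where A = "tuples G (Suc n)"])
    fix xs assume xs: "xs \<in> tuples G (Suc n)"
    have pow: "add_pow M k (a \<oplus>\<^bsub>M\<^esub> b) = add_pow M k a \<oplus>\<^bsub>M\<^esub> add_pow M k b"
      if "a \<in> carrier M" "b \<in> carrier M" for a b and k :: int
      using M.add.int_pow_distrib that by (simp add: M.a_comm)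
    let ?s = "\<lambda>c. \<Oplus>\<^bsub>M\<^esub>i\<in>{1..n}. add_pow M ((-1::int) ^ i) (c (merge_at G i xs))"
    have m: "merge_at G i xs \<in> tuples G n" if "i \<in> {1..n}" for i
      using that xs merge_at_in_tuples by simp
    have s: "?s (\<lambda>xs\<in>tuples G n. c xs \<oplus>\<^bsub>M\<^esub> d xs) = ?s c \<oplus>\<^bsub>M\<^esub> ?s d"
    proof -
      have "?s (\<lambda>xs\<in>tuples G n. c xs \<oplus>\<^bsub>M\<^esub> d xs)
          = (\<Oplus>\<^bsub>M\<^esub>i\<in>{1..n}. add_pow M ((-1::int) ^ i) (c (merge_at G i xs)) \<oplus>\<^bsub>M\<^esub> add_pow M ((-1::int) ^ i) (d (merge_at G i xs)))"
        using m c' by (intro M.finsum_cong') (auto simp: pow intro!: M.add.int_pow_closed M.add.m_closed)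
      also have "\<dots> = ?s c \<oplus>\<^bsub>M\<^esub> ?s d"
        using m c' by (intro M.finsum_addf) (auto intro!: M.add.int_pow_closed)
      finally show ?thesis .
    qed
    have sc: "?s c \<in> carrier M" "?s d \<in> carrier M"
      using m c' by (auto intro!: M.finsum_closed M.add.int_pow_closed)
    have h: "hd xs \<odot>\<^bsub>M\<^esub> (c (tl xs) \<oplus>\<^bsub>M\<^esub> d (tl xs)) = hd xs \<odot>\<^bsub>M\<^esub> c (tl xs) \<oplus>\<^bsub>M\<^esub> hd xs \<odot>\<^bsub>M\<^esub> d (tl xs)"
      using M tup[OF xs] c' by (simp add: group_ring_module_def)
    have "\<lbrakk>a \<in> carrier M; a' \<in> carrier M; b \<in> carrier M; b' \<in> carrier M; e \<in> carrier M; e' \<in> carrier M\<rbrakk>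
      \<Longrightarrow> (a \<oplus>\<^bsub>M\<^esub> a') \<oplus>\<^bsub>M\<^esub> (b \<oplus>\<^bsub>M\<^esub> b') \<oplus>\<^bsub>M\<^esub> (e \<oplus>\<^bsub>M\<^esub> e') = (a \<oplus>\<^bsub>M\<^esub> b \<oplus>\<^bsub>M\<^esub> e) \<oplus>\<^bsub>M\<^esub> (a' \<oplus>\<^bsub>M\<^esub> b' \<oplus>\<^bsub>M\<^esub> e')"
      for a a' b b' e e'
      by (simp add: M.a_ac)
    then show "coboundary G M n (c \<otimes>\<^bsub>cochain_group G M n\<^esub> d) xs
      = (coboundary G M n c \<otimes>\<^bsub>cochain_group G M (Suc n)\<^esub> coboundary G M n d) xs"
      using xs tup[OF xs] c' sc act
      unfolding cochain_group_simps coboundary_def by (simp add: s[simplified] h pow M.add.int_pow_closed)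
  qed (auto simp: coboundary_def cochain_group_simps)
qed

end

context equivariant_contraction
begin

lemma group_cohomology_trivial:
  fixes M :: "('g, 'm) module"
  assumes M: "group_ring_module G M" and n: "N \<le> n" "0 < n"
  shows "carrier (group_cohomology G M n) = {\<one>\<^bsub>group_cohomology G M n\<^esub>}"
proof -
  obtain m where m: "n = Suc m" using n by (cases n) auto
  have AM: "abelian_group M" using M by (simp add: group_ring_module_def)
  let ?C = "cochain_group G M n" and ?B = "coboundaries G M n" and ?Z = "cocycles G M n"
  interpret C: comm_group ?C by (rule comm_group_cochain_group[OF AM])
  interpret C': comm_group "cochain_group G M m" by (rule comm_group_cochain_group[OF AM])
  interpret d: group_hom "cochain_group G M m" ?C "coboundary G M m"
    using coboundary_hom[OF M, of m] by unfold_locales (simp add: m)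
  interpret d': group_hom ?C "cochain_group G M (Suc n)" "coboundary G M n"
    using coboundary_hom[OF M, of n] comm_group_cochain_group[OF AM]
    by (auto simp: group_hom_def group_hom_axioms_def C.group_axioms comm_group.axioms)
  have B: "subgroup ?B ?C"
    using d.img_is_subgroup by (simp add: coboundaries_def m)
  have ZB: "?Z \<subseteq> ?B"
  proof
    fix c assume "c \<in> ?Z"
    then have "\<exists>b\<in>carrier (cochain_group G M m). coboundary G M m b = c"
      by (intro cocycle_is_coboundary[OF M n(1) m]) (auto simp: cocycles_def kernel_def)
    then show "c \<in> ?B" by (auto simp: coboundaries_def m)
  qed
  have coset: "r_coset (?C\<lparr>carrier := ?Z\<rparr>) ?B c = ?B" if "c \<in> ?Z" for c
    using C.coset_join2[OF _ B, of c] subgroup.subset[OF B] ZB that by (auto simp: r_coset_def)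
  have "\<one>\<^bsub>?C\<^esub> \<in> ?Z"
    by (simp add: cocycles_def kernel_def)
  then show ?thesis
    using coset by (auto simp: group_cohomology_def FactGroup_def RCOSETS_def)
qed

lemma cd_le: "0 < N \<Longrightarrow> cd TYPE('m) G \<le> enat (N - 1)"
  unfolding cd_def using group_cohomology_trivial
  by (intro SUP_least) (force simp: not_less_eq_eq)

end

section \<open>Small chains in a simplex\<close>

definition small_simplex :: "nat \<Rightarrow> 'a topology \<Rightarrow> 'a set set \<Rightarrow> ((nat \<Rightarrow> real) \<Rightarrow> 'a) \<Rightarrow> bool" where
  "small_simplex p X \<C> f \<longleftrightarrow> (\<exists>V\<in>\<C>. singular_simplex p (subtopology X V) f)"

definition small_chain :: "nat \<Rightarrow> 'a topology \<Rightarrow> 'a set set \<Rightarrow> 'a chain \<Rightarrow> bool" where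
  "small_chain p X \<C> c \<longleftrightarrow> (\<forall>f\<in>Poly_Mapping.keys c. small_simplex p X \<C> f)"

lemma small_chain_diff: "small_chain p X \<C> a \<Longrightarrow> small_chain p X \<C> b \<Longrightarrow> small_chain p X \<C> (a - b)"
  unfolding small_chain_def using keys_diff[of a b] by blast

lemma small_chain_sum: "(\<And>i. i \<in> I \<Longrightarrow> small_chain p X \<C> (f i)) \<Longrightarrow> small_chain p X \<C> (sum f I)"
  unfolding small_chain_def using keys_sum[of f I] by blast

lemma small_chain_cmul: "small_chain p X \<C> c \<Longrightarrow> small_chain p X \<C> (frag_cmul a c)"
  by (auto simp: small_chain_def)

lemma small_simplex_imp_singular: "small_simplex p X \<C> f \<Longrightarrow> singular_simplex p X f"
  by (auto simp: small_simplex_def singular_simplex_subtopology)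

lemma small_chain_imp_singular: "small_chain p X \<C> c \<Longrightarrow> singular_chain p X c"
  by (auto simp: small_chain_def singular_chain_def dest: small_simplex_imp_singular)

lemma small_simplex_face:
  "small_simplex (Suc p) X \<C> f \<Longrightarrow> j \<le> Suc p \<Longrightarrow> small_simplex p X \<C> (singular_face (Suc p) j f)"
  using singular_simplex_singular_face[of "Suc p" _ f j] by (auto simp: small_simplex_def)

lemma chain_boundary_iterated_subdivision:
  "singular_chain (Suc p) X c \<Longrightarrow>
     singular_chain (Suc p) X ((singular_subdivision (Suc p) ^^ n) c) \<and>
     chain_boundary (Suc p) ((singular_subdivision (Suc p) ^^ n) c)
       = (singular_subdivision p ^^ n) (chain_boundary (Suc p) c)"
  using chain_boundary_singular_subdivision[of "Suc p" X]
  by (induction n) (auto simp: singular_chain_singular_subdivision)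

text \<open>Iterated subdivision makes \<open>w\<close> small but also subdivides its boundary. The
  chain homotopy \<open>h\<close> to the identity corrects this: it maps chains of a subspace to
  chains of the same subspace, so it keeps the small chain \<open>?z\<close> small. Keeping the
  boundary unchanged is what lets fillings of neighbouring simplices fit together.\<close>

lemma small_boundary:
  assumes \<C>: "\<And>V. V \<in> \<C> \<Longrightarrow> openin X V" "topspace X \<subseteq> \<Union>\<C>"
    and w: "singular_chain (Suc p) X w" and small: "small_chain p X \<C> (chain_boundary (Suc p) w)"
  shows "\<exists>c. small_chain (Suc p) X \<C> c \<and> chain_boundary (Suc p) c = chain_boundary (Suc p) w"
proof -
  let ?z = "chain_boundary (Suc p) w"
  obtain n where n: "\<And>m f. n \<le> m \<Longrightarrow> f \<in> Poly_Mapping.keys ((singular_subdivision (Suc p) ^^ m) w) \<Longrightarrow>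
      \<exists>V\<in>\<C>. f \<in> standard_simplex (Suc p) \<rightarrow> V"
    using sufficient_iterated_singular_subdivision_exists[OF \<C> w] by blast
  obtain h where h: "\<And>p. h p 0 = (0 :: 'a chain)"
        "\<And>p c1 c2. h p (c1-c2) = h p c1 - h p c2"
        "\<And>p X c. singular_chain p X c \<Longrightarrow> singular_chain (Suc p) X (h p c)"
        "\<And>p X c. singular_chain p X c
                 \<Longrightarrow> chain_boundary (Suc p) (h p c) + h (p - Suc 0) (chain_boundary p c)
                   = (singular_subdivision p ^^ n) c - c"
    using chain_homotopic_iterated_singular_subdivision[of n] by blast
  let ?w = "(singular_subdivision (Suc p) ^^ n) w"
  have "small_chain (Suc p) X \<C> ?w"
    unfolding small_chain_def
  proof
    fix f assume f: "f \<in> Poly_Mapping.keys ?w"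
    then obtain V where "V \<in> \<C>" "f \<in> standard_simplex (Suc p) \<rightarrow> V"
      using n[OF order_refl f] by blast
    moreover have "singular_simplex (Suc p) X f"
      using chain_boundary_iterated_subdivision[OF w, of n] f by (auto simp: singular_chain_def)
    ultimately show "small_simplex (Suc p) X \<C> f"
      by (auto simp: small_simplex_def singular_simplex_subtopology)
  qed
  moreover have "small_chain (Suc p) X \<C> (h p ?z)"
  proof -
    have "Poly_Mapping.keys ?z \<subseteq> {f. small_simplex p X \<C> f}"
      using small by (auto simp: small_chain_def)
    then show ?thesis
    proof (induction rule: frag_induction)
      case (one f)
      then obtain V where "V \<in> \<C>" "singular_simplex p (subtopology X V) f"
        by (auto simp: small_simplex_def)
      then show ?case
        using h(3)[of p "subtopology X V" "frag_of f"]
        by (auto simp: singular_chain_of small_chain_def small_simplex_def singular_chain_def)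
    next
      case zero
      show ?case by (simp add: h small_chain_def)
    next
      case (diff a b)
      then show ?case by (simp add: h small_chain_diff)
    qed
  qed
  ultimately have "small_chain (Suc p) X \<C> (?w - h p ?z)"
    by (rule small_chain_diff)
  moreover have "chain_boundary (Suc p) (?w - h p ?z) = ?z"
    using h(4)[of p X ?z] chain_boundary_iterated_subdivision[OF w, of n]
      chain_boundary_boundary_alt[OF w] small_chain_imp_singular[OF small]
    by (simp add: chain_boundary_diff h(1))
  ultimately show ?thesis by blast
qed

section \<open>Singular chains in a standard simplex\<close>

abbreviation simplex_top :: "nat \<Rightarrow> (nat \<Rightarrow> real) topology" where
  "simplex_top m \<equiv> subtopology (powertop_real UNIV) (standard_simplex m)"

definition basis_vec :: "nat \<Rightarrow> nat \<Rightarrow> real" where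
  "basis_vec i = (\<lambda>j. if j = i then 1 else 0)"

lemma basis_vec_in [simp]: "basis_vec i \<in> standard_simplex p \<longleftrightarrow> i \<le> p"
  by (simp add: basis_vec_def)

lemma continuous_map_simplex_coordinate: "continuous_map (simplex_top m) euclideanreal (\<lambda>x. x n)"
  using continuous_map_product_projection[of n UNIV "\<lambda>_. euclideanreal"]
  by (simp add: continuous_map_from_subtopology)

lemma homotopic_simplex_const:
  "homotopic_with (\<lambda>_. True) (simplex_top m) (simplex_top m) id (\<lambda>_. basis_vec 0)"
proof -
  let ?h = "\<lambda>(t, x) i. (1 - t) * x i + t * basis_vec 0 i"
  let ?P = "prod_topology (top_of_set {0..1::real}) (simplex_top m)"
  have 1: "continuous_map ?P euclideanreal fst"
    using continuous_map_fst continuous_map_into_fulltopology by blast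
  have 2: "continuous_map ?P euclideanreal (\<lambda>z. snd z n)" for n
    using continuous_map_compose[OF continuous_map_snd continuous_map_simplex_coordinate]
    by (simp add: o_def)
  have "continuous_map ?P euclideanreal (\<lambda>z. (1 - fst z) * snd z n + fst z * basis_vec 0 n)" for n
    by (intro continuous_map_add continuous_map_real_mult continuous_map_diff 1 2) auto
  then have "continuous_map ?P (powertop_real UNIV) ?h"
    unfolding continuous_map_componentwise_UNIV by (simp add: case_prod_unfold)
  moreover have "?h \<in> {0..1} \<times> standard_simplex m \<rightarrow> standard_simplex m"
    by (auto intro!: convex_standard_simplex)
  ultimately show ?thesis
    unfolding homotopic_with_def by (intro exI[of _ ?h]) (auto simp: continuous_map_in_subtopology)
qed

text \<open>The simplex contracts to its vertex \<open>0\<close>, and in a point every cycle of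
  positive degree bounds. In degree \<open>0\<close> the last hypothesis expresses that the
  augmentation vanishes.\<close>

lemma simplex_cycle_is_boundary:
  assumes z: "singular_chain p (simplex_top m) z" and "chain_boundary p z = 0"
    and 0: "p = 0 \<Longrightarrow> chain_map 0 (\<lambda>_. basis_vec 0) z = 0"
  shows "\<exists>w. singular_chain (Suc p) (simplex_top m) w \<and> chain_boundary (Suc p) w = z"
proof -
  let ?S = "simplex_top m" and ?c = "\<lambda>_. basis_vec 0"
  have cyc: "singular_relcycle p ?S {} z"
    using assms by (simp add: singular_cycle)
  have "homologous_rel p ?S {} (chain_map p id z) (chain_map p ?c z)"
    using homotopic_simplex_const cyc by (intro homotopic_imp_homologous_rel_chain_maps[where T="{}"]) auto
  moreover have "singular_relboundary p ?S {} (chain_map p ?c z)"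
  proof (cases "p = 0")
    case True
    then show ?thesis using 0 by simp
  next
    case False
    let ?V = "subtopology ?S {basis_vec 0}"
    have "continuous_map ?S ?V ?c"
      by (auto simp: continuous_map_in_subtopology)
    then have "singular_relcycle p ?V {} (chain_map p ?c z)"
      using cyc by (intro singular_relcycle_chain_map[OF cyc]) auto
    moreover have "topspace ?V = {basis_vec 0}" by auto
    ultimately have "singular_relboundary p ?V {} (chain_map p ?c z)"
      using False singular_boundary_eq_cycle_singleton[of ?V "basis_vec 0" p] by simp
    then show ?thesis
      unfolding singular_boundary singular_chain_subtopology by blast
  qed
  ultimately have "singular_relboundary p ?S {} (chain_map p id z)"
    unfolding homologous_rel_def using singular_relboundary_add by fastforce
  then show ?thesis
    using chain_map_ident[OF z] by (simp add: singular_boundary)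
qed

lemma simplical_face_simplical_face:
  "i \<le> j \<Longrightarrow> simplical_face (Suc j) (simplical_face i t) = simplical_face i (simplical_face j t)"
  by (auto simp: simplical_face_def fun_eq_iff)

lemma continuous_simplical_face:
  assumes "j \<le> Suc m"
  shows "continuous_map (simplex_top m) (simplex_top (Suc m)) (simplical_face j)"
proof -
  have "continuous_map (simplex_top m) euclideanreal (\<lambda>x. simplical_face j x i)" for i
  proof -
    consider "i < j" | "i = j" | "j < i" by linarith
    then show ?thesis
      unfolding simplical_face_def by cases (simp_all add: continuous_map_simplex_coordinate)
  qed
  moreover have "simplical_face j x \<in> standard_simplex (Suc m)" if "x \<in> standard_simplex m" for x
    using assms simplical_face_in_standard_simplex[of "Suc m" j x] that by simp
  ultimately show ?thesis
    unfolding continuous_map_in_subtopology continuous_map_componentwise_UNIV by simp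
qed

lemma keys_chain_boundaryE:
  assumes "g \<in> Poly_Mapping.keys (chain_boundary (Suc p) (frag_of f))"
  obtains j where "j \<le> Suc p" "g = singular_face (Suc p) j f"
proof -
  have "g \<in> Poly_Mapping.keys (\<Sum>j\<le>Suc p. frag_cmul ((-1) ^ j) (frag_of (singular_face (Suc p) j f)))"
    using assms by (simp add: chain_boundary_of del: sum.atMost_Suc)
  then have "g \<in> (\<Union>j\<le>Suc p. Poly_Mapping.keys (frag_cmul ((-1) ^ j) (frag_of (singular_face (Suc p) j f))))"
    by (rule subsetD[OF keys_sum])
  then obtain j where "j \<le> Suc p" "g \<in> Poly_Mapping.keys (frag_of (singular_face (Suc p) j f))"
    by (auto simp del: keys_frag_of)
  then show thesis using that by simp
qed

section \<open>Simplices with an equivariantly labelled cover\<close>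

text \<open>The standard simplex that belongs to \<open>e\<close> is covered by the sets \<open>U e i\<close>; the labels
  \<open>lam e i\<close> are constant along paths in \<open>U e i\<close>.\<close>

locale simplex_cover = plain_group G for G :: "'g monoid" (structure) +
  fixes k :: nat and U :: "'g list \<Rightarrow> nat \<Rightarrow> (nat \<Rightarrow> real) set" and lam :: "'g list \<Rightarrow> nat \<Rightarrow> (nat \<Rightarrow> real) \<Rightarrow> 'g"
  assumes U_open: "e \<in> tuples G (Suc m) \<Longrightarrow> i \<le> k \<Longrightarrow> openin (simplex_top m) (U e i)"
    and U_cover: "e \<in> tuples G (Suc m) \<Longrightarrow> standard_simplex m \<subseteq> (\<Union>i\<le>k. U e i)"
    and U_face: "e \<in> tuples G (Suc (Suc m)) \<Longrightarrow> j \<le> Suc m \<Longrightarrow> i \<le> k \<Longrightarrow> x \<in> standard_simplex m \<Longrightarrow>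
       simplical_face j x \<in> U e i \<longleftrightarrow> x \<in> U (del j e) i"
    and U_act: "h \<in> carrier G \<Longrightarrow> e \<in> tuples G (Suc m) \<Longrightarrow> U (map ((\<otimes>) h) e) = U e"
    and lam_closed: "e \<in> tuples G (Suc m) \<Longrightarrow> i \<le> k \<Longrightarrow> x \<in> U e i \<Longrightarrow> lam e i x \<in> carrier G"
    and lam_face: "e \<in> tuples G (Suc (Suc m)) \<Longrightarrow> j \<le> Suc m \<Longrightarrow> i \<le> k \<Longrightarrow> x \<in> standard_simplex m \<Longrightarrow>
       x \<in> U (del j e) i \<Longrightarrow> lam e i (simplical_face j x) = lam (del j e) i x"
    and lam_act: "h \<in> carrier G \<Longrightarrow> e \<in> tuples G (Suc m) \<Longrightarrow> i \<le> k \<Longrightarrow> x \<in> U e i \<Longrightarrow>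
       lam (map ((\<otimes>) h) e) i x = h \<otimes> lam e i x"
    and lam_path: "e \<in> tuples G (Suc m) \<Longrightarrow> i \<le> k \<Longrightarrow> pathin (subtopology (simplex_top m) (U e i)) \<gamma> \<Longrightarrow>
       lam e i (\<gamma> 0) = lam e i (\<gamma> 1)"
begin

abbreviation "cov e \<equiv> U e ` {..k}"

text \<open>Acyclic models: a small chain that replaces the identity of the standard simplex, with
  its boundary prescribed by the chains already chosen for the faces.\<close>

primrec F :: "nat \<Rightarrow> 'g list \<Rightarrow> (nat \<Rightarrow> real) chain" where
  "F 0 e = frag_of (restrict id (standard_simplex 0))"
| "F (Suc m) e = (SOME c. small_chain (Suc m) (simplex_top (Suc m)) (cov e) c \<and>
     chain_boundary (Suc m) c = (\<Sum>j\<le>Suc m. frag_cmul ((-1) ^ j) (chain_map m (simplical_face j) (F m (del j e)))))"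

abbreviation Z :: "nat \<Rightarrow> 'g list \<Rightarrow> (nat \<Rightarrow> real) chain" where
  "Z m e \<equiv> (\<Sum>j\<le>Suc m. frag_cmul ((-1) ^ j) (chain_map m (simplical_face j) (F m (del j e))))"

lemma small_simplex_push:
  assumes e: "e \<in> tuples G (Suc (Suc m))" and j: "j \<le> Suc m"
    and f: "small_simplex p (simplex_top m) (cov (del j e)) f"
  shows "small_simplex p (simplex_top (Suc m)) (cov e) (simplex_map p (simplical_face j) f)"
proof -
  obtain i where i: "i \<le> k" "singular_simplex p (simplex_top m) f" "f ` standard_simplex p \<subseteq> U (del j e) i"
    using f by (auto simp: small_simplex_def singular_simplex_subtopology)
  then have "f ` standard_simplex p \<subseteq> standard_simplex m"
    by (auto simp: singular_simplex_def continuous_map_in_subtopology)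
  then have "simplex_map p (simplical_face j) f ` standard_simplex p \<subseteq> U e i"
    using i U_face[OF e j i(1)] by (auto simp: simplex_map_def)
  then show ?thesis
    using i singular_simplex_simplex_map[OF i(2) continuous_simplical_face[OF j]]
    by (auto simp: small_simplex_def singular_simplex_subtopology)
qed

lemma small_chain_push:
  assumes e: "e \<in> tuples G (Suc (Suc m))" and j: "j \<le> Suc m"
    and c: "small_chain p (simplex_top m) (cov (del j e)) c"
  shows "small_chain p (simplex_top (Suc m)) (cov e) (chain_map p (simplical_face j) c)"
  unfolding small_chain_def chain_map_def
proof
  fix f assume "f \<in> Poly_Mapping.keys (frag_extend (frag_of \<circ> simplex_map p (simplical_face j)) c)"
  then obtain f' where "f' \<in> Poly_Mapping.keys c" "f = simplex_map p (simplical_face j) f'"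
    using keys_frag_extend[of "frag_of \<circ> simplex_map p (simplical_face j)" c] by auto
  then show "small_simplex p (simplex_top (Suc m)) (cov e) f"
    using c small_simplex_push[OF e j] by (auto simp: small_chain_def)
qed

text \<open>The prescribed boundary is a small cycle. It bounds because the simplex is contractible,
  and then it bounds a small chain by \<open>small_boundary\<close>.\<close>

lemma F_properties:
  "e \<in> tuples G (Suc m) \<Longrightarrow> small_chain m (simplex_top m) (cov e) (F m e) \<and>
     (\<forall>n. m = Suc n \<longrightarrow> chain_boundary (Suc n) (F (Suc n) e) = Z n e)"
proof (induction m arbitrary: e)
  case 0
  have "restrict id (standard_simplex 0) ` standard_simplex 0 = standard_simplex 0"
    by auto
  moreover obtain i where "i \<le> k" "standard_simplex 0 \<subseteq> U e i"
    using U_cover[OF 0] by (auto simp: standard_simplex_0)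
  moreover have "singular_simplex 0 (simplex_top 0) (restrict id (standard_simplex 0))"
    by (simp add: singular_simplex_def)
  ultimately have "small_simplex 0 (simplex_top 0) (cov e) (restrict id (standard_simplex 0))"
    by (auto simp: small_simplex_def singular_simplex_subtopology simp del: restrict_apply)
  then show ?case
    by (simp add: small_chain_def)
next
  case (Suc m)
  have del: "del j e \<in> tuples G (Suc m)" if "j \<le> Suc m" for j
    using Suc.prems that by (rule del_in_tuples)
  have small: "small_chain m (simplex_top (Suc m)) (cov e) (Z m e)"
    using Suc.IH[OF del] Suc.prems by (intro small_chain_sum small_chain_cmul small_chain_push) auto
  \<comment> \<open>The simplicial identities hold for the face maps of simplices and for
    \<open>del\<close> alike, which gives the symmetry that \<open>alternating_double_sum\<close>
    asks for.\<close>
  have cyc: "chain_boundary m (Z m e) = 0"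
  proof (cases m)
    case 0
    then show ?thesis by (simp add: chain_boundary_def)
  next
    case (Suc n)
    have "chain_boundary m (Z m e) = (\<Sum>j\<le>Suc m. frag_cmul ((-1) ^ j)
        (chain_boundary m (chain_map m (simplical_face j) (F m (del j e)))))"
      by (simp add: chain_boundary_sum chain_boundary_cmul del: sum.atMost_Suc)
    also have "\<dots> = (\<Sum>j\<le>Suc m. frag_cmul ((-1) ^ j) (\<Sum>i\<le>m. frag_cmul ((-1) ^ i)
        (chain_map n (simplical_face j \<circ> simplical_face i) (F n (del i (del j e))))))"
    proof (intro sum.cong refl arg_cong[where f="frag_cmul _"])
      fix j assume "j \<in> {..Suc m}"
      then have "singular_chain m (simplex_top m) (F m (del j e))"
          and b: "chain_boundary m (F m (del j e)) = Z n (del j e)"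
        using Suc.IH[OF del, of j] Suc by (auto dest: small_chain_imp_singular)
      then have "chain_boundary m (chain_map m (simplical_face j) (F m (del j e)))
          = chain_map n (simplical_face j) (Z n (del j e))"
        using chain_boundary_chain_map[of m _ "F m (del j e)" "simplical_face j"] Suc by simp
      also have "\<dots> = (\<Sum>i\<le>m. frag_cmul ((-1) ^ i)
          (chain_map n (simplical_face j \<circ> simplical_face i) (F n (del i (del j e)))))"
        by (simp add: chain_map_sum chain_map_compose Suc del: sum.atMost_Suc)
      finally show "chain_boundary m (chain_map m (simplical_face j) (F m (del j e))) = \<dots>" .
    qed
    also have "\<dots> = (\<Sum>j\<le>Suc m. \<Sum>i\<le>m. frag_cmul ((-1) ^ (j + i))
        (chain_map n (simplical_face j \<circ> simplical_face i) (F n (del i (del j e)))))"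
      by (simp add: frag_cmul_sum power_add del: sum.atMost_Suc)
    also have "\<dots> = 0"
      using Suc.prems
      by (intro alternating_double_sum) (auto simp: o_def simplical_face_simplical_face tuples_def del_del)
    finally show ?thesis .
  qed
  have "\<exists>w. singular_chain (Suc m) (simplex_top (Suc m)) w \<and> chain_boundary (Suc m) w = Z m e"
  proof (rule simplex_cycle_is_boundary[OF small_chain_imp_singular[OF small] cyc])
    \<comment> \<open>In this degree \<open>Z\<close> is a difference of two vertices, which cancel
      once both are pushed to one point.\<close>
    show "chain_map 0 (\<lambda>_. basis_vec 0) (Z m e) = 0" if "m = 0"
    proof -
      have "(\<lambda>_. basis_vec 0) \<circ> simplical_face j = (\<lambda>_. basis_vec 0)" for j
        by auto
      then have "chain_map 0 (\<lambda>_. basis_vec 0) (chain_map 0 (simplical_face j) x) = chain_map 0 (\<lambda>_. basis_vec 0) x"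
        for j and x :: "(nat \<Rightarrow> real) chain"
        using fun_cong[OF chain_map_compose[of 0 "\<lambda>_. basis_vec 0" "simplical_face j"], of x] by simp
      then show ?thesis
        using that by (simp add: chain_map_diff simplex_map_def o_def)
    qed
  qed
  then obtain w where w: "singular_chain (Suc m) (simplex_top (Suc m)) w" "chain_boundary (Suc m) w = Z m e"
    by blast
  have "\<exists>c. small_chain (Suc m) (simplex_top (Suc m)) (cov e) c \<and> chain_boundary (Suc m) c = chain_boundary (Suc m) w"
  proof (rule small_boundary[OF _ _ w(1)])
    show "openin (simplex_top (Suc m)) V" if "V \<in> cov e" for V
      using that U_open[OF Suc.prems] by blast
    show "topspace (simplex_top (Suc m)) \<subseteq> \<Union> (cov e)"
      using U_cover[OF Suc.prems] by simp
    show "small_chain m (simplex_top (Suc m)) (cov e) (chain_boundary (Suc m) w)"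
      using small w(2) by simp
  qed
  then have "\<exists>c. small_chain (Suc m) (simplex_top (Suc m)) (cov e) c \<and> chain_boundary (Suc m) c = Z m e"
    unfolding w(2) .
  then have "small_chain (Suc m) (simplex_top (Suc m)) (cov e) (F (Suc m) e) \<and> chain_boundary (Suc m) (F (Suc m) e) = Z m e"
    unfolding F.simps by (rule someI_ex)
  then show ?case by blast
qed

text \<open>Translation changes neither the cover nor, by induction, the prescribed boundary, so
  \<open>SOME\<close> is applied to the same predicate.\<close>

lemma F_act: "h \<in> carrier G \<Longrightarrow> e \<in> tuples G (Suc m) \<Longrightarrow> F m (map ((\<otimes>) h) e) = F m e"
proof (induction m arbitrary: e)
  case (Suc m)
  have "Z m (map ((\<otimes>) h) e) = Z m e"
    using Suc.IH[OF Suc.prems(1) del_in_tuples[OF Suc.prems(2)]] by (simp add: del_map del: sum.atMost_Suc)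
  then show ?case
    using U_act[OF Suc.prems] by (simp add: del_map del: sum.atMost_Suc)
qed simp

text \<open>\<open>L\<close> replaces a small simplex by the flags of its faces, each flag being listed from the largest
  face down and each face being represented by its apex.\<close>

definition colour :: "'g list \<Rightarrow> nat \<Rightarrow> ((nat \<Rightarrow> real) \<Rightarrow> nat \<Rightarrow> real) \<Rightarrow> nat" where
  "colour e p f = (LEAST i. i \<le> k \<and> f ` standard_simplex p \<subseteq> U e i)"

definition apex :: "'g list \<Rightarrow> nat \<Rightarrow> ((nat \<Rightarrow> real) \<Rightarrow> nat \<Rightarrow> real) \<Rightarrow> 'g" where
  "apex e p f = lam e (colour e p f) (f (basis_vec 0))"

primrec L :: "'g list \<Rightarrow> nat \<Rightarrow> ((nat \<Rightarrow> real) \<Rightarrow> nat \<Rightarrow> real) \<Rightarrow> 'g list \<Rightarrow>\<^sub>0 int" where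
  "L e 0 f = frag_of [apex e 0 f]"
| "L e (Suc p) f = prepend (apex e (Suc p) f) (frag_extend (L e p) (chain_boundary (Suc p) (frag_of f)))"

lemma L_Suc: "L e (Suc p) f = prepend (apex e (Suc p) f)
    (\<Sum>j\<le>Suc p. frag_cmul ((-1) ^ j) (L e p (singular_face (Suc p) j f)))"
  by (simp add: chain_boundary_of frag_extend_sum frag_extend_cmul o_def del: sum.atMost_Suc)

text \<open>\<open>L\<close> obeys the cone formula of barycentric subdivision, with apexes in place
  of barycentres. As there, the chain coned off is a cycle by induction.\<close>

lemma BD_L:
  "singular_simplex (Suc p) X f \<Longrightarrow> BD (L e (Suc p) f) = frag_extend (L e p) (chain_boundary (Suc p) (frag_of f))"
proof (induction p arbitrary: f)
  case 0
  show ?case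
    by (simp add: BD_prepend chain_boundary_of frag_extend_add frag_extend_minus frag_extend_diff bd_Cons prepend_simps)
next
  case (Suc p)
  let ?b = "chain_boundary (Suc (Suc p)) (frag_of f)"
  have b: "singular_chain (Suc p) X ?b"
    using Suc.prems by (intro singular_chain_boundary_alt) (simp add: singular_chain_of)
  have "BD (frag_extend (L e (Suc p)) ?b) = frag_extend (\<lambda>f. BD (L e (Suc p) f)) ?b"
    by (rule frag_extend_comp)
  also have "\<dots> = frag_extend (\<lambda>f. frag_extend (L e p) (chain_boundary (Suc p) (frag_of f))) ?b"
    using b Suc.IH by (intro frag_extend_eq) (auto simp: singular_chain_def)
  also have "\<dots> = frag_extend (L e p) (chain_boundary (Suc p) ?b)"
    unfolding frag_extend_comp[symmetric] by (simp add: chain_boundary_def)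
  also have "\<dots> = 0"
    using Suc.prems by (simp add: chain_boundary_boundary_alt singular_chain_of)
  finally show ?case
    unfolding L.simps(2)[of e "Suc p"] BD_prepend by (simp add: prepend_simps del: L.simps)
qed

lemma colour:
  assumes "small_simplex p (simplex_top m) (cov e) f"
  shows "colour e p f \<le> k" "f ` standard_simplex p \<subseteq> U e (colour e p f)"
  using assms LeastI_ex[of "\<lambda>i. i \<le> k \<and> f ` standard_simplex p \<subseteq> U e i"]
  by (auto simp: small_simplex_def singular_simplex_subtopology colour_def)

lemma colour_vertex:
  "small_simplex p (simplex_top m) (cov e) f \<Longrightarrow> f (basis_vec 0) \<in> U e (colour e p f)"
  using colour(2)[of p m e f] by (simp add: image_subset_iff)

text \<open>The segment from vertex \<open>0\<close> to \<open>x\<close> is mapped into the set of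
  that colour, where labels are constant along paths. Hence the apex can be read off at any point,
  in particular at a point of a face of the same colour.\<close>

lemma apex_eq:
  assumes e: "e \<in> tuples G (Suc m)" and f: "small_simplex p (simplex_top m) (cov e) f"
    and x: "x \<in> standard_simplex p"
  shows "apex e p f = lam e (colour e p f) (f x)"
proof -
  note c = colour[OF f]
  let ?g = "\<lambda>u i. (1 - u) * basis_vec 0 i + u * x i"
  have "continuous_map (top_of_set {0..1}) (powertop_real UNIV) ?g"
    unfolding continuous_map_componentwise_UNIV by (intro allI) (simp, intro continuous_intros)
  moreover have "?g u \<in> standard_simplex p" if "u \<in> {0..1}" for u
    using that x by (intro convex_standard_simplex) auto
  ultimately have "continuous_map (top_of_set {0..1}) (simplex_top p) ?g"
    by (auto simp: continuous_map_in_subtopology)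
  moreover have "continuous_map (simplex_top p) (subtopology (simplex_top m) (U e (colour e p f))) f"
    using f c small_simplex_imp_singular[OF f] by (auto simp: singular_simplex_def continuous_map_in_subtopology)
  ultimately have "pathin (subtopology (simplex_top m) (U e (colour e p f))) (f \<circ> ?g)"
    unfolding pathin_def by (rule continuous_map_compose)
  from lam_path[OF e c(1) this] show ?thesis
    by (simp add: apex_def)
qed

lemma keys_L:
  assumes e: "e \<in> tuples G (Suc m)"
  shows "small_simplex p (simplex_top m) (cov e) f \<Longrightarrow> Poly_Mapping.keys (L e p f) \<subseteq> tuples G (Suc p)"
proof (induction p arbitrary: f)
  case (0 f)
  then show ?case
    using lam_closed[OF e colour(1)[OF 0] colour_vertex[OF 0]] by (auto simp: tuples_def apex_def)
next
  case (Suc p f)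
  have "apex e (Suc p) f \<in> carrier G"
    using lam_closed[OF e colour(1)[OF Suc.prems] colour_vertex[OF Suc.prems]] by (auto simp: apex_def)
  moreover have "Poly_Mapping.keys (frag_extend (L e p) (chain_boundary (Suc p) (frag_of f))) \<subseteq> tuples G (Suc p)"
  proof (rule keys_frag_extend_subset)
    fix g assume "g \<in> Poly_Mapping.keys (chain_boundary (Suc p) (frag_of f))"
    then obtain j where "j \<le> Suc p" "g = singular_face (Suc p) j f"
      by (rule keys_chain_boundaryE)
    then show "Poly_Mapping.keys (L e p g) \<subseteq> tuples G (Suc p)"
      using Suc.IH[OF small_simplex_face[OF Suc.prems]] by simp
  qed
  ultimately show ?case
    unfolding L.simps by (rule keys_prepend)
qed

text \<open>A flag of faces with strictly decreasing colours has at most \<open>k + 1\<close> members; if two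
  neighbours have the same colour, then they also have the same apex.\<close>

lemma L_degenerate:
  assumes e: "e \<in> tuples G (Suc m)"
  shows "small_simplex p (simplex_top m) (cov e) f \<Longrightarrow> l \<in> Poly_Mapping.keys (L e p f) \<Longrightarrow>
    \<not> distinct_adj l \<or> p \<le> colour e p f \<and> l \<noteq> [] \<and> hd l = apex e p f"
proof (induction p arbitrary: f l)
  case (Suc p f l)
  obtain l' where "l' \<in> Poly_Mapping.keys (frag_extend (L e p) (chain_boundary (Suc p) (frag_of f)))"
      and l: "l = apex e (Suc p) f # l'"
    using subsetD[OF keys_frag_extend Suc.prems(2)[unfolded L.simps prepend_def]] by auto
  then obtain g where "g \<in> Poly_Mapping.keys (chain_boundary (Suc p) (frag_of f))"
      and "l' \<in> Poly_Mapping.keys (L e p g)"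
    using subsetD[OF keys_frag_extend, of l' "L e p"] by blast
  then obtain j where j: "j \<le> Suc p" and l': "l' \<in> Poly_Mapping.keys (L e p (singular_face (Suc p) j f))"
    by (elim keys_chain_boundaryE) simp
  let ?g = "singular_face (Suc p) j f"
  note g = small_simplex_face[OF Suc.prems(1) j]
  have g_im: "?g ` standard_simplex p \<subseteq> f ` standard_simplex (Suc p)"
    using j simplical_face_in_standard_simplex[of "Suc p" j] by (auto simp: singular_face_def)
  \<comment> \<open>A face lies in every set that contains the whole simplex, so the least index
    cannot rise.\<close>
  have le: "colour e p ?g \<le> colour e (Suc p) f"
    using colour[OF Suc.prems(1)] g_im unfolding colour_def[of e p] by (intro Least_le) auto
  from Suc.IH[OF g l'] show ?case
  proof
    assume "\<not> distinct_adj l'"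
    then show ?case using l by (cases l') auto
  next
    assume *: "p \<le> colour e p ?g \<and> l' \<noteq> [] \<and> hd l' = apex e p ?g"
    show ?case
    proof (cases "colour e p ?g = colour e (Suc p) f")
      case True
      have "apex e p ?g = lam e (colour e (Suc p) f) (f (simplical_face j (basis_vec 0)))"
        unfolding apex_def True by (simp add: singular_face_def)
      also have "\<dots> = apex e (Suc p) f"
        using apex_eq[OF e Suc.prems(1), of "simplical_face j (basis_vec 0)"]
          simplical_face_in_standard_simplex[of "Suc p" j "basis_vec 0"] j by simp
      finally show ?thesis using * l by (cases l') auto
    next
      case False
      \<comment> \<open>A strict drop of the colour pays for the additional dimension.\<close>
      then show ?thesis using * le l by auto
    qed
  qed
qed simp

lemma apex_push:
  assumes e: "e \<in> tuples G (Suc (Suc m))" and j: "j \<le> Suc m"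
    and f: "small_simplex p (simplex_top m) (cov (del j e)) f"
  shows "apex e p (simplex_map p (simplical_face j) f) = apex (del j e) p f"
proof -
  have f_in: "f x \<in> standard_simplex m" if "x \<in> standard_simplex p" for x
    using small_simplex_imp_singular[OF f] that
    by (auto simp: singular_simplex_def continuous_map_in_subtopology)
  have "(i \<le> k \<and> simplex_map p (simplical_face j) f ` standard_simplex p \<subseteq> U e i) \<longleftrightarrow>
      (i \<le> k \<and> f ` standard_simplex p \<subseteq> U (del j e) i)" for i
    using U_face[OF e j] f_in by (auto simp: simplex_map_def)
  then have "colour e p (simplex_map p (simplical_face j) f) = colour (del j e) p f"
    by (simp add: colour_def)
  then show ?thesis
    using lam_face[OF e j colour(1)[OF f] f_in[of "basis_vec 0"]] colour_vertex[OF f]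
    by (auto simp: apex_def simplex_map_def)
qed

text \<open>The cover and the labels of a simplex restrict to those of its faces, so apexes can be
  computed in either. Together with the boundary formula for \<open>F\<close> this makes
  \<open>T\<close> a chain map.\<close>

lemma L_push:
  assumes e: "e \<in> tuples G (Suc (Suc m))" and j: "j \<le> Suc m"
  shows "small_simplex p (simplex_top m) (cov (del j e)) f \<Longrightarrow>
    L e p (simplex_map p (simplical_face j) f) = L (del j e) p f"
proof (induction p arbitrary: f)
  case 0
  then show ?case using apex_push[OF e j 0] by simp
next
  case (Suc p)
  have "singular_face (Suc p) i (simplex_map (Suc p) (simplical_face j) f)
      = simplex_map p (simplical_face j) (singular_face (Suc p) i f)" if "i \<le> Suc p" for i
    using that singular_face_simplex_map[of "Suc p" i "simplical_face j" f]
    by (auto simp: simplex_map_def singular_face_def fun_eq_iff)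
  then have "L e p (singular_face (Suc p) i (simplex_map (Suc p) (simplical_face j) f))
      = L (del j e) p (singular_face (Suc p) i f)" if "i \<le> Suc p" for i
    using that Suc.IH[OF small_simplex_face[OF Suc.prems]] by simp
  then show ?case
    unfolding L_Suc apex_push[OF e j Suc.prems] by (simp del: sum.atMost_Suc)
qed

lemma apex_act:
  assumes h: "h \<in> carrier G" and e: "e \<in> tuples G (Suc m)" and f: "small_simplex p (simplex_top m) (cov e) f"
  shows "apex (map ((\<otimes>) h) e) p f = h \<otimes> apex e p f"
  using lam_act[OF h e colour(1)[OF f] colour_vertex[OF f]]
  by (auto simp: apex_def colour_def U_act[OF h e])

lemma L_act:
  assumes h: "h \<in> carrier G" and e: "e \<in> tuples G (Suc m)"
  shows "small_simplex p (simplex_top m) (cov e) f \<Longrightarrow> L (map ((\<otimes>) h) e) p f = relabel ((\<otimes>) h) (L e p f)"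
proof (induction p arbitrary: f)
  case 0
  then show ?case using apex_act[OF h e 0] by (simp add: relabel_simps)
next
  case (Suc p)
  have "relabel ((\<otimes>) h) (\<Sum>j\<le>Suc p. frag_cmul ((-1) ^ j) (L e p (singular_face (Suc p) j f)))
    = (\<Sum>j\<le>Suc p. frag_cmul ((-1) ^ j) (L (map ((\<otimes>) h) e) p (singular_face (Suc p) j f)))"
    using Suc.IH[OF small_simplex_face[OF Suc.prems]]
    by (simp add: relabel_def frag_extend_sum frag_extend_cmul o_def del: sum.atMost_Suc)
  then show ?case
    unfolding L_Suc by (simp add: relabel_prepend apex_act[OF h e Suc.prems] del: sum.atMost_Suc)
qed

text \<open>A tuple is turned into a small chain and this into flags of apexes. As \<open>F\<close>
  is invariant, the group enters only through the labels used by \<open>L\<close>.\<close>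

primrec T :: "nat \<Rightarrow> 'g list \<Rightarrow> 'g list \<Rightarrow>\<^sub>0 int" where
  "T 0 e = frag_of []"
| "T (Suc m) e = frag_extend (L e m) (F m e)"

lemma BD_T: 
  assumes e: "e \<in> tuples G (Suc m)"
  shows "BD (T (Suc m) e) = frag_extend (T m) (bd e)"
proof (cases m)
  case 0
  then obtain g where "e = [g]" using e by (auto simp: tuples_def length_Suc_conv)
  then show ?thesis using 0 by (simp add: bd_Cons prepend_simps)
next
  case (Suc n)
  note F = F_properties[OF e]
  have "BD (T (Suc m) e) = frag_extend (\<lambda>f. BD (L e m f)) (F m e)"
    by (simp add: frag_extend_comp)
  also have "\<dots> = frag_extend (\<lambda>f. frag_extend (L e n) (chain_boundary m (frag_of f))) (F m e)"
    using F Suc BD_L[of n "simplex_top m"] by (intro frag_extend_eq) (auto simp: small_chain_def dest!: small_simplex_imp_singular)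
  also have "\<dots> = frag_extend (L e n) (chain_boundary m (F m e))"
    unfolding frag_extend_comp[symmetric] by (simp add: chain_boundary_def Suc)
  also have "\<dots> = (\<Sum>j\<le>m. frag_cmul ((-1) ^ j) (frag_extend (L e n) (chain_map n (simplical_face j) (F n (del j e)))))"
    using F Suc by (simp add: frag_extend_sum frag_extend_cmul o_def del: sum.atMost_Suc F.simps)
  also have "\<dots> = (\<Sum>j\<le>m. frag_cmul ((-1) ^ j) (T m (del j e)))"
  proof (intro sum.cong refl arg_cong[where f="frag_cmul _"])
    fix j assume "j \<in> {..m}"
    then have j: "j \<le> Suc n" using Suc by simp
    have "small_chain n (simplex_top n) (cov (del j e)) (F n (del j e))"
      using F_properties[OF del_in_tuples[OF e[unfolded Suc] j]] by auto
    then have "frag_extend (\<lambda>f. L e n (simplex_map n (simplical_face j) f)) (F n (del j e)) = frag_extend (L (del j e) n) (F n (del j e))"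
      using e Suc j by (intro frag_extend_eq L_push) (auto simp: small_chain_def)
    then show "frag_extend (L e n) (chain_map n (simplical_face j) (F n (del j e))) = T m (del j e)"
      by (simp add: Suc chain_map_def frag_extend_comp)
  qed
  also have "\<dots> = frag_extend (T m) (bd e)"
    using e by (simp add: bd_def frag_extend_sum frag_extend_cmul o_def tuples_def lessThan_Suc_atMost del: T.simps)
  finally show ?thesis .
qed

lemma keys_T: "e \<in> tuples G n \<Longrightarrow> Poly_Mapping.keys (T n e) \<subseteq> tuples G n"
proof (cases n)
  case (Suc m)
  assume e: "e \<in> tuples G n"
  then have "small_chain m (simplex_top m) (cov e) (F m e)"
    using F_properties Suc by blast
  then show ?thesis
    using e keys_L[of e m m] unfolding Suc T.simps small_chain_def by (intro keys_frag_extend_subset) blast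
qed (simp add: tuples_def)

lemma T_act:
  assumes h: "h \<in> carrier G" and e: "e \<in> tuples G n"
  shows "T n (map ((\<otimes>) h) e) = relabel ((\<otimes>) h) (T n e)"
proof (cases n)
  case (Suc m)
  have "small_chain m (simplex_top m) (cov e) (F m e)"
    using F_properties e Suc by blast
  then have "frag_extend (L (map ((\<otimes>) h) e) m) (F m e) = frag_extend (\<lambda>f. relabel ((\<otimes>) h) (L e m f)) (F m e)"
    using L_act[OF h e[unfolded Suc]] by (intro frag_extend_eq) (auto simp: small_chain_def)
  then show ?thesis
    using h e by (simp add: Suc F_act relabel_def frag_extend_comp)
qed (simp add: relabel_simps)

text \<open>A list with distinct neighbours would come from a simplex of dimension
  \<open>m > k\<close> whose colour is at least \<open>m\<close>, but colours are at most
  \<open>k\<close>.\<close>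

lemma T_degenerate:
  assumes e: "e \<in> tuples G n" and n: "Suc k < n" and l: "l \<in> Poly_Mapping.keys (T n e)"
  shows "\<not> distinct_adj l"
proof -
  obtain m where m: "n = Suc m" "k < m" using n by (cases n) auto
  obtain f where f: "f \<in> Poly_Mapping.keys (F m e)" "l \<in> Poly_Mapping.keys (L e m f)"
    using l keys_frag_extend[of "L e m" "F m e"] m by auto
  then have "small_simplex m (simplex_top m) (cov e) f"
    using F_properties[OF e[unfolded m]] by (auto simp: small_chain_def)
  then show ?thesis
    using L_degenerate[OF e[unfolded m] _ f(2)] colour(1)[of m m e f] m by fastforce
qed

text \<open>\<open>nrm\<close> is applied after \<open>T\<close> because it kills exactly the kind
  of lists to which \<open>T\<close> is confined in high degrees. The bound \<open>Suc k\<close>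
  counts list entries and corresponds to dimension \<open>k\<close>.\<close>

sublocale equivariant_contraction G "\<lambda>n l. frag_extend (nrm n) (T n l)" "Suc k"
proof
  show "frag_extend (nrm 0) (T 0 []) = frag_of []" by simp
  show "BD (frag_extend (nrm (Suc n)) (T (Suc n) l)) = frag_extend (\<lambda>l. frag_extend (nrm n) (T n l)) (bd l)"
    if l: "l \<in> tuples G (Suc n)" for n l
  proof -
    have "BD (frag_extend (nrm (Suc n)) (T (Suc n) l)) = frag_extend (\<lambda>l. BD (nrm (Suc n) l)) (T (Suc n) l)"
      by (rule frag_extend_comp)
    also have "\<dots> = frag_extend (\<lambda>l. frag_extend (nrm n) (bd l)) (T (Suc n) l)"
      using keys_T[OF l] by (intro frag_extend_eq BD_nrm) (auto simp: tuples_def)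
    also have "\<dots> = frag_extend (nrm n) (frag_extend (T n) (bd l))"
      by (simp add: BD_T[OF l] del: T.simps flip: frag_extend_comp)
    finally show ?thesis by (simp add: frag_extend_comp)
  qed
  show "Poly_Mapping.keys (frag_extend (nrm n) (T n l)) \<subseteq> tuples G n" if "l \<in> tuples G n" for n l
    using keys_T[OF that] keys_nrm by (intro keys_frag_extend_subset) blast
  show "frag_extend (nrm n) (T n (map ((\<otimes>) h) l)) = relabel ((\<otimes>) h) (frag_extend (nrm n) (T n l))"
    if "h \<in> carrier G" "l \<in> tuples G n" for h n l
  proof -
    have "frag_extend (nrm n) (T n (map ((\<otimes>) h) l)) = frag_extend (\<lambda>l. nrm n (map ((\<otimes>) h) l)) (T n l)"
      by (simp add: T_act[OF that] relabel_def frag_extend_comp)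
    also have "\<dots> = frag_extend (\<lambda>l. relabel ((\<otimes>) h) (nrm n l)) (T n l)"
      using keys_T[OF that(2)] by (intro frag_extend_eq relabel_nrm[symmetric]) (auto simp: tuples_def)
    finally show ?thesis by (simp add: relabel_def frag_extend_comp)
  qed
  show "frag_extend (nrm n) (T n l) = 0" if l: "l \<in> tuples G n" and "Suc k < n" for n l
  proof (rule frag_extend_eq_0)
    fix l' assume l': "l' \<in> Poly_Mapping.keys (T n l)"
    then have "length l' = n" using keys_T[OF l] by (auto simp: tuples_def)
    then show "nrm n l' = 0" using nrm_eq_0[OF T_degenerate[OF that l']] by simp
  qed
qed

end

theorem (in simplex_cover) cd_le_cover: "cd TYPE('m) G \<le> enat k"
  using cd_le by simp

abbreviation unit_interval :: "real topology" where
  "unit_interval \<equiv> top_of_set {0..1}"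

lemma unit_square: "prod_topology unit_interval unit_interval = top_of_set ({0..1} \<times> {0..1})"
  by (simp add: prod_topology_subtopology_eu)

lemma continuous_map_square:
  "continuous_on ({0..1} \<times> {0..1}) f \<Longrightarrow> f \<in> {0..1} \<times> {0..1} \<rightarrow> S \<Longrightarrow>
     continuous_map (prod_topology unit_interval unit_interval) (top_of_set S) f"
  by (simp add: unit_square continuous_map_in_subtopology image_subset_iff_funcset)

section \<open>Paths and the fundamental group\<close>

definition path_htpy :: "'a topology \<Rightarrow> (real \<Rightarrow> 'a) \<Rightarrow> (real \<Rightarrow> 'a) \<Rightarrow> bool" where
  "path_htpy Y p q \<longleftrightarrow> homotopic_with (\<lambda>h. h 0 = p 0 \<and> h 1 = p 1) unit_interval Y p q"

definition path_join :: "(real \<Rightarrow> 'a) \<Rightarrow> (real \<Rightarrow> 'a) \<Rightarrow> real \<Rightarrow> 'a" where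
  "path_join p q t = (if t \<le> 1/2 then p (2 * t) else q (2 * t - 1))"

definition path_rev :: "(real \<Rightarrow> 'a) \<Rightarrow> real \<Rightarrow> 'a" where
  "path_rev p t = p (1 - t)"

lemma path_htpy_iff:
  "path_htpy Y p q \<longleftrightarrow> (\<exists>h. continuous_map (prod_topology unit_interval unit_interval) Y h \<and>
     (\<forall>s\<in>{0..1}. h (0, s) = p s \<and> h (1, s) = q s) \<and> (\<forall>t\<in>{0..1}. h (t, 0) = p 0 \<and> h (t, 1) = p 1))"
  unfolding path_htpy_def by (subst homotopic_with) auto

lemma path_htpy_refl: "pathin Y p \<Longrightarrow> path_htpy Y p p"
  by (simp add: path_htpy_def pathin_def)

lemma path_htpy_ends: "path_htpy Y p q \<Longrightarrow> q 0 = p 0 \<and> q 1 = p 1"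
  unfolding path_htpy_def by (drule homotopic_with_imp_property) simp

lemma path_htpy_sym: "path_htpy Y p q \<Longrightarrow> path_htpy Y q p"
  using path_htpy_ends[of Y p q] homotopic_with_symD[of _ unit_interval Y p q] by (simp add: path_htpy_def)

lemma path_htpy_trans [trans]: "path_htpy Y p q \<Longrightarrow> path_htpy Y q r \<Longrightarrow> path_htpy Y p r"
  using path_htpy_ends[of Y p q] homotopic_with_trans[of _ unit_interval Y p q r] by (simp add: path_htpy_def)

lemma path_htpy_imp_pathin: "path_htpy Y p q \<Longrightarrow> pathin Y p \<and> pathin Y q"
  unfolding path_htpy_def pathin_def by (rule homotopic_with_imp_continuous_maps)

lemma path_htpy_cong: "pathin Y p \<Longrightarrow> (\<And>t. t \<in> {0..1} \<Longrightarrow> p t = q t) \<Longrightarrow> path_htpy Y p q"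
  unfolding path_htpy_def by (rule homotopic_with_equal) (auto simp: pathin_def)

lemma path_htpy_compose: "path_htpy X p q \<Longrightarrow> continuous_map X Y f \<Longrightarrow> path_htpy Y (f \<circ> p) (f \<circ> q)"
  unfolding path_htpy_def by (erule homotopic_with_compose_continuous_map_left) auto

text \<open>An interval is convex, so any two parameter paths with the same ends are homotopic in
  it. The laws for joining paths follow by writing both sides as one map on an interval,
  reparametrised by broken lines.\<close>

lemma path_htpy_through:
  fixes \<phi> \<psi> :: "real \<Rightarrow> real"
  assumes h: "continuous_map (top_of_set {a..b}) Y h"
    and \<phi>: "continuous_on {0..1} \<phi>" "\<phi> \<in> {0..1} \<rightarrow> {a..b}"
    and \<psi>: "continuous_on {0..1} \<psi>" "\<psi> \<in> {0..1} \<rightarrow> {a..b}"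
    and ends: "\<phi> 0 = \<psi> 0" "\<phi> 1 = \<psi> 1"
  shows "path_htpy Y (h \<circ> \<phi>) (h \<circ> \<psi>)"
proof (rule path_htpy_compose[OF _ h])
  let ?k = "\<lambda>(t, s). (1 - t) * \<phi> s + t * \<psi> s"
  have c: "continuous_on ({0..1} \<times> {0..1}) (\<lambda>x. \<phi> (snd x))" "continuous_on ({0..1} \<times> {0..1}) (\<lambda>x. \<psi> (snd x))"
    by (auto intro!: continuous_on_compose2[OF \<phi>(1)] continuous_on_compose2[OF \<psi>(1)] continuous_intros)
  have "continuous_on ({0..1} \<times> {0..1}) ?k"
    unfolding case_prod_unfold by (intro continuous_intros c)
  moreover have "?k \<in> {0..1} \<times> {0..1} \<rightarrow> {a..b}"
  proof
    fix x :: "real \<times> real" assume "x \<in> {0..1} \<times> {0..1}"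
    then obtain t s where x: "x = (t, s)" "t \<in> {0..1}" "s \<in> {0..1}" by auto
    then have "(1 - t) *\<^sub>R \<phi> s + t *\<^sub>R \<psi> s \<in> {a..b}"
      using \<phi> \<psi> by (intro convexD_alt) auto
    then show "?k x \<in> {a..b}" using x by simp
  qed
  ultimately have "continuous_map (prod_topology unit_interval unit_interval) (top_of_set {a..b}) ?k"
    by (rule continuous_map_square)
  then show "path_htpy (top_of_set {a..b}) \<phi> \<psi>"
    unfolding path_htpy_iff using ends by (intro exI[of _ ?k]) (auto simp: algebra_simps)
qed

lemma pathin_compose_interval:
  "continuous_map (top_of_set {a..b}) Y h \<Longrightarrow> continuous_on {0..1} \<phi> \<Longrightarrow> \<phi> \<in> {0..1} \<rightarrow> {a..b} \<Longrightarrow> pathin Y (h \<circ> \<phi>)"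
  unfolding pathin_def by (rule continuous_map_compose) (auto simp: image_subset_iff_funcset)

lemma continuous_map_translate:
  assumes "pathin Y p"
  shows "continuous_map (top_of_set {a..a+1}) Y (\<lambda>t. p (t - a))"
proof -
  have "continuous_map (top_of_set {a..a+1}) unit_interval (\<lambda>t. t - a)"
    by (auto intro!: continuous_intros)
  from continuous_map_compose[OF this, of Y p] show ?thesis
    using assms by (simp add: pathin_def o_def)
qed

definition path_join3 :: "(real \<Rightarrow> 'a) \<Rightarrow> (real \<Rightarrow> 'a) \<Rightarrow> (real \<Rightarrow> 'a) \<Rightarrow> real \<Rightarrow> 'a" where
  "path_join3 p q r t = (if t \<le> 1 then p t else if t \<le> 2 then q (t - 1) else r (t - 2))"

lemma continuous_map_path_join3:
  assumes "pathin Y p" "pathin Y q" "pathin Y r" "p 1 = q 0" "q 1 = r 0"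
  shows "continuous_map (top_of_set {0..3}) Y (path_join3 p q r)"
proof -
  have q: "continuous_map (top_of_set {1..2}) Y (\<lambda>t. q (t - 1))"
    and r: "continuous_map (top_of_set {2..3}) Y (\<lambda>t. r (t - 2))"
    using continuous_map_translate[OF assms(2), of 1] continuous_map_translate[OF assms(3), of 2] by simp_all
  have "continuous_map (top_of_set {1..3}) Y (\<lambda>t. if t \<le> 2 then q (t - 1) else r (t - 2))"
  proof (rule continuous_map_cases_le)
    have "{x. x \<in> topspace (top_of_set {1..3}) \<and> x \<le> 2} = {1..2::real}"
      "{x. x \<in> topspace (top_of_set {1..3}) \<and> 2 \<le> x} = {2..3::real}" by auto
    then show "continuous_map (subtopology (top_of_set {1..3}) {x. x \<in> topspace (top_of_set {1..3}) \<and> x \<le> 2}) Y (\<lambda>t. q (t - 1))"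
      "continuous_map (subtopology (top_of_set {1..3}) {x. x \<in> topspace (top_of_set {1..3}) \<and> 2 \<le> x}) Y (\<lambda>t. r (t - 2))"
      using q r by (simp_all add: subtopology_subtopology Int_absorb1 del: topspace_euclidean_subtopology)
  qed (use assms in auto)
  then have qr: "continuous_map (top_of_set {1..3}) Y (\<lambda>t. if t \<le> 2 then q (t - 1) else r (t - 2))" .
  show ?thesis
    unfolding path_join3_def[abs_def]
  proof (rule continuous_map_cases_le)
    have "{x. x \<in> topspace (top_of_set {0..3}) \<and> x \<le> 1} = {0..1::real}"
      "{x. x \<in> topspace (top_of_set {0..3}) \<and> 1 \<le> x} = {1..3::real}" by auto
    then show "continuous_map (subtopology (top_of_set {0..3}) {x. x \<in> topspace (top_of_set {0..3}) \<and> x \<le> 1}) Y p"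
      "continuous_map (subtopology (top_of_set {0..3}) {x. x \<in> topspace (top_of_set {0..3}) \<and> 1 \<le> x}) Y
         (\<lambda>t. if t \<le> 2 then q (t - 1) else r (t - 2))"
      using qr assms(1) by (simp_all add: subtopology_subtopology Int_absorb1 pathin_def del: topspace_euclidean_subtopology)
  qed (use assms in auto)
qed

lemma continuous_on_broken_line:
  fixes f g :: "real \<Rightarrow> real"
  assumes "continuous_on {0..1} f" "continuous_on {0..1} g" "f (1/2) = g (1/2)"
  shows "continuous_on {0..1} (\<lambda>t. if t \<le> 1/2 then f t else g t)"
proof (rule continuous_on_cases_le)
  show "continuous_on {t \<in> {0..1}. t \<le> 1/2} f" "continuous_on {t \<in> {0..1}. 1/2 \<le> t} g"
    using assms by (auto elim: continuous_on_subset)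
  show "f t = g t" if "t = 1/2" for t
    unfolding that by (rule assms)
qed (rule continuous_on_id)

lemma path_join_ends [simp]: "path_join p q 0 = p 0" "path_join p q 1 = q 1"
  by (simp_all add: path_join_def)

lemma path_rev_ends [simp]: "path_rev p 0 = p 1" "path_rev p 1 = p 0"
  by (simp_all add: path_rev_def)

lemma path_rev_rev [simp]: "path_rev (path_rev p) = p"
  by (simp add: path_rev_def fun_eq_iff)

lemma pathin_rev: "pathin Y p \<Longrightarrow> pathin Y (path_rev p)"
  using pathin_compose_interval[of 0 1 Y p "\<lambda>t. 1 - t", OF _ continuous_on_diff[OF continuous_on_const continuous_on_id]]
  by (auto simp: pathin_def path_rev_def[abs_def] o_def)

lemma pathin_join:
  assumes "pathin Y p" "pathin Y q" "p 1 = q 0"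
  shows "pathin Y (path_join p q)"
proof -
  let ?h = "path_join3 p q (\<lambda>_. q 1)"
  have "continuous_map (top_of_set {0..3}) Y ?h"
    using assms by (intro continuous_map_path_join3) (auto dest: path_finish_in_topspace)
  then have "pathin Y (?h \<circ> (\<lambda>t. 2 * t))"
    by (rule pathin_compose_interval) (auto intro!: continuous_intros)
  then show ?thesis
    unfolding pathin_def by (rule continuous_map_eq) (use assms in \<open>auto simp: path_join_def path_join3_def\<close>)
qed

lemma path_htpy_join:
  assumes p: "path_htpy Y p p'" and q: "path_htpy Y q q'" and pq: "p 1 = q 0"
  shows "path_htpy Y (path_join p q) (path_join p' q')"
proof -
  let ?I2 = "prod_topology unit_interval unit_interval"
  obtain h where h: "continuous_map ?I2 Y h" "\<And>s. s \<in> {0..1} \<Longrightarrow> h (0, s) = p s \<and> h (1, s) = p' s"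
      "\<And>t. t \<in> {0..1} \<Longrightarrow> h (t, 0) = p 0 \<and> h (t, 1) = p 1"
    using p unfolding path_htpy_iff by blast
  obtain k where k: "continuous_map ?I2 Y k" "\<And>s. s \<in> {0..1} \<Longrightarrow> k (0, s) = q s \<and> k (1, s) = q' s"
      "\<And>t. t \<in> {0..1} \<Longrightarrow> k (t, 0) = q 0 \<and> k (t, 1) = q 1"
    using q unfolding path_htpy_iff by blast
  let ?f = "\<lambda>x. if snd x \<le> 1/2 then h (fst x, 2 * snd x) else k (fst x, 2 * snd x - 1)"
  have "continuous_map ?I2 Y ?f"
  proof (rule continuous_map_cases_le)
    have 1: "continuous_map (top_of_set ({0..1} \<times> {0..1/2})) ?I2 (\<lambda>x. (fst x, 2 * snd x))"
      and 2: "continuous_map (top_of_set ({0..1} \<times> {1/2..1})) ?I2 (\<lambda>x. (fst x, 2 * snd x - 1))"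
      unfolding unit_square by (auto simp: continuous_map_in_subtopology intro!: continuous_intros)
    have "{x \<in> topspace ?I2. snd x \<le> 1/2} = {0..1} \<times> {0..1/2}" "{x \<in> topspace ?I2. 1/2 \<le> snd x} = {0..1} \<times> {1/2..1}"
      by auto
    moreover have "({0..1} \<times> {0..1}) \<inter> ({0..1} \<times> {0..1/2}) = {0..1::real} \<times> {0..1/2::real}"
      "({0..1} \<times> {0..1}) \<inter> ({0..1} \<times> {1/2..1}) = {0..1::real} \<times> {1/2..1::real}"
      by auto
    ultimately show "continuous_map (subtopology ?I2 {x \<in> topspace ?I2. snd x \<le> 1/2}) Y (\<lambda>x. h (fst x, 2 * snd x))"
      "continuous_map (subtopology ?I2 {x \<in> topspace ?I2. 1/2 \<le> snd x}) Y (\<lambda>x. k (fst x, 2 * snd x - 1))"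
      using continuous_map_compose[OF 1 h(1)] continuous_map_compose[OF 2 k(1)]
      by (simp_all add: unit_square subtopology_subtopology o_def)
    have sq: "continuous_map ?I2 euclideanreal snd" "continuous_map ?I2 euclideanreal (\<lambda>x. 1/2)"
      unfolding unit_square by (auto intro!: continuous_intros)
    then show "continuous_map ?I2 euclideanreal snd" "continuous_map ?I2 euclideanreal (\<lambda>x. 1/2)" .
    show "h (fst x, 2 * snd x) = k (fst x, 2 * snd x - 1)" if "x \<in> topspace ?I2" "snd x = 1/2" for x
      unfolding that(2) using that(1) h(3)[of "fst x"] k(3)[of "fst x"] pq by auto
  qed
  then show ?thesis
    unfolding path_htpy_iff using h k by (intro exI[of _ ?f]) (auto simp: path_join_def)
qed

lemma path_join_assoc:
  assumes "pathin Y p" "pathin Y q" "pathin Y r" "p 1 = q 0" "q 1 = r 0"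
  shows "path_htpy Y (path_join (path_join p q) r) (path_join p (path_join q r))"
proof -
  let ?h = "path_join3 p q r"
  let ?a = "\<lambda>t::real. if t \<le> 1/2 then 4 * t else 2 * t + 1"
  let ?b = "\<lambda>t::real. if t \<le> 1/2 then 2 * t else 4 * t - 1"
  have h: "continuous_map (top_of_set {0..3}) Y ?h"
    using assms by (intro continuous_map_path_join3) (auto dest: path_finish_in_topspace)
  have 1: "path_htpy Y (?h \<circ> ?a) (?h \<circ> ?b)"
    by (rule path_htpy_through[OF h]; (intro continuous_on_broken_line continuous_intros)?) auto
  have 2: "path_htpy Y (path_join (path_join p q) r) (?h \<circ> ?a)"
    using assms by (intro path_htpy_cong pathin_join) (auto simp: path_join_def path_join3_def)
  have 3: "path_htpy Y (path_join p (path_join q r)) (?h \<circ> ?b)"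
    using assms by (intro path_htpy_cong pathin_join) (auto simp: path_join_def path_join3_def)
  show ?thesis by (rule path_htpy_trans[OF 2 path_htpy_trans[OF 1 path_htpy_sym[OF 3]]])
qed

lemma path_join_cancel:
  assumes "pathin Y p" "pathin Y q" "p 1 = q 0"
  shows "path_htpy Y (path_join (path_join p q) (path_rev q)) p"
proof -
  let ?h = "path_join3 p q (\<lambda>_. q 1)"
  \<comment> \<open>The parameter runs through \<open>p\<close> and \<open>q\<close> up to
    \<open>2\<close> and then back to \<open>1\<close>, so its ends are those of the plain run
    through \<open>p\<close>.\<close>
  let ?a = "\<lambda>t::real. if t \<le> 1/2 then 4 * t else 3 - 2 * t"
  have h: "continuous_map (top_of_set {0..3}) Y ?h"
    using assms by (intro continuous_map_path_join3) (auto dest: path_finish_in_topspace)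
  have 1: "path_htpy Y (?h \<circ> ?a) (?h \<circ> (\<lambda>t. t))"
    by (rule path_htpy_through[OF h]; (intro continuous_on_broken_line continuous_intros)?) auto
  have 2: "path_htpy Y (path_join (path_join p q) (path_rev q)) (?h \<circ> ?a)"
    using assms by (intro path_htpy_cong pathin_join pathin_rev) (auto simp: path_join_def path_join3_def path_rev_def)
  have 3: "path_htpy Y p (?h \<circ> (\<lambda>t. t))"
    using assms by (intro path_htpy_cong) (auto simp: path_join3_def)
  show ?thesis by (rule path_htpy_trans[OF 2 path_htpy_trans[OF 1 path_htpy_sym[OF 3]]])
qed

lemma path_join_const:
  assumes "pathin Y p"
  shows "path_htpy Y (path_join p (\<lambda>_. p 1)) p" "path_htpy Y (path_join (\<lambda>_. p 0) p) p"
proof -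
  have const: "pathin Y (\<lambda>_. p 1)" "pathin Y (\<lambda>_. p 0)"
    using assms by (auto dest: path_finish_in_topspace path_start_in_topspace)
  note through = path_htpy_through[OF assms[unfolded pathin_def]]
  have "path_htpy Y (p \<circ> (\<lambda>t. min (2 * t) 1)) (p \<circ> (\<lambda>t. t))"
    by (rule through; (intro continuous_intros)?) auto
  moreover have "path_htpy Y (path_join p (\<lambda>_. p 1)) (p \<circ> (\<lambda>t. min (2 * t) 1))"
    using assms const by (intro path_htpy_cong pathin_join) (auto simp: path_join_def min_def)
  ultimately show "path_htpy Y (path_join p (\<lambda>_. p 1)) p"
    unfolding o_def by (rule path_htpy_trans[rotated])
  have "path_htpy Y (p \<circ> (\<lambda>t. max (2 * t - 1) 0)) (p \<circ> (\<lambda>t. t))"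
    by (rule through; (intro continuous_intros)?) auto
  moreover have "path_htpy Y (path_join (\<lambda>_. p 0) p) (p \<circ> (\<lambda>t. max (2 * t - 1) 0))"
    using assms const by (intro path_htpy_cong pathin_join) (auto simp: path_join_def max_def)
  ultimately show "path_htpy Y (path_join (\<lambda>_. p 0) p) p"
    unfolding o_def by (rule path_htpy_trans[rotated])
qed

section \<open>Loops and one-dimensional spheroids\<close>

declare One_nat_def [simp del]

lemma continuous_map_Euclidean_coordinate: "continuous_map (Euclidean_space n) euclideanreal (\<lambda>s. s i)"
  using continuous_map_product_projection[of i UNIV "\<lambda>_. euclideanreal"]
  by (simp add: Euclidean_space_def continuous_map_from_subtopology)

lemma topspace_cube: "topspace (cube n) = {s. (\<forall>i<n. 0 \<le> s i \<and> s i \<le> 1) \<and> (\<forall>i\<ge>n. s i = 0)}"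
  by (auto simp: cube_def topspace_Euclidean_space)

lemma continuous_map_cube_coordinate: "continuous_map (cube n) euclideanreal (\<lambda>s. s i)"
  unfolding cube_def by (rule continuous_map_from_subtopology[OF continuous_map_Euclidean_coordinate])

lemma continuous_map_into_cube:
  "continuous_map X (cube n) f \<longleftrightarrow> (\<forall>i. continuous_map X euclideanreal (\<lambda>x. f x i)) \<and> f \<in> topspace X \<rightarrow> topspace (cube n)"
proof -
  have "cube n = subtopology (powertop_real UNIV) (topspace (cube n))"
    by (simp add: cube_def Euclidean_space_def subtopology_subtopology)
  then show ?thesis
    by (metis continuous_map_componentwise_UNIV continuous_map_in_subtopology)
qed

definition cube_point :: "real \<Rightarrow> nat \<Rightarrow> real" where
  "cube_point t i = (if i = 0 then t else 0)"

lemma cube_point_0 [simp]: "cube_point t 0 = t"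
  by (simp add: cube_point_def)

lemma cube_point_eq: "s \<in> topspace (cube 1) \<Longrightarrow> cube_point (s 0) = s"
  by (auto simp: topspace_cube cube_point_def fun_eq_iff)

lemma continuous_cube_point: "continuous_map unit_interval (cube 1) cube_point"
  by (auto simp: continuous_map_into_cube topspace_cube cube_point_def)

lemma continuous_cube_coordinate_0: "continuous_map (cube 1) unit_interval (\<lambda>s. s 0)"
  by (auto simp: continuous_map_in_subtopology continuous_map_cube_coordinate topspace_cube)

definition loop_spheroid :: "(real \<Rightarrow> 'a) \<Rightarrow> (nat \<Rightarrow> real) \<Rightarrow> 'a" where
  "loop_spheroid p s = p (s 0)"

definition is_loop :: "'a topology \<Rightarrow> 'a \<Rightarrow> (real \<Rightarrow> 'a) \<Rightarrow> bool" where
  "is_loop Y y p \<longleftrightarrow> pathin Y p \<and> p 0 = y \<and> p 1 = y"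

lemma cube_boundary_1: "cube_boundary 1 = {cube_point 0, cube_point 1}"
proof -
  have "s = cube_point 0 \<or> s = cube_point 1" if "s \<in> cube_boundary 1" for s
    using that cube_point_eq[of s] by (auto simp: cube_boundary_def)
  then show ?thesis by (auto simp: cube_boundary_def topspace_cube cube_point_def)
qed

lemma loop_spheroid_in: "is_loop Y y p \<Longrightarrow> loop_spheroid p \<in> spheroids 1 Y y"
  using continuous_map_compose[OF continuous_cube_coordinate_0, of Y p]
  by (auto simp: spheroids_def is_loop_def pathin_def loop_spheroid_def[abs_def] o_def cube_boundary_1)

lemma spheroid_loop: "f \<in> spheroids 1 Y y \<Longrightarrow> is_loop Y y (f \<circ> cube_point)"
  using continuous_map_compose[OF continuous_cube_point, of Y f]
  by (auto simp: spheroids_def is_loop_def pathin_def cube_boundary_1)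

lemma equiv_spheroid_rel: "equiv (spheroids n Y y) (spheroid_rel n Y y)"
proof (rule equivI)
  show "refl_on (spheroids n Y y) (spheroid_rel n Y y)"
    by (auto simp: refl_on_def spheroid_rel_def spheroids_def)
  show "sym (spheroid_rel n Y y)"
    by (auto simp: sym_def spheroid_rel_def intro: homotopic_with_symD)
  show "trans (spheroid_rel n Y y)"
    by (auto simp: trans_def spheroid_rel_def intro: homotopic_with_trans)
qed (auto simp: spheroid_rel_def)

lemma path_htpy_imp_spheroid_rel:
  assumes "is_loop Y y p" "path_htpy Y p q"
  shows "(loop_spheroid p, loop_spheroid q) \<in> spheroid_rel 1 Y y"
proof -
  have q: "is_loop Y y q"
    using assms path_htpy_ends[OF assms(2)] path_htpy_imp_pathin[OF assms(2)] by (simp add: is_loop_def)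
  have "homotopic_with (\<lambda>h. h (cube_point 0) = y \<and> h (cube_point 1) = y) (cube 1) Y (p \<circ> (\<lambda>s. s 0)) (q \<circ> (\<lambda>s. s 0))"
    using assms(2) continuous_cube_coordinate_0 unfolding path_htpy_def
    by (rule homotopic_with_compose_continuous_map_right) (use assms(1) in \<open>auto simp: is_loop_def\<close>)
  then show ?thesis
    using loop_spheroid_in[OF assms(1)] loop_spheroid_in[OF q]
    by (simp add: spheroid_rel_def cube_boundary_1 loop_spheroid_def[abs_def] o_def)
qed

lemma spheroid_rel_imp_path_htpy:
  assumes "(f, g) \<in> spheroid_rel 1 Y y"
  shows "path_htpy Y (f \<circ> cube_point) (g \<circ> cube_point)"
proof -
  have f: "is_loop Y y (f \<circ> cube_point)" using assms by (auto simp: spheroid_rel_def intro: spheroid_loop)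
  have "homotopic_with (\<lambda>h. \<forall>s\<in>cube_boundary 1. h s = y) (cube 1) Y f g"
    using assms by (simp add: spheroid_rel_def)
  then have "homotopic_with (\<lambda>h. h 0 = y \<and> h 1 = y) unit_interval Y (f \<circ> cube_point) (g \<circ> cube_point)"
    by (rule homotopic_with_compose_continuous_map_right[OF _ continuous_cube_point]) (auto simp: cube_boundary_1)
  then show ?thesis using f by (simp add: path_htpy_def is_loop_def)
qed

definition loop_class :: "'a topology \<Rightarrow> 'a \<Rightarrow> (real \<Rightarrow> 'a) \<Rightarrow> ((nat \<Rightarrow> real) \<Rightarrow> 'a) set" where
  "loop_class Y y p = spheroid_rel 1 Y y `` {loop_spheroid p}"

lemma loop_spheroid_cube_point [simp]: "loop_spheroid p \<circ> cube_point = p"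
  by (simp add: loop_spheroid_def fun_eq_iff)

lemma loop_class_eq_iff:
  assumes "is_loop Y y p" "is_loop Y y q"
  shows "loop_class Y y p = loop_class Y y q \<longleftrightarrow> path_htpy Y p q"
proof -
  have "loop_class Y y p = loop_class Y y q \<longleftrightarrow> (loop_spheroid p, loop_spheroid q) \<in> spheroid_rel 1 Y y"
    unfolding loop_class_def
    using eq_equiv_class_iff[OF equiv_spheroid_rel loop_spheroid_in[OF assms(1)] loop_spheroid_in[OF assms(2)]] .
  also have "\<dots> \<longleftrightarrow> path_htpy Y p q"
    using path_htpy_imp_spheroid_rel[OF assms(1)] spheroid_rel_imp_path_htpy[of "loop_spheroid p" "loop_spheroid q" Y y]
    by auto
  finally show ?thesis .
qed

lemma loop_class_in: "is_loop Y y p \<Longrightarrow> loop_class Y y p \<in> carrier (fundamental_group Y y)"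
  unfolding loop_class_def homotopy_group_def by (simp add: quotientI loop_spheroid_in)

lemma loop_spheroid_mem: "is_loop Y y p \<Longrightarrow> loop_spheroid p \<in> loop_class Y y p"
  unfolding loop_class_def by (rule equiv_class_self[OF equiv_spheroid_rel loop_spheroid_in])

lemma loop_class_mem:
  assumes "f \<in> loop_class Y y p"
  shows "f \<in> spheroids 1 Y y" "path_htpy Y p (f \<circ> cube_point)"
  using assms spheroid_rel_imp_path_htpy[of "loop_spheroid p" f Y y]
  by (auto simp: loop_class_def spheroid_rel_def)

lemma loop_spheroid_rel:
  assumes "f \<in> spheroids 1 Y y"
  shows "(f, loop_spheroid (f \<circ> cube_point)) \<in> spheroid_rel 1 Y y"
proof -
  have "homotopic_with (\<lambda>h. \<forall>s\<in>cube_boundary 1. h s = y) (cube 1) Y f (loop_spheroid (f \<circ> cube_point))"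
    using assms by (intro homotopic_with_equal) 
      (auto simp: spheroids_def loop_spheroid_def cube_point_eq cube_boundary_1)
  then show ?thesis
    using assms loop_spheroid_in[OF spheroid_loop[OF assms]] by (simp add: spheroid_rel_def)
qed

lemma loop_class_surj:
  assumes "C \<in> carrier (fundamental_group Y y)"
  obtains p where "is_loop Y y p" "C = loop_class Y y p"
proof -
  obtain f where f: "f \<in> spheroids 1 Y y" "C = spheroid_rel 1 Y y `` {f}"
    using assms by (auto simp: homotopy_group_def elim: quotientE)
  have "C = loop_class Y y (f \<circ> cube_point)"
    unfolding f(2) loop_class_def by (rule equiv_class_eq[OF equiv_spheroid_rel loop_spheroid_rel[OF f(1)]])
  then show thesis using that spheroid_loop[OF f(1)] by blast
qed

lemma is_loop_join: "is_loop Y y p \<Longrightarrow> is_loop Y y q \<Longrightarrow> is_loop Y y (path_join p q)"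
  by (simp add: is_loop_def pathin_join)

lemma spheroid_concat_eq: "spheroid_concat (loop_spheroid p) (loop_spheroid q) = loop_spheroid (path_join p q)"
  by (auto simp: spheroid_concat_def loop_spheroid_def path_join_def fun_eq_iff)

lemma spheroid_concat_cong:
  assumes "\<And>s. s \<in> topspace (cube 1) \<Longrightarrow> f s = f' s" "\<And>s. s \<in> topspace (cube 1) \<Longrightarrow> g s = g' s"
    and s: "s \<in> topspace (cube 1)"
  shows "spheroid_concat f g s = spheroid_concat f' g' s"
proof -
  have "s(0 := 2 * s 0) \<in> topspace (cube 1)" if "s 0 \<le> 1/2"
    using s that by (auto simp: topspace_cube)
  moreover have "s(0 := 2 * s 0 - 1) \<in> topspace (cube 1)" if "\<not> s 0 \<le> 1/2"
    using s that by (auto simp: topspace_cube)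
  ultimately show ?thesis using assms by (simp add: spheroid_concat_def)
qed

text \<open>The product in \<open>homotopy_group\<close> is a union over all representatives, so
  every pair of them has to give the same class. A spheroid and its loop agree only on the cube,
  which is why the concatenations are compared there.\<close>

lemma loop_class_mult:
  assumes p: "is_loop Y y p" and q: "is_loop Y y q"
  shows "loop_class Y y p \<otimes>\<^bsub>fundamental_group Y y\<^esub> loop_class Y y q = loop_class Y y (path_join p q)"
proof -
  have "spheroid_rel 1 Y y `` {spheroid_concat f g} = loop_class Y y (path_join p q)"
    if f: "f \<in> loop_class Y y p" and g: "g \<in> loop_class Y y q" for f g
  proof -
    let ?p = "f \<circ> cube_point" and ?q = "g \<circ> cube_point"
    note f' = loop_class_mem[OF f] and g' = loop_class_mem[OF g]
    have loops: "is_loop Y y ?p" "is_loop Y y ?q" by (rule spheroid_loop f' g')+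
    have "path_htpy Y (path_join p q) (path_join ?p ?q)"
      using path_htpy_join[OF f'(2) g'(2)] p q by (simp add: is_loop_def)
    then have "loop_class Y y (path_join p q) = loop_class Y y (path_join ?p ?q)"
      using p q loops by (simp add: loop_class_eq_iff is_loop_join)
    moreover have "(loop_spheroid (path_join ?p ?q), spheroid_concat f g) \<in> spheroid_rel 1 Y y"
    proof -
      have eq: "loop_spheroid (path_join ?p ?q) s = spheroid_concat f g s" if "s \<in> topspace (cube 1)" for s
        unfolding spheroid_concat_eq[symmetric]
        by (rule spheroid_concat_cong[OF _ _ that]) (auto simp: loop_spheroid_def cube_point_eq)
      have l: "loop_spheroid (path_join ?p ?q) \<in> spheroids 1 Y y"
        using loops by (intro loop_spheroid_in is_loop_join)
      have b: "cube_boundary 1 \<subseteq> topspace (cube 1)" by (auto simp: cube_boundary_def)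
      then have "homotopic_with (\<lambda>h. \<forall>s\<in>cube_boundary 1. h s = y) (cube 1) Y
         (loop_spheroid (path_join ?p ?q)) (spheroid_concat f g)"
        using l eq by (intro homotopic_with_equal) (auto simp: spheroids_def subset_iff)
      moreover from this have "spheroid_concat f g \<in> spheroids 1 Y y"
        using homotopic_with_imp_continuous_maps homotopic_with_imp_property unfolding spheroids_def by blast
      ultimately show ?thesis using l by (simp add: spheroid_rel_def)
    qed
    then have "loop_class Y y (path_join ?p ?q) = spheroid_rel 1 Y y `` {spheroid_concat f g}"
      unfolding loop_class_def by (rule equiv_class_eq[OF equiv_spheroid_rel])
    ultimately show ?thesis by simp
  qed
  then show ?thesis
    using loop_spheroid_mem[OF p] loop_spheroid_mem[OF q] unfolding homotopy_group_def by (simp, blast)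
qed

lemma pi1_map_loop_class:
  assumes p: "is_loop X x p" and f: "continuous_map X Y f" "f x = y"
  shows "pi1_map Y y f (loop_class X x p) = loop_class Y y (f \<circ> p)"
proof -
  have l: "is_loop Y y (f \<circ> p)" using p f by (auto simp: is_loop_def pathin_compose)
  have "spheroid_rel 1 Y y `` {f \<circ> g} = loop_class Y y (f \<circ> p)" if g: "g \<in> loop_class X x p" for g
  proof -
    note g' = loop_class_mem[OF g]
    have fg: "f \<circ> g \<in> spheroids 1 Y y"
      using g'(1) f by (auto simp: spheroids_def continuous_map_compose)
    have "path_htpy Y (f \<circ> p) ((f \<circ> g) \<circ> cube_point)"
      using path_htpy_compose[OF g'(2) f(1)] by (simp add: o_assoc)
    then have "loop_class Y y (f \<circ> p) = loop_class Y y ((f \<circ> g) \<circ> cube_point)"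
      using l spheroid_loop[OF fg] by (simp add: loop_class_eq_iff)
    also have "\<dots> = spheroid_rel 1 Y y `` {f \<circ> g}"
      unfolding loop_class_def by (rule equiv_class_eq[OF equiv_spheroid_rel loop_spheroid_rel[OF fg], symmetric])
    finally show ?thesis by simp
  qed
  then show ?thesis unfolding pi1_map_def using loop_spheroid_mem[OF p] by blast
qed

declare One_nat_def [simp]

text \<open>The two ways round the square, from one corner to the opposite one, are homotopic
  through segments because the square is convex. This extracts a conjugation from a free homotopy of
  loops.\<close>

lemma path_htpy_square:
  assumes h: "continuous_map (prod_topology unit_interval unit_interval) Y h"
  shows "path_htpy Y (path_join (\<lambda>s. h (0, s)) (\<lambda>t. h (t, 1))) (path_join (\<lambda>t. h (t, 0)) (\<lambda>s. h (1, s)))"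
proof -
  let ?S = "{0..1} \<times> {0..1::real}"
  let ?a = "\<lambda>s::real. (max 0 (2 * s - 1), min 1 (2 * s))" and ?b = "\<lambda>s::real. (min 1 (2 * s), max 0 (2 * s - 1))"
  let ?k = "\<lambda>(t, s). ((1 - t) * max 0 (2 * s - 1) + t * min 1 (2 * s), (1 - t) * min 1 (2 * s) + t * max 0 (2 * s - 1))"
  have conv: "(1 - t) * u + t * v \<in> {0..1}" if "t \<in> {0..1}" "u \<in> {0..1}" "v \<in> {0..1}" for t u v :: real
    using convexD_alt[of "{0..1::real}" u v t] that by simp
  have "continuous_map (prod_topology unit_interval unit_interval) (top_of_set ?S) ?k"
  proof (rule continuous_map_square)
    show "continuous_on ?S ?k"
      unfolding case_prod_unfold by (intro continuous_intros)
    show "?k \<in> ?S \<rightarrow> ?S"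
      using conv by auto
  qed
  then have ab: "path_htpy (top_of_set ?S) ?a ?b"
    unfolding path_htpy_iff by (intro exI[of _ ?k]) auto
  have "path_htpy Y (h \<circ> ?a) (h \<circ> ?b)"
    using path_htpy_compose[OF ab] h by (simp add: unit_square)
  moreover have "h \<circ> ?a = (\<lambda>s. if s \<le> 1/2 then h (0, 2 * s) else h (2 * s - 1, 1))"
    by (auto simp: fun_eq_iff max_absorb1 max_absorb2 min_absorb1 min_absorb2)
  moreover have "h \<circ> ?b = (\<lambda>s. if s \<le> 1/2 then h (2 * s, 0) else h (1, 2 * s - 1))"
    by (auto simp: fun_eq_iff max_absorb1 max_absorb2 min_absorb1 min_absorb2)
  ultimately show ?thesis
    by (simp add: path_join_def[abs_def])
qed

lemma path_join_compose: "f \<circ> path_join p q = path_join (f \<circ> p) (f \<circ> q)"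
  by (auto simp: path_join_def fun_eq_iff)

lemma path_rev_compose: "f \<circ> path_rev p = path_rev (f \<circ> p)"
  by (auto simp: path_rev_def fun_eq_iff)

section \<open>Labelling paths by group elements\<close>

locale path_labelling = plain_group P for P :: "'p monoid" (structure) +
  fixes Y :: "'u topology" and y :: 'u and \<beta> :: "'p \<Rightarrow> ((nat \<Rightarrow> real) \<Rightarrow> 'u) set"
  assumes base: "y \<in> topspace Y" and iso: "\<beta> \<in> iso P (fundamental_group Y y)"
begin

definition reach :: "'u \<Rightarrow> bool" where
  "reach v \<longleftrightarrow> (\<exists>p. pathin Y p \<and> p 0 = y \<and> p 1 = v)"

text \<open>The tail of the base point is chosen constant, so that \<open>lab\<close> assigns to a
  loop at \<open>y\<close> the element of its own class.\<close>

definition tail :: "'u \<Rightarrow> real \<Rightarrow> 'u" where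
  "tail v = (if v = y then (\<lambda>_. y) else (SOME p. pathin Y p \<and> p 0 = y \<and> p 1 = v))"

definition closing :: "(real \<Rightarrow> 'u) \<Rightarrow> real \<Rightarrow> 'u" where
  "closing p = path_join (path_join (tail (p 0)) p) (path_rev (tail (p 1)))"

text \<open>The retraction of the fundamental groupoid of the path component of \<open>y\<close>
  onto its fundamental group, along the chosen tails, followed by the inverse of
  \<open>\<beta>\<close>.\<close>

definition lab :: "(real \<Rightarrow> 'u) \<Rightarrow> 'p" where
  "lab p = inv_into (carrier P) \<beta> (loop_class Y y (closing p))"

lemma tail: "reach v \<Longrightarrow> pathin Y (tail v) \<and> tail v 0 = y \<and> tail v 1 = v"
  using base someI_ex[of "\<lambda>p. pathin Y p \<and> p 0 = y \<and> p 1 = v"] by (auto simp: tail_def reach_def)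

lemma reach_path: "pathin Y p \<Longrightarrow> reach (p 0) \<Longrightarrow> reach (p 1)"
  unfolding reach_def[of "p 1"] using tail[of "p 0"] by (intro exI[of _ "path_join (tail (p 0)) p"]) (auto simp: pathin_join)

lemma reach_path': "pathin Y p \<Longrightarrow> reach (p 1) \<Longrightarrow> reach (p 0)"
  using reach_path[of "path_rev p"] by (simp add: pathin_rev)

lemma reach_base: "reach y"
  unfolding reach_def using base by (intro exI[of _ "\<lambda>_. y"]) simp

lemma closing_loop: "pathin Y p \<Longrightarrow> reach (p 0) \<Longrightarrow> is_loop Y y (closing p)"
  using tail[of "p 0"] tail[of "p 1"] reach_path[of p]
  by (auto simp: closing_def is_loop_def intro!: pathin_join pathin_rev)

lemma bij: "bij_betw \<beta> (carrier P) (carrier (fundamental_group Y y))"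
  and hom: "\<beta> \<in> hom P (fundamental_group Y y)"
  using iso by (auto simp: iso_def)

lemma lab_closed [simp]: "pathin Y p \<Longrightarrow> reach (p 0) \<Longrightarrow> lab p \<in> carrier P"
  and \<beta>_lab: "pathin Y p \<Longrightarrow> reach (p 0) \<Longrightarrow> \<beta> (lab p) = loop_class Y y (closing p)"
  unfolding lab_def
  using bij_betw_apply[OF bij_betw_inv_into[OF bij] loop_class_in[OF closing_loop[of p]]]
    bij_betw_inv_into_right[OF bij loop_class_in[OF closing_loop[of p]]]
  by simp_all

lemma \<beta>_inj: "g \<in> carrier P \<Longrightarrow> h \<in> carrier P \<Longrightarrow> \<beta> g = \<beta> h \<Longrightarrow> g = h"
  using bij by (auto simp: bij_betw_def inj_on_def)

lemma lab_cong:
  assumes "path_htpy Y p q" "reach (p 0)"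
  shows "lab p = lab q"
proof -
  have q: "pathin Y p" "pathin Y q" "q 0 = p 0" "q 1 = p 1"
    using path_htpy_imp_pathin[OF assms(1)] path_htpy_ends[OF assms(1)] by auto
  have t: "pathin Y (tail (p 0)) \<and> tail (p 0) 1 = p 0" "pathin Y (tail (p 1)) \<and> tail (p 1) 1 = p 1"
    using tail reach_path[OF q(1) assms(2)] assms(2) by auto
  have "path_htpy Y (closing p) (closing q)"
    unfolding closing_def q(3,4) using t assms by (intro path_htpy_join path_htpy_refl pathin_rev) auto
  then have "loop_class Y y (closing p) = loop_class Y y (closing q)"
    using loop_class_eq_iff closing_loop q assms by metis
  then show ?thesis by (simp add: lab_def)
qed

text \<open>Between the two closed-up loops, the tail of the common point is traversed backwards and
  then forwards, and cancels.\<close>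

lemma lab_join:
  assumes p: "pathin Y p" "reach (p 0)" and q: "pathin Y q" and pq: "p 1 = q 0"
  shows "lab (path_join p q) = lab p \<otimes> lab q"
proof -
  have r: "reach (q 0)" "reach (q 1)" using reach_path p q pq by metis+
  let ?a = "tail (p 0)" and ?b = "tail (q 0)" and ?c = "path_rev (tail (q 1))"
  have a: "pathin Y ?a" "?a 0 = y" "?a 1 = p 0" and b: "pathin Y ?b" "?b 0 = y" "?b 1 = q 0"
    and c: "pathin Y ?c" "?c 0 = q 1" "?c 1 = y"
    using tail[OF p(2)] tail[OF r(1)] tail[OF r(2)] by (auto intro: pathin_rev)
  let ?ap = "path_join ?a p"
  have ap: "pathin Y ?ap" "?ap 1 = q 0" using a p pq by (auto intro: pathin_join)
  have "path_htpy Y (path_join (closing p) (closing q)) (path_join (path_join (path_join ?ap (path_rev ?b)) (path_join ?b q)) ?c)"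
    unfolding closing_def pq using a b c p q pq ap
    by (intro path_htpy_sym[OF path_join_assoc] path_htpy_sym) (auto intro!: pathin_join pathin_rev)
  also have "path_htpy Y \<dots> (path_join (path_join (path_join (path_join ?ap (path_rev ?b)) ?b) q) ?c)"
    using a b c p q pq ap
    by (intro path_htpy_join path_htpy_refl path_htpy_sym[OF path_join_assoc]) (auto intro!: pathin_join pathin_rev)
  also have "path_htpy Y \<dots> (path_join (path_join ?ap q) ?c)"
  proof -
    have "path_htpy Y (path_join (path_join ?ap (path_rev ?b)) ?b) ?ap"
      using path_join_cancel[OF ap(1) pathin_rev[OF b(1)]] b ap by simp
    then show ?thesis
      using q c b by (intro path_htpy_join[OF path_htpy_join] path_htpy_refl) auto
  qed
  also have "path_htpy Y \<dots> (closing (path_join p q))"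
  proof -
    have "path_htpy Y (path_join ?ap q) (path_join ?a (path_join p q))"
      using a p q pq by (intro path_join_assoc) auto
    then show ?thesis
      unfolding closing_def path_join_ends using c q by (intro path_htpy_join[OF _ path_htpy_refl]) auto
  qed
  finally have "loop_class Y y (path_join (closing p) (closing q)) = loop_class Y y (closing (path_join p q))"
    using p q pq r by (subst loop_class_eq_iff) (auto intro!: is_loop_join closing_loop pathin_join)
  then have "\<beta> (lab (path_join p q)) = \<beta> (lab p \<otimes> lab q)"
    using p q pq r hom_mult[OF hom, of "lab p" "lab q"]
    by (simp add: \<beta>_lab pathin_join loop_class_mult closing_loop del: One_nat_def)
  then show ?thesis using p q pq r by (intro \<beta>_inj) (auto simp: pathin_join)
qed

lemma lab_const: "reach v \<Longrightarrow> lab (\<lambda>_. v) = \<one>"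
proof -
  assume v: "reach v"
  then have p: "pathin Y (\<lambda>_. v)" using tail path_finish_in_topspace by fastforce
  have "path_join (\<lambda>_. v) (\<lambda>_. v) = (\<lambda>_. v)" by (simp add: path_join_def fun_eq_iff)
  then have "lab (\<lambda>_. v) \<otimes> lab (\<lambda>_. v) = lab (\<lambda>_. v)"
    using lab_join[OF p _ p] v by simp
  then show ?thesis using lab_closed[OF p] v by simp
qed

lemma lab_rev:
  assumes "pathin Y p" "reach (p 0)"
  shows "lab (path_rev p) = inv (lab p)"
proof -
  have r: "reach (p 1)" using assms reach_path by blast
  have "path_htpy Y (path_join (path_join (\<lambda>_. p 0) p) (path_rev p)) (\<lambda>_. p 0)"
    using assms path_start_in_topspace by (intro path_join_cancel) auto
  from lab_cong[OF this] have "lab (path_join (path_join (\<lambda>_. p 0) p) (path_rev p)) = \<one>"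
    using assms lab_const by simp
  moreover have "lab (path_join (path_join (\<lambda>_. p 0) p) (path_rev p)) = lab p \<otimes> lab (path_rev p)"
    using assms r path_start_in_topspace[OF assms(1)]
    by (subst lab_join, auto intro!: pathin_join pathin_rev)
      (subst lab_join, auto simp: lab_const)
  ultimately show ?thesis
    using assms r inv_equality[of "lab (path_rev p)" "lab p"] lab_closed[of "path_rev p"]
    by (metis inv_char lab_closed pathin_rev path_rev_ends(1) inv_comm inv_equality)
qed

lemma lab_loop:
  assumes "is_loop Y y p"
  shows "\<beta> (lab p) = loop_class Y y p"
proof -
  have p: "pathin Y p" "p 0 = y" "p 1 = y" using assms by (auto simp: is_loop_def)
  have t: "tail y = (\<lambda>_. y)" "path_rev (\<lambda>_. y) = (\<lambda>_. y)" by (simp_all add: tail_def path_rev_def fun_eq_iff)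
  have "path_htpy Y (closing p) (path_join p (\<lambda>_. y))"
    unfolding closing_def p t using path_join_const[OF p(1)] p base by (intro path_htpy_join path_htpy_refl) auto
  also have "path_htpy Y \<dots> p"
    using path_join_const(1)[OF p(1)] p by simp
  finally show ?thesis
    using p reach_base closing_loop[of p] assms by (simp add: \<beta>_lab loop_class_eq_iff)
qed

text \<open>This is the source of the homotopies that fill triangles in \<open>Y\<close>: an
  identity between labels becomes a homotopy of loops.\<close>

lemma lab_loop_inj:
  assumes "is_loop Y y p" "is_loop Y y q" "lab p = lab q"
  shows "path_htpy Y p q"
  using assms lab_loop loop_class_eq_iff by metis

lemma lab_loop_surj:
  assumes "g \<in> carrier P"
  obtains p where "is_loop Y y p" "lab p = g"
proof -
  have "\<beta> g \<in> carrier (fundamental_group Y y)"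
    using assms hom by (auto simp: hom_def)
  then obtain p where p: "is_loop Y y p" "\<beta> g = loop_class Y y p"
    by (rule loop_class_surj)
  then have "lab p = g"
    using assms lab_loop[OF p(1)] reach_base by (intro \<beta>_inj) (auto simp: is_loop_def)
  then show thesis using that p by blast
qed

end

section \<open>Path-connectedness of spaces of CW homotopy type\<close>

lemma path_component_of_disc_image:
  assumes "continuous_map (disc n) X \<phi>" "s \<in> topspace (disc n)" "s' \<in> topspace (disc n)"
  shows "path_component_of X (\<phi> s) (\<phi> s')"
proof -
  have disc: "disc n = subtopology (powertop_real UNIV) (topspace (disc n))"
    by (simp add: disc_def Euclidean_space_def subtopology_subtopology)
  let ?g = "\<lambda>u i. (1 - u) * s i + u * s' i"
  have "?g u \<in> topspace (disc n)" if u: "u \<in> {0..1}" for u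
  proof -
    have sq: "((1 - u) * a + u * b)\<^sup>2 \<le> (1 - u) * a\<^sup>2 + u * b\<^sup>2" for a b :: real
    proof -
      have "(1 - u) * a\<^sup>2 + u * b\<^sup>2 - ((1 - u) * a + u * b)\<^sup>2 = u * (1 - u) * (a - b)\<^sup>2"
        by (simp add: power2_eq_square algebra_simps)
      then show ?thesis using u by (smt (verit) atLeastAtMost_iff mult_nonneg_nonneg zero_le_power2)
    qed
    have "(\<Sum>i<n. (?g u i)\<^sup>2) \<le> (\<Sum>i<n. (1 - u) * (s i)\<^sup>2 + u * (s' i)\<^sup>2)"
      by (intro sum_mono sq)
    also have "\<dots> = (1 - u) * (\<Sum>i<n. (s i)\<^sup>2) + u * (\<Sum>i<n. (s' i)\<^sup>2)"
      by (simp add: sum.distrib sum_distrib_left)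
    also have "\<dots> \<le> (1 - u) * 1 + u * 1"
      using assms u by (intro add_mono mult_left_mono) (auto simp: disc_def)
    finally show ?thesis
      using assms by (auto simp: disc_def topspace_Euclidean_space)
  qed
  moreover have "continuous_map unit_interval (powertop_real UNIV) ?g"
    unfolding continuous_map_componentwise_UNIV by (intro allI) (simp, intro continuous_intros)
  ultimately have "continuous_map unit_interval (disc n) ?g"
    by (subst disc) (auto simp: continuous_map_in_subtopology)
  then have "pathin X (\<phi> \<circ> ?g)"
    unfolding pathin_def using assms(1) by (rule continuous_map_compose)
  moreover have "(\<phi> \<circ> ?g) 0 = \<phi> s" "(\<phi> \<circ> ?g) 1 = \<phi> s'"
    by simp_all
  ultimately show ?thesis
    unfolding path_component_of_def by blast
qed

text \<open>Every union of path components is closed for the weak topology.\<close>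

lemma CW_complex_path_connected:
  assumes CW: "CW_complex X" and conn: "connected_space X"
  shows "path_connected_space X"
proof -
  obtain \<Phi> :: "(nat \<times> ((nat \<Rightarrow> real) \<Rightarrow> 'a)) set" where
    1: "\<forall>(n, \<phi>)\<in>\<Phi>. continuous_map (disc n) X \<phi> \<and> inj_on \<phi> (open_disc n)"
    and 2: "\<forall>S\<subseteq>topspace X. (\<forall>(n, \<phi>)\<in>\<Phi>. closedin (disc n) {s \<in> topspace (disc n). \<phi> s \<in> S}) \<longrightarrow> closedin X S"
    using CW unfolding CW_complex_def by (elim conjE exE)
  have cont: "continuous_map (disc n) X \<phi>" if "(n, \<phi>) \<in> \<Phi>" for n \<phi>
    using bspec[OF 1 that] by simp
  have weak: "closedin X S" if "S \<subseteq> topspace X"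
      "\<And>n \<phi>. (n, \<phi>) \<in> \<Phi> \<Longrightarrow> closedin (disc n) {s \<in> topspace (disc n). \<phi> s \<in> S}" for S
    using 2[rule_format, OF that(1)] that(2) by auto
  \<comment> \<open>The flag \<open>b\<close> treats a path component and its complement at once.
    The image of a disc stays in one path component, so each preimage is empty or the whole
    disc.\<close>
  have closed: "closedin X {v \<in> topspace X. path_component_of X u v \<longleftrightarrow> b}" for u b
  proof (rule weak)
    fix n \<phi> assume "(n, \<phi>) \<in> \<Phi>"
    note c = cont[OF this]
    show "closedin (disc n) {s \<in> topspace (disc n). \<phi> s \<in> {v \<in> topspace X. path_component_of X u v \<longleftrightarrow> b}}"
    proof (cases "{s \<in> topspace (disc n). \<phi> s \<in> {v \<in> topspace X. path_component_of X u v \<longleftrightarrow> b}} = {}")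
      case False
      then obtain s where s: "s \<in> topspace (disc n)" "path_component_of X u (\<phi> s) \<longleftrightarrow> b"
        by auto
      have "path_component_of X u (\<phi> s') \<longleftrightarrow> b" "\<phi> s' \<in> topspace X" if "s' \<in> topspace (disc n)" for s'
        using path_component_of_disc_image[OF c s(1) that] path_component_of_disc_image[OF c that s(1)]
          s(2) path_component_of_trans[of X] c that
        by (auto simp: continuous_map_def)
      then have "{s \<in> topspace (disc n). \<phi> s \<in> {v \<in> topspace X. path_component_of X u v \<longleftrightarrow> b}} = topspace (disc n)"
        by auto
      then show ?thesis by simp
    qed (simp only: closedin_empty)
  qed auto
  show ?thesis
    unfolding path_connected_space_iff_path_component
  proof (intro ballI)
    fix u v assume u: "u \<in> topspace X" and v: "v \<in> topspace X"
    let ?C = "{v \<in> topspace X. path_component_of X u v}"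
    have "closedin X ?C" using closed[of u True] by simp
    moreover have "topspace X - ?C = {v \<in> topspace X. path_component_of X u v \<longleftrightarrow> False}"
      by auto
    then have "closedin X (topspace X - ?C)" using closed[of u False] by (simp only:)
    then have "openin X ?C" by (simp add: openin_closedin_eq)
    ultimately have "?C = {} \<or> ?C = topspace X"
      by (intro conn[unfolded connected_space_clopen_in, rule_format] conjI)
    moreover have "u \<in> ?C" using u by (simp add: path_component_of_refl)
    ultimately show "path_component_of X u v" using v by auto
  qed
qed

text \<open>A homotopy to the identity joins every point to its image by a path. Hence connectedness
  passes from \<open>X\<close> to the CW-complex, and path-connectedness passes back. It is needed
  to join free loops in \<open>X\<close> to the base point.\<close>

lemma CW_homotopy_type_path_connected:
  assumes "has_CW_homotopy_type X" and conn: "connected_space X"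
  shows "path_connected_space X"
proof -
  obtain K :: "'a topology" and f g where K: "CW_complex K" and f: "continuous_map X K f" and g: "continuous_map K X g"
    and gf: "homotopic_with (\<lambda>_. True) X X (g \<circ> f) id" and fg: "homotopic_with (\<lambda>_. True) K K (f \<circ> g) id"
    using assms(1) by (auto simp: has_CW_homotopy_type_def homotopy_equivalent_space_def)
  have htpy: "path_component_of Z (h v) v" if "homotopic_with (\<lambda>_. True) Z Z h id" "v \<in> topspace Z"
    for h v and Z :: "'a topology"
  proof -
    have "homotopic_with (\<lambda>_. True) unit_interval Z (h \<circ> (\<lambda>_. v)) (id \<circ> (\<lambda>_. v))"
      using that by (intro homotopic_with_compose_continuous_map_right[OF that(1)]) auto
    then show ?thesis
      by (simp add: o_def homotopic_constant_maps)
        (metis atLeastAtMost_iff empty_iff le_numeral_extra(3) topspace_discrete_topology topspace_euclidean_subtopology zero_le_one)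
  qed
  have "connected_space K"
    unfolding connected_space_clopen_in
  proof (intro allI impI)
    fix C assume C: "openin K C \<and> closedin K C"
    have closed: "{x \<in> topspace X. f x \<in> C} = {} \<or> {x \<in> topspace X. f x \<in> C} = topspace X"
      using C by (intro conn[unfolded connected_space_clopen_in, rule_format] conjI
          openin_continuous_map_preimage[OF f] closedin_continuous_map_preimage[OF f]) auto
    have iff: "f (g w) \<in> C \<longleftrightarrow> w \<in> C" if w: "w \<in> topspace K" for w
    proof -
      obtain p where p: "pathin K p" "p 0 = f (g w)" "p 1 = w"
        using htpy[OF fg w] by (auto simp: path_component_of_def)
      have "connectedin K (p ` {0..1})"
        using p(1) by (rule connectedin_path_image)
      then have "p ` {0..1} \<subseteq> C \<or> disjnt (p ` {0..1}) C"
        using C connectedin_clopen_cases by blast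
      moreover have "f (g w) \<in> p ` {0..1}" "w \<in> p ` {0..1}"
        using imageI[of 0 "{0..1}" p] imageI[of 1 "{0..1}" p] p(2,3) by simp_all
      ultimately show ?thesis by (auto simp: disjnt_iff)
    qed
    have "C \<subseteq> topspace K" using C openin_subset by blast
    moreover have "g w \<in> topspace X" if "w \<in> topspace K" for w
      using g that by (auto simp: continuous_map_def)
    ultimately show "C = {} \<or> C = topspace K"
      using closed iff by blast
  qed
  then have "path_connected_space K"
    by (rule CW_complex_path_connected[OF K])
  then have "path_connectedin X (g ` topspace K)"
    using path_connectedin_continuous_map_image[OF g] path_connectedin_topspace by blast
  show ?thesis
    unfolding path_connected_space_iff_path_component
  proof (intro ballI)
    fix u v assume u: "u \<in> topspace X" and v: "v \<in> topspace X"
    have "f u \<in> topspace K" "f v \<in> topspace K" using u v f by (auto simp: continuous_map_def)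
    then have "path_component_of K (f u) (f v)"
      using \<open>path_connected_space K\<close> by (simp add: path_connected_space_iff_path_component)
    then have "path_component_of X (g (f u)) (g (f v))"
      using pathin_compose[OF _ g] unfolding path_component_of_def by fastforce
    then show "path_component_of X u v"
      using htpy[OF gf u] htpy[OF gf v] by (metis comp_apply path_component_of_sym path_component_of_trans)
  qed
qed

text \<open>\<open>H\<close> acts freely on the classes of \<open>R\<close>, which will be path
  components. One representative per orbit trivialises the action: the value at \<open>z\<close> is
  the unique element that carries the representative into the class of \<open>z\<close>.\<close>

lemma equivariant_invariant_function:
  fixes act :: "'h \<Rightarrow> 'z \<Rightarrow> 'z" and R :: "'z \<Rightarrow> 'z \<Rightarrow> bool"
  assumes "group H" and act_closed: "\<And>h z. h \<in> carrier H \<Longrightarrow> z \<in> S \<Longrightarrow> act h z \<in> S"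
    and act_mult: "\<And>g h z. g \<in> carrier H \<Longrightarrow> h \<in> carrier H \<Longrightarrow> z \<in> S \<Longrightarrow> act (g \<otimes>\<^bsub>H\<^esub> h) z = act g (act h z)"
    and act_one: "\<And>z. z \<in> S \<Longrightarrow> act \<one>\<^bsub>H\<^esub> z = z"
    and R_refl: "\<And>z. z \<in> S \<Longrightarrow> R z z"
    and R_sym: "\<And>z w. z \<in> S \<Longrightarrow> w \<in> S \<Longrightarrow> R z w \<Longrightarrow> R w z"
    and R_trans: "\<And>z w u. z \<in> S \<Longrightarrow> w \<in> S \<Longrightarrow> u \<in> S \<Longrightarrow> R z w \<Longrightarrow> R w u \<Longrightarrow> R z u"
    and R_act: "\<And>h z w. h \<in> carrier H \<Longrightarrow> z \<in> S \<Longrightarrow> w \<in> S \<Longrightarrow> R z w \<Longrightarrow> R (act h z) (act h w)"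
    and free: "\<And>h z. h \<in> carrier H \<Longrightarrow> z \<in> S \<Longrightarrow> R z (act h z) \<Longrightarrow> h = \<one>\<^bsub>H\<^esub>"
  obtains l where "\<And>z. z \<in> S \<Longrightarrow> l z \<in> carrier H"
    "\<And>h z. h \<in> carrier H \<Longrightarrow> z \<in> S \<Longrightarrow> l (act h z) = h \<otimes>\<^bsub>H\<^esub> l z"
    "\<And>z w. z \<in> S \<Longrightarrow> w \<in> S \<Longrightarrow> R z w \<Longrightarrow> l z = l w"
proof -
  interpret H: group H by fact
  \<comment> \<open>\<open>rep z\<close> is chosen from the set \<open>cls z\<close> alone, so
    points of the same orbit of classes share their representative.\<close>
  define cls where "cls z = {w \<in> S. \<exists>h\<in>carrier H. R z (act h w)}" for z
  define rep where "rep z = (SOME w. w \<in> cls z)" for z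
  have rep: "rep z \<in> S" "\<exists>h\<in>carrier H. R z (act h (rep z))" if "z \<in> S" for z
  proof -
    have "z \<in> cls z"
      unfolding cls_def using that act_one[OF that] R_refl[OF that] by force
    then have "rep z \<in> cls z" unfolding rep_def by (rule someI)
    then show "rep z \<in> S" "\<exists>h\<in>carrier H. R z (act h (rep z))" by (auto simp: cls_def)
  qed
  have uniq: "h = g" if "z \<in> S" "w \<in> S" "h \<in> carrier H" "g \<in> carrier H" "R z (act h w)" "R z (act g w)" for z w h g
  proof -
    have "R (act g w) (act h w)"
      using that R_trans[of "act g w" z "act h w"] R_sym[of z "act g w"] act_closed by blast
    then have "R (act (inv\<^bsub>H\<^esub> h) (act g w)) (act (inv\<^bsub>H\<^esub> h) (act h w))"
      using that act_closed by (intro R_act) auto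
    then have "R (act (inv\<^bsub>H\<^esub> h \<otimes>\<^bsub>H\<^esub> g) w) w"
      using that by (simp add: act_mult[symmetric] act_one)
    then have "R w (act (inv\<^bsub>H\<^esub> h \<otimes>\<^bsub>H\<^esub> g) w)"
      by (rule R_sym[rotated 2]) (simp_all add: act_closed that(1-4))
    then have "inv\<^bsub>H\<^esub> h \<otimes>\<^bsub>H\<^esub> g = \<one>\<^bsub>H\<^esub>"
      by (rule free[OF H.m_closed[OF H.inv_closed[OF that(3)] that(4)] that(2)])
    then have "h \<otimes>\<^bsub>H\<^esub> (inv\<^bsub>H\<^esub> h \<otimes>\<^bsub>H\<^esub> g) = h" using that by simp
    then show ?thesis
      using that by (simp add: H.m_assoc[symmetric])
  qed
  define l where "l z = (SOME h. h \<in> carrier H \<and> R z (act h (rep z)))" for z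
  have l: "l z \<in> carrier H" "R z (act (l z) (rep z))" if "z \<in> S" for z
    using someI_ex[of "\<lambda>h. h \<in> carrier H \<and> R z (act h (rep z))"] rep(2)[OF that] by (auto simp: l_def)
  have cls_eq: "cls z = cls w" if "z \<in> S" "w \<in> S" "R z w" for z w
  proof -
    have "R z (act h u) \<longleftrightarrow> R w (act h u)" if "h \<in> carrier H" "u \<in> S" for h u
      using R_trans[of z w "act h u"] R_trans[of w z "act h u"] R_sym[of z w] act_closed
        \<open>z \<in> S\<close> \<open>w \<in> S\<close> \<open>R z w\<close> that by blast
    then show ?thesis by (auto simp: cls_def)
  qed
  have cls_act: "cls (act g z) = cls z" if "z \<in> S" "g \<in> carrier H" for z g
  proof -
    have "(\<exists>h\<in>carrier H. R (act g z) (act h w)) \<longleftrightarrow> (\<exists>h\<in>carrier H. R z (act h w))" if w: "w \<in> S" for w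
    proof
      assume "\<exists>h\<in>carrier H. R (act g z) (act h w)"
      then obtain h where h: "h \<in> carrier H" "R (act g z) (act h w)" by blast
      then have "R (act (inv\<^bsub>H\<^esub> g) (act g z)) (act (inv\<^bsub>H\<^esub> g) (act h w))"
        using \<open>z \<in> S\<close> \<open>g \<in> carrier H\<close> w act_closed by (intro R_act) auto
      then have "R z (act (inv\<^bsub>H\<^esub> g \<otimes>\<^bsub>H\<^esub> h) w)"
        using \<open>z \<in> S\<close> \<open>g \<in> carrier H\<close> w h by (simp add: act_mult[symmetric] act_one)
      then show "\<exists>h\<in>carrier H. R z (act h w)"
        using \<open>g \<in> carrier H\<close> h by blast
    next
      assume "\<exists>h\<in>carrier H. R z (act h w)"
      then obtain h where h: "h \<in> carrier H" "R z (act h w)" by blast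
      then have "R (act g z) (act (g \<otimes>\<^bsub>H\<^esub> h) w)"
        using R_act[of g z "act h w"] \<open>z \<in> S\<close> \<open>g \<in> carrier H\<close> w act_closed by (simp add: act_mult)
      then show "\<exists>h\<in>carrier H. R (act g z) (act h w)"
        using \<open>g \<in> carrier H\<close> h by blast
    qed
    then show ?thesis by (auto simp: cls_def)
  qed
  show thesis
  proof (rule that)
    show "l z \<in> carrier H" if "z \<in> S" for z using l that by blast
    show "l (act h z) = h \<otimes>\<^bsub>H\<^esub> l z" if h: "h \<in> carrier H" and z: "z \<in> S" for h z
    proof (rule uniq)
      have r: "rep (act h z) = rep z" using cls_act[OF z h] by (simp add: rep_def)
      show "R (act h z) (act (l (act h z)) (rep z))"
        using l(2)[of "act h z"] act_closed h z r by simp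
      show "R (act h z) (act (h \<otimes>\<^bsub>H\<^esub> l z) (rep z))"
        using R_act[OF h z _ l(2)[OF z]] act_closed l z rep h by (simp add: act_mult)
    qed (use act_closed l h z rep in auto)
    show "l z = l w" if "z \<in> S" "w \<in> S" "R z w" for z w
    proof (rule uniq)
      have "rep z = rep w" using cls_eq[OF that] by (simp add: rep_def)
      then show "R z (act (l w) (rep z))"
        using l(2)[OF that(2)] R_trans[of z w "act (l w) (rep w)"] that act_closed rep l by auto
    qed (use l that rep in auto)
  qed
qed

context path_labelling
begin

text \<open>Along a partial section up to homotopy, a loop is freely homotopic to one that comes from \<open>X\<close>.\<close>

lemma loop_lab_conjugate:
  fixes X :: "'v topology" and G1 :: "'g monoid"
  assumes X: "path_connected_space X" "x \<in> topspace X" and f: "continuous_map X Y f" "f x = y"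
    and \<alpha>: "\<alpha> \<in> iso G1 (fundamental_group X x)"
    and \<phi>: "\<And>g. g \<in> carrier G1 \<Longrightarrow> \<phi> g \<in> carrier P \<and> pi1_map Y y f (\<alpha> g) = \<beta> (\<phi> g)"
    and \<sigma>: "continuous_map (subtopology Y U) X \<sigma>"
    and htpy: "homotopic_with (\<lambda>_. True) (subtopology Y U) Y (f \<circ> \<sigma>) id"
    and \<gamma>: "pathin (subtopology Y U) \<gamma>" "\<gamma> 1 = \<gamma> 0" "reach (\<gamma> 0)"
  shows "\<exists>g\<in>carrier G1. \<exists>t\<in>carrier P. lab \<gamma> = inv t \<otimes> \<phi> g \<otimes> t"
proof -
  let ?YU = "subtopology Y U" and ?\<delta> = "\<sigma> \<circ> \<gamma>"
  obtain k where k: "continuous_map (prod_topology unit_interval ?YU) Y k"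
      "\<And>v. k (0, v) = f (\<sigma> v)" "\<And>v. k (1, v) = v"
    using htpy unfolding homotopic_with_def by auto
  have \<gamma>Y: "pathin Y \<gamma>" using \<gamma>(1) by (simp add: pathin_subtopology)
  have g: "continuous_map unit_interval ?YU \<gamma>" using \<gamma>(1) by (simp add: pathin_def)
  have \<delta>: "pathin X ?\<delta>" using \<gamma>(1) \<sigma> by (rule pathin_compose)
  have f\<delta>: "pathin Y (f \<circ> ?\<delta>)" using \<delta> f(1) by (rule pathin_compose)
  \<comment> \<open>The track of the start of \<open>\<gamma>\<close> under the homotopy. It is also
    the track of the end, since \<open>\<gamma>\<close> is closed.\<close>
  define \<tau> where "\<tau> = (\<lambda>t. k (t, \<gamma> 0))"
  have "continuous_map (prod_topology unit_interval unit_interval) (prod_topology unit_interval ?YU) (\<lambda>z. (fst z, \<gamma> (snd z)))"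
    unfolding continuous_map_paired
    using continuous_map_compose[OF continuous_map_snd g, unfolded o_def] continuous_map_fst by blast
  from continuous_map_compose[OF this k(1)]
  have sq: "continuous_map (prod_topology unit_interval unit_interval) Y (\<lambda>(t, s). k (t, \<gamma> s))"
    by (simp add: o_def case_prod_unfold)
  have "continuous_map unit_interval (prod_topology unit_interval ?YU) (\<lambda>t. (t, \<gamma> 0))"
    using path_start_in_topspace[OF \<gamma>(1)] by (simp add: continuous_map_pairwise o_def)
  from continuous_map_compose[OF this k(1)]
  have \<tau>: "pathin Y \<tau>" by (simp add: pathin_def \<tau>_def o_def)
  have \<tau>_ends: "\<tau> 0 = (f \<circ> ?\<delta>) 0" "\<tau> 0 = (f \<circ> ?\<delta>) 1" "\<tau> 1 = \<gamma> 0"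
    by (simp_all add: \<tau>_def k \<gamma>(2))
  have "path_htpy Y (path_join (f \<circ> ?\<delta>) \<tau>) (path_join \<tau> \<gamma>)"
    using path_htpy_square[OF sq] by (simp add: k \<tau>_def \<gamma>(2) o_def)
  moreover have r\<tau>: "reach (\<tau> 0)"
    using reach_path'[OF \<tau>] \<tau>_ends \<gamma>(3) by simp
  ultimately have "lab (path_join (f \<circ> ?\<delta>) \<tau>) = lab (path_join \<tau> \<gamma>)"
    using \<tau>_ends by (intro lab_cong) auto
  then have eq1: "lab (f \<circ> ?\<delta>) \<otimes> lab \<tau> = lab \<tau> \<otimes> lab \<gamma>"
    using f\<delta> \<tau> \<tau>_ends r\<tau> \<gamma>Y by (simp add: lab_join)
  obtain r where r: "pathin X r" "r 0 = x" "r 1 = ?\<delta> 0"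
    using X path_start_in_topspace[OF \<delta>] unfolding path_connected_space_def by blast
  \<comment> \<open>Conjugating by \<open>r\<close> moves the free loop to the base point
    \<open>x\<close>, where its class is some \<open>\<alpha> g\<close>. The conjugating element in
    the conclusion is the label of \<open>f \<circ> r\<close> times that of
    \<open>\<tau>\<close>.\<close>
  define L where "L = path_join (path_join r ?\<delta>) (path_rev r)"
  have L: "is_loop X x L"
    using r \<delta> \<gamma>(2) by (auto simp: L_def is_loop_def intro!: pathin_join pathin_rev)
  have "loop_class X x L \<in> \<alpha> ` carrier G1"
    using \<alpha> loop_class_in[OF L] by (auto simp: iso_def bij_betw_def)
  then obtain g where g: "g \<in> carrier G1" "loop_class X x L = \<alpha> g" by blast
  have fL: "is_loop Y y (f \<circ> L)"
    using L f by (auto simp: is_loop_def pathin_compose)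
  have "\<beta> (lab (f \<circ> L)) = \<beta> (\<phi> g)"
    using lab_loop[OF fL] pi1_map_loop_class[OF L f] \<phi>[OF g(1)] g(2) by simp
  then have "lab (f \<circ> L) = \<phi> g"
    using \<phi>[OF g(1)] fL reach_base by (intro \<beta>_inj) (auto simp: is_loop_def)
  moreover have fr: "pathin Y (f \<circ> r)" "(f \<circ> r) 0 = y" "(f \<circ> r) 1 = (f \<circ> ?\<delta>) 0"
    using pathin_compose[OF r(1) f(1)] r f by auto
  moreover have "f \<circ> L = path_join (path_join (f \<circ> r) (f \<circ> ?\<delta>)) (path_rev (f \<circ> r))"
    by (simp add: L_def path_join_compose path_rev_compose)
  ultimately have eq2: "lab (f \<circ> r) \<otimes> lab (f \<circ> ?\<delta>) \<otimes> inv (lab (f \<circ> r)) = \<phi> g"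
    using f\<delta> reach_base \<gamma>(2) by (simp add: lab_join lab_rev pathin_join pathin_rev)
  let ?a = "lab (f \<circ> r)" and ?b = "lab (f \<circ> ?\<delta>)" and ?c = "lab \<tau>"
  have carr: "?a \<in> carrier P" "?b \<in> carrier P" "?c \<in> carrier P" "lab \<gamma> \<in> carrier P"
    using fr f\<delta> \<tau> \<gamma>Y reach_base r\<tau> \<tau>_ends \<gamma>(3) by (auto intro!: lab_closed)
  have "lab \<gamma> = inv ?c \<otimes> (?b \<otimes> ?c)"
    using eq1 carr by (simp add: inv_solve_left)
  also have "\<dots> = inv (?a \<otimes> ?c) \<otimes> \<phi> g \<otimes> (?a \<otimes> ?c)"
    using carr unfolding eq2[symmetric]
    by (simp add: inv_mult_group m_assoc) (simp add: m_assoc[symmetric])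
  finally show ?thesis using g carr by blast
qed

text \<open>On the part over \<open>U\<close> of the universal covering, encoded as the set of pairs \<open>(v, p)\<close> of a point and a group
  element, \<open>HH\<close> acts freely on the path components by the hypothesis \<open>free\<close>.\<close>

lemma section_label:
  assumes HH: "subgroup HH P"
    and free: "\<And>\<gamma> t. pathin (subtopology Y U) \<gamma> \<Longrightarrow> \<gamma> 1 = \<gamma> 0 \<Longrightarrow> reach (\<gamma> 0) \<Longrightarrow> t \<in> carrier P \<Longrightarrow>
      t \<otimes> lab \<gamma> \<otimes> inv t \<in> HH \<Longrightarrow> lab \<gamma> = \<one>"
  obtains l where "\<And>v p. v \<in> U \<Longrightarrow> reach v \<Longrightarrow> p \<in> carrier P \<Longrightarrow> l (v, p) \<in> HH"
    "\<And>v p h. v \<in> U \<Longrightarrow> reach v \<Longrightarrow> p \<in> carrier P \<Longrightarrow> h \<in> HH \<Longrightarrow> l (v, h \<otimes> p) = h \<otimes> l (v, p)"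
    "\<And>\<gamma> p. pathin (subtopology Y U) \<gamma> \<Longrightarrow> reach (\<gamma> 0) \<Longrightarrow> p \<in> carrier P \<Longrightarrow>
       l (\<gamma> 1, p \<otimes> lab \<gamma>) = l (\<gamma> 0, p)"
proof -
  let ?H = "P\<lparr>carrier := HH\<rparr>"
  let ?S = "{(v, p). v \<in> U \<and> reach v \<and> p \<in> carrier P}"
  let ?act = "\<lambda>h (v, p). (v, h \<otimes> p)"
  \<comment> \<open>The relation of being joined by a lifted path: the second coordinate is
    transported by the label of the path below.\<close>
  let ?R = "\<lambda>(v, p) (w, q). \<exists>\<gamma>. pathin (subtopology Y U) \<gamma> \<and> \<gamma> 0 = v \<and> \<gamma> 1 = w \<and> q = p \<otimes> lab \<gamma>"
  have Y: "pathin Y \<gamma>" if "pathin (subtopology Y U) \<gamma>" for \<gamma>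
    using that by (simp add: pathin_subtopology)
  have top: "v \<in> topspace Y" if "reach v" for v
    using tail[OF that] path_finish_in_topspace by metis
  have HP: "h \<in> carrier P" if "h \<in> HH" for h
    using subgroup.subset[OF HH] that by blast
  obtain l where l: "\<And>z. z \<in> ?S \<Longrightarrow> l z \<in> carrier ?H"
    "\<And>h z. h \<in> carrier ?H \<Longrightarrow> z \<in> ?S \<Longrightarrow> l (?act h z) = h \<otimes>\<^bsub>?H\<^esub> l z"
    "\<And>z w. z \<in> ?S \<Longrightarrow> w \<in> ?S \<Longrightarrow> ?R z w \<Longrightarrow> l z = l w"
  proof (rule equivariant_invariant_function[of ?H ?S ?act ?R])
    show "group ?H" using subgroup.subgroup_is_group[OF HH is_group] .
    show "?R z z" if "z \<in> ?S" for z
      using that top lab_const by (force intro!: exI[of _ "\<lambda>_. fst z"])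
    show "?R w z" if zw: "z \<in> ?S" "w \<in> ?S" "?R z w" for z w
    proof -
      obtain v p v' p' where eq: "z = (v, p)" "w = (v', p')" by (cases z, cases w)
      obtain \<gamma> where \<gamma>: "pathin (subtopology Y U) \<gamma>" "\<gamma> 0 = v" "\<gamma> 1 = v'" "p' = p \<otimes> lab \<gamma>"
        using zw(3) eq by auto
      then have "p = p' \<otimes> lab (path_rev \<gamma>)"
        using zw eq Y by (simp add: lab_rev m_assoc)
      then show ?thesis
        using \<gamma> pathin_rev[OF \<gamma>(1)] eq by (auto intro!: exI[of _ "path_rev \<gamma>"])
    qed
    show "?R z u" if zwu: "z \<in> ?S" "w \<in> ?S" "u \<in> ?S" "?R z w" "?R w u" for z w u
    proof -
      obtain v p v' p' v'' p'' where eq: "z = (v, p)" "w = (v', p')" "u = (v'', p'')" by (cases z, cases w, cases u)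
      obtain \<gamma> where \<gamma>: "pathin (subtopology Y U) \<gamma>" "\<gamma> 0 = v" "\<gamma> 1 = v'" "p' = p \<otimes> lab \<gamma>"
        using zwu(4) eq by auto
      obtain \<delta> where \<delta>: "pathin (subtopology Y U) \<delta>" "\<delta> 0 = v'" "\<delta> 1 = v''" "p'' = p' \<otimes> lab \<delta>"
        using zwu(5) eq by auto
      have "p'' = p \<otimes> lab (path_join \<gamma> \<delta>)"
        using zwu eq \<gamma> \<delta> Y by (simp add: lab_join m_assoc)
      then show ?thesis
        using \<gamma> \<delta> eq by (auto intro!: exI[of _ "path_join \<gamma> \<delta>"] pathin_join)
    qed
    show "?R (?act h z) (?act h w)" if zw: "h \<in> carrier ?H" "z \<in> ?S" "w \<in> ?S" "?R z w" for h z w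
    proof -
      obtain v p v' p' where eq: "z = (v, p)" "w = (v', p')" by (cases z, cases w)
      obtain \<gamma> where \<gamma>: "pathin (subtopology Y U) \<gamma>" "\<gamma> 0 = v" "\<gamma> 1 = v'" "p' = p \<otimes> lab \<gamma>"
        using zw(4) eq by auto
      then have "h \<otimes> p' = h \<otimes> p \<otimes> lab \<gamma>"
        using zw eq Y HP by (simp add: m_assoc)
      then show ?thesis using \<gamma> eq by auto
    qed
    show "h = \<one>\<^bsub>?H\<^esub>" if hz: "h \<in> carrier ?H" "z \<in> ?S" "?R z (?act h z)" for h z
    proof -
      obtain v p where eq: "z = (v, p)" by (cases z)
      obtain \<gamma> where \<gamma>: "pathin (subtopology Y U) \<gamma>" "\<gamma> 0 = v" "\<gamma> 1 = v" "h \<otimes> p = p \<otimes> lab \<gamma>"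
        using hz(3) eq by auto
      have carr: "h \<in> carrier P" "p \<in> carrier P" "lab \<gamma> \<in> carrier P"
        using hz eq \<gamma> Y HP by auto
      \<comment> \<open>A lifted path from a point to its translate by \<open>h\<close> lies over a
        loop whose label is conjugate to \<open>h\<close> by \<open>p\<close>, so
        \<open>free\<close> applies.\<close>
      have h: "h = p \<otimes> lab \<gamma> \<otimes> inv p"
        using carr \<gamma>(4) by (metis inv_solve_right m_closed)
      then have "lab \<gamma> = \<one>"
        using hz eq \<gamma> by (intro free[of \<gamma> p]) auto
      then show ?thesis using h carr by simp
    qed
  qed (use HP m_assoc subgroup.m_closed[OF HH] in auto)
  show thesis
  proof (rule that)
    show "l (v, p) \<in> HH" if "v \<in> U" "reach v" "p \<in> carrier P" for v p
      using l(1)[of "(v, p)"] that by simp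
    show "l (v, h \<otimes> p) = h \<otimes> l (v, p)" if "v \<in> U" "reach v" "p \<in> carrier P" "h \<in> HH" for v p h
      using l(2)[of h "(v, p)"] that by simp
    show "l (\<gamma> 1, p \<otimes> lab \<gamma>) = l (\<gamma> 0, p)" if "pathin (subtopology Y U) \<gamma>" "reach (\<gamma> 0)" "p \<in> carrier P" for \<gamma> p
    proof -
      have "\<gamma> 0 \<in> U" "\<gamma> 1 \<in> U" using that(1) by (auto simp: pathin_subtopology)
      then show ?thesis
        using that Y[OF that(1)] reach_path[OF Y[OF that(1)]]
        by (intro l(3)[symmetric]) auto
    qed
  qed
qed

end

section \<open>Extending maps over cubes\<close>

definition cube_set :: "nat \<Rightarrow> (nat \<Rightarrow> real) set" where
  "cube_set n = {s. (\<forall>i<n. 0 \<le> s i \<and> s i \<le> 1) \<and> (\<forall>i\<ge>n. s i = 0)}"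

lemma topspace_cube_set: "topspace (cube n) = cube_set n"
  by (simp add: topspace_cube cube_set_def)

lemma cube_boundary_eq: "cube_boundary n = {s \<in> cube_set n. \<exists>i<n. s i = 0 \<or> s i = 1}"
  by (simp add: cube_boundary_def topspace_cube_set)

lemma cube_eq: "cube n = top_of_set (cube_set n)"
proof -
  have "cube n = subtopology (powertop_real UNIV) (cube_set n)"
    by (simp add: cube_def Euclidean_space_def subtopology_subtopology flip: topspace_cube_set)
  then show ?thesis by (simp only: euclidean_product_topology)
qed

lemma simplex_top_eq: "simplex_top m = top_of_set (standard_simplex m)"
  by (simp only: euclidean_product_topology)

lemma continuous_map_top_of_set:
  "continuous_map (top_of_set S) (top_of_set T) f \<longleftrightarrow> continuous_on S f \<and> f ` S \<subseteq> T"
  by (auto simp: continuous_map_in_subtopology)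

lemma compact_cube: "compact_space (cube n)"
proof -
  have "cube_set n = (\<Pi>\<^sub>E i\<in>UNIV. if i < n then {0..1} else {0})"
    by (auto simp: cube_set_def PiE_iff) (metis atLeastAtMost_iff, metis atLeastAtMost_iff, metis not_le singletonD)
  moreover have "compactin (powertop_real UNIV) (\<Pi>\<^sub>E i\<in>UNIV. if i < n then {0..1} else {0::real})"
    by (simp add: compactin_PiE)
  ultimately show ?thesis
    unfolding cube_eq by (simp add: compact_space_subtopology euclidean_product_topology del: topspace_euclidean_subtopology)
qed

lemma Hausdorff_simplex_top: "Hausdorff_space (simplex_top m)"
  unfolding simplex_top_eq by (simp add: Hausdorff_space_subtopology)

text \<open>A continuous surjection from a compact space to a Hausdorff space is closed, hence a
  quotient map. It serves both for the cube over the simplex and for the square over the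
  triangle.\<close>

lemma extend_over_quotient:
  assumes q: "continuous_map X Z q" "q ` topspace X = topspace Z" and "compact_space X" "Hausdorff_space Z"
    and k: "continuous_map X Y k"
    and fib: "\<And>s s'. s \<in> topspace X \<Longrightarrow> s' \<in> topspace X \<Longrightarrow> q s = q s' \<Longrightarrow> k s = k s'"
  obtains g where "continuous_map Z Y g" "\<And>s. s \<in> topspace X \<Longrightarrow> g (q s) = k s"
proof -
  have "closed_map X Z q"
    using assms by (intro continuous_imp_closed_map) auto
  then have "quotient_map X Z q"
    using q by (intro continuous_closed_imp_quotient_map) auto
  then show thesis
    by (rule quotient_map_lift_exists[OF _ k]) (use fib that in blast)+
qed

text \<open>The maximum norm of the first \<open>n\<close> coordinates, whose balls are
  cubes.\<close>

primrec radius :: "nat \<Rightarrow> (nat \<Rightarrow> real) \<Rightarrow> real" where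
  "radius 0 w = 0"
| "radius (Suc n) w = max (radius n w) \<bar>w n\<bar>"

lemma radius_nonneg: "0 \<le> radius n w"
  by (induction n) auto

lemma radius_le_iff: "0 \<le> c \<Longrightarrow> radius n w \<le> c \<longleftrightarrow> (\<forall>i<n. \<bar>w i\<bar> \<le> c)"
  by (induction n) (auto simp: less_Suc_eq)

lemma abs_le_radius: "i < n \<Longrightarrow> \<bar>w i\<bar> \<le> radius n w"
  using radius_le_iff[OF radius_nonneg] by blast

lemma radius_attained: "0 < n \<Longrightarrow> \<exists>i<n. \<bar>w i\<bar> = radius n w"
proof (induction n)
  case (Suc n)
  show ?case
  proof (cases "radius n w \<le> \<bar>w n\<bar>")
    case False
    then have "0 < n" by (cases n) auto
    then show ?thesis using Suc.IH False by (auto simp: max_def less_Suc_eq)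
  qed (auto simp: max_def)
qed simp

lemma radius_scale: "0 \<le> c \<Longrightarrow> (\<And>i. i < n \<Longrightarrow> w' i = c * w i) \<Longrightarrow> radius n w' = c * radius n w"
  by (induction n) (auto simp: abs_mult max_mult_distrib_left)

lemma continuous_on_radius:
  "(\<And>i. i < n \<Longrightarrow> continuous_on S (\<lambda>x. w x i)) \<Longrightarrow> continuous_on S (\<lambda>x. radius n (w x))"
  by (induction n) (auto intro!: continuous_intros)

text \<open>The sides of \<open>cube (Suc n)\<close> over the boundary of \<open>cube n\<close>, together with the face
  \<open>s 0 = 1\<close>, are parametrised by \<open>cube n\<close> through \<open>unfold_sides\<close>: the face is the concentric cube of half
  size. \<open>fold_sides\<close> is a map of the solid \<open>cube (Suc n)\<close> to \<open>cube n\<close> times the interval of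
  homotopy parameters that inverts this on the boundary, except over the face \<open>s 0 = 0\<close>, which goes to
  the places where a null homotopy is constant.\<close>

definition centred :: "(nat \<Rightarrow> real) \<Rightarrow> nat \<Rightarrow> real" where
  "centred s i = 2 * s i - 1"

definition unfold_sides :: "nat \<Rightarrow> (nat \<Rightarrow> real) \<Rightarrow> nat \<Rightarrow> real" where
  "unfold_sides n u i = (case i of 0 \<Rightarrow> min 1 (2 * (1 - radius n (centred u)))
     | Suc j \<Rightarrow> if j < n then (centred u j / max (radius n (centred u)) (1/2) + 1) / 2 else 0)"

definition fold_sides :: "nat \<Rightarrow> (nat \<Rightarrow> real) \<Rightarrow> nat \<Rightarrow> real" where
  "fold_sides n s i = (if i < n then
      ((1 - s 0) * (centred s (Suc i) / max (radius n (centred s \<circ> Suc)) (1/2)) + s 0 * (centred s (Suc i) / 2) + 1) / 2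
    else 0)"

definition fold_time :: "nat \<Rightarrow> (nat \<Rightarrow> real) \<Rightarrow> real" where
  "fold_time n s = (1 - s 0) * max (2 * radius n (centred s \<circ> Suc) - 1) 0 + s 0"

lemma radius_centred_le_1: "u \<in> cube_set n \<Longrightarrow> radius n (centred u) \<le> 1"
  by (subst radius_le_iff) (auto simp: cube_set_def centred_def abs_le_iff)

lemma radius_centred_Suc_le_1: "s \<in> cube_set (Suc n) \<Longrightarrow> radius n (centred s \<circ> Suc) \<le> 1"
  by (subst radius_le_iff) (auto simp: cube_set_def centred_def abs_le_iff)

lemma radius_centred_boundary: "u \<in> cube_boundary n \<Longrightarrow> radius n (centred u) = 1"
  using abs_le_radius[of _ n "centred u"] radius_centred_le_1[of u n]
  by (force simp: cube_boundary_eq centred_def)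

lemma divide_max_radius: "i < n \<Longrightarrow> \<bar>w i / max (radius n w) (1/2)\<bar> \<le> 1"
  using abs_le_radius[of i n w] by (auto simp: abs_divide divide_le_eq)

lemma unfold_sides_in_boundary:
  assumes n: "0 < n" and u: "u \<in> cube_set n"
  shows "unfold_sides n u \<in> cube_boundary (Suc n)"
proof -
  let ?r = "radius n (centred u)"
  have r: "0 \<le> ?r" "?r \<le> 1" using radius_nonneg radius_centred_le_1[OF u] by auto
  have "0 \<le> unfold_sides n u i \<and> unfold_sides n u i \<le> 1" if "i < Suc n" for i
  proof (cases i)
    case 0
    then show ?thesis using r by (simp add: unfold_sides_def)
  next
    case (Suc j)
    define x where "x = centred u j / max ?r (1/2)"
    have "\<bar>x\<bar> \<le> 1" using divide_max_radius[of j n "centred u"] that Suc by (simp add: x_def)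
    then show ?thesis using that Suc by (simp add: unfold_sides_def abs_le_iff flip: x_def)
  qed
  moreover have "unfold_sides n u i = 0" if "Suc n \<le> i" for i
    using that by (cases i) (auto simp: unfold_sides_def)
  moreover have "\<exists>i<Suc n. unfold_sides n u i = 0 \<or> unfold_sides n u i = 1"
  proof (cases "?r \<le> 1/2")
    case True
    then show ?thesis by (intro exI[of _ 0]) (auto simp: unfold_sides_def)
  next
    case False
    obtain i where i: "i < n" "\<bar>centred u i\<bar> = ?r" using radius_attained[OF n] by blast
    then have "centred u i = ?r \<or> centred u i = - ?r" by linarith
    then have "centred u i / max ?r (1/2) = 1 \<or> centred u i / max ?r (1/2) = -1"
      using False by (auto simp: max_def)
    then show ?thesis using i(1) by (intro exI[of _ "Suc i"]) (auto simp: unfold_sides_def)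
  qed
  ultimately show ?thesis by (auto simp: cube_boundary_eq cube_set_def)
qed

lemma unfold_sides_boundary: "u \<in> cube_boundary n \<Longrightarrow> unfold_sides n u 0 = 0"
  by (simp add: unfold_sides_def radius_centred_boundary)

lemma continuous_unfold_sides: "continuous_on S (unfold_sides n)"
proof (rule continuous_on_coordinatewise_then_product)
  have c: "continuous_on S (\<lambda>u. centred u i)" for i
    unfolding centred_def by (intro continuous_intros) (auto intro: continuous_on_product_coordinates continuous_on_subset)
  have r: "continuous_on S (\<lambda>u. radius n (centred u))"
    by (intro continuous_on_radius c)
  show "continuous_on S (\<lambda>u. unfold_sides n u i)" for i
    by (cases i; cases "i - 1 < n") (auto simp: unfold_sides_def intro!: continuous_intros c r)
qed

lemma fold_sides_in:
  assumes s: "s \<in> cube_set (Suc n)"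
  shows "fold_sides n s \<in> cube_set n"
proof -
  let ?w = "centred s \<circ> Suc"
  have "\<bar>(1 - s 0) * (?w i / max (radius n ?w) (1/2)) + s 0 * (?w i / 2)\<bar> \<le> 1" if i: "i < n" for i
  proof -
    have s0: "0 \<le> s 0" "s 0 \<le> 1" using s by (auto simp: cube_set_def)
    have "\<bar>?w i\<bar> \<le> 1" using abs_le_radius[OF i, of ?w] radius_centred_Suc_le_1[OF s] by linarith
    then have w: "\<bar>?w i / 2\<bar> \<le> 1" by simp
    have scale: "\<bar>a * x\<bar> \<le> a" if "0 \<le> a" "\<bar>x\<bar> \<le> 1" for a x :: real
      using that by (simp add: abs_mult mult_left_le)
    have sum: "\<bar>a + b\<bar> \<le> 1" if "\<bar>a\<bar> \<le> 1 - s 0" "\<bar>b\<bar> \<le> s 0" for a b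
      using that by linarith
    show ?thesis
      using s0 by (intro sum scale divide_max_radius[OF i] w) auto
  qed
  then show ?thesis
    by (fastforce simp: cube_set_def fold_sides_def abs_le_iff)
qed

lemma fold_time_in:
  assumes s: "s \<in> cube_set (Suc n)"
  shows "fold_time n s \<in> {0..1}"
proof -
  have s0: "0 \<le> s 0" "s 0 \<le> 1" using s by (auto simp: cube_set_def)
  have "(1 - s 0) * max (2 * radius n (centred s \<circ> Suc) - 1) 0 \<le> (1 - s 0) * 1"
    using s0 radius_centred_Suc_le_1[OF s] by (intro mult_left_mono) auto
  then show ?thesis using s0 by (auto simp: fold_time_def)
qed

lemma continuous_centred_coordinate: "continuous_on S (\<lambda>u. centred u i)"
  unfolding centred_def by (intro continuous_intros) (auto intro: continuous_on_product_coordinates continuous_on_subset)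

lemma continuous_fold_sides: "continuous_on S (fold_sides n)"
  and continuous_fold_time: "continuous_on S (fold_time n)"
proof -
  have c0: "continuous_on S (\<lambda>s. s 0)"
    by (auto intro: continuous_on_product_coordinates continuous_on_subset)
  have r: "continuous_on S (\<lambda>s. radius n (centred s \<circ> Suc))"
    by (intro continuous_on_radius) (simp add: continuous_centred_coordinate)
  have "max (radius n (centred s \<circ> Suc)) (1/2) \<noteq> 0" for s
    by (auto simp: max_def)
  then have "continuous_on S (\<lambda>s. fold_sides n s i)" for i
    unfolding fold_sides_def
    by (cases "i < n") (auto intro!: continuous_intros c0 r continuous_centred_coordinate)
  then show "continuous_on S (fold_sides n)"
    by (rule continuous_on_coordinatewise_then_product)
  show "continuous_on S (fold_time n)"
    unfolding fold_time_def[abs_def] by (intro continuous_intros c0 r)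
qed

lemma unfold_fold_sides:
  assumes s: "s \<in> cube_boundary (Suc n)" and s0: "s 0 \<noteq> 0"
  shows "fold_time n s = 1" "unfold_sides n (fold_sides n s) = s"
proof -
  let ?w = "centred s \<circ> Suc" and ?u = "fold_sides n s"
  let ?r = "radius n ?w"
  have sc: "s \<in> cube_set (Suc n)" using s by (simp add: cube_boundary_eq)
  then have s01: "0 \<le> s 0" "s 0 \<le> 1" by (auto simp: cube_set_def)
  obtain i where i: "i < Suc n" "s i = 0 \<or> s i = 1" using s by (auto simp: cube_boundary_eq)
  \<comment> \<open>The factor by which \<open>fold_sides\<close> scales the centred coordinates on
    the boundary off \<open>s 0 = 0\<close>: it is \<open>1/2\<close> on the face
    \<open>s 0 = 1\<close> and tends to \<open>1\<close> towards the lower edge of the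
    sides.\<close>
  define c where "c = 1 - s 0 / 2"
  have c: "1/2 \<le> c" "c < 1" using s01 s0 by (auto simp: c_def)
  have cases: "s 0 = 1 \<or> ?r = 1"
  proof (cases i)
    case 0
    then show ?thesis using i s0 by auto
  next
    case (Suc j)
    then have "\<bar>?w j\<bar> = 1" using i by (auto simp: centred_def)
    then show ?thesis
      using abs_le_radius[of j n ?w] radius_centred_Suc_le_1[OF sc] i Suc by fastforce
  qed
  have r1: "?r \<le> 1" using radius_centred_Suc_le_1[OF sc] .
  show "fold_time n s = 1"
    using cases by (auto simp: fold_time_def)
  have u: "centred ?u j = c * ?w j" if "j < n" for j
    using cases that by (auto simp: centred_def[of "fold_sides n s"] fold_sides_def c_def max_def field_simps)
  have ru: "radius n (centred ?u) = c * ?r"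
    using c by (intro radius_scale u) auto
  have m: "max (c * ?r) (1/2) = c"
    using cases c r1 by (auto simp: c_def max_def)
  show "unfold_sides n ?u = s"
  proof
    fix k
    show "unfold_sides n ?u k = s k"
    proof (cases k)
      case 0
      have "min 1 (2 * (1 - c * ?r)) = s 0"
        using cases c r1 by (auto simp: c_def min_def)
      then show ?thesis by (simp add: 0 unfold_sides_def ru)
    next
      case (Suc j)
      have "unfold_sides n ?u (Suc j) = (if j < n then (c * ?w j / c + 1) / 2 else 0)"
        by (simp add: unfold_sides_def ru m u)
      then show ?thesis
        using c sc Suc by (auto simp: centred_def cube_set_def)
    qed
  qed
qed

text \<open>On the bottom the concentric half-size cube has time \<open>0\<close>, and the rest is
  projected radially to the boundary. In both places a null homotopy run backwards takes the base
  value.\<close>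

lemma fold_sides_bottom:
  assumes "0 < n" "s \<in> cube_set (Suc n)" and s0: "s 0 = 0"
  shows "fold_time n s = 0 \<or> fold_sides n s \<in> cube_boundary n"
proof (cases "radius n (centred s \<circ> Suc) \<le> 1/2")
  case True
  then show ?thesis by (simp add: fold_time_def s0)
next
  case False
  let ?w = "centred s \<circ> Suc"
  obtain i where i: "i < n" "\<bar>?w i\<bar> = radius n ?w" using radius_attained[OF assms(1)] by blast
  then have "?w i = radius n ?w \<or> ?w i = - radius n ?w" by linarith
  then have "?w i / max (radius n ?w) (1/2) = 1 \<or> ?w i / max (radius n ?w) (1/2) = -1"
    using False by (auto simp: max_def)
  then have "fold_sides n s i = 0 \<or> fold_sides n s i = 1"
    using i(1) s0 by (auto simp: fold_sides_def)
  then show ?thesis using i(1) fold_sides_in[OF assms(2)] by (auto simp: cube_boundary_eq)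
qed

definition null_spheroids :: "nat \<Rightarrow> 'u topology \<Rightarrow> 'u \<Rightarrow> bool" where
  "null_spheroids n Y y \<longleftrightarrow> (\<forall>f\<in>spheroids n Y y.
     homotopic_with (\<lambda>h. \<forall>s\<in>cube_boundary n. h s = y) (cube n) Y f (\<lambda>_. y))"

text \<open>Through \<open>unfold_sides\<close>, the map \<open>k\<close> on the boundary becomes a
  spheroid. A null homotopy of this spheroid, composed with the folding map, is defined on the solid
  cube and restores \<open>k\<close> on its boundary.\<close>

lemma cube_extension:
  assumes n: "0 < n" and null: "null_spheroids n Y y"
    and k: "continuous_map (subtopology (cube (Suc n)) (cube_boundary (Suc n))) Y k"
    and k0: "\<And>s. s \<in> cube_boundary (Suc n) \<Longrightarrow> s 0 = 0 \<Longrightarrow> k s = y"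
  obtains k' where "continuous_map (cube (Suc n)) Y k'" "\<And>s. s \<in> cube_boundary (Suc n) \<Longrightarrow> k' s = k s"
proof -
  have bs: "cube_boundary m \<subseteq> cube_set m" for m by (auto simp: cube_boundary_eq)
  have "continuous_map (cube n) (subtopology (cube (Suc n)) (cube_boundary (Suc n))) (unfold_sides n)"
    using unfold_sides_in_boundary[OF n] continuous_unfold_sides bs[of "Suc n"]
    by (simp add: cube_eq subtopology_subtopology Int_absorb1 continuous_map_top_of_set image_subset_iff topspace_cube_set)
  from continuous_map_compose[OF this k] have "continuous_map (cube n) Y (k \<circ> unfold_sides n)" .
  moreover have "(k \<circ> unfold_sides n) u = y" if "u \<in> cube_boundary n" for u
    using that bs[of n] unfold_sides_in_boundary[OF n, of u] unfold_sides_boundary[OF that] k0 by auto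
  ultimately have "k \<circ> unfold_sides n \<in> spheroids n Y y"
    by (simp add: spheroids_def)
  then have "homotopic_with (\<lambda>h. \<forall>s\<in>cube_boundary n. h s = y) (cube n) Y (k \<circ> unfold_sides n) (\<lambda>_. y)"
    using null by (simp add: null_spheroids_def)
  then obtain N where N: "continuous_map (prod_topology unit_interval (cube n)) Y N"
      "\<And>u. N (0, u) = k (unfold_sides n u)" "\<And>u. N (1, u) = y"
      "\<And>t u. t \<in> {0..1} \<Longrightarrow> u \<in> cube_boundary n \<Longrightarrow> N (t, u) = y"
    by (auto simp: homotopic_with_def)
  \<comment> \<open>Time is reversed: the null homotopy starts at the spheroid, while
    \<open>fold_time\<close> equals \<open>1\<close> on the part of the boundary where the spheroid
    must be recovered.\<close>
  let ?\<psi> = "\<lambda>s. (1 - fold_time n s, fold_sides n s)"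
  have "continuous_map (cube (Suc n)) unit_interval (\<lambda>s. 1 - fold_time n s)"
    unfolding cube_eq continuous_map_top_of_set
    using fold_time_in[of _ n] continuous_on_diff[OF continuous_on_const continuous_fold_time] by auto
  moreover have "continuous_map (cube (Suc n)) (cube n) (fold_sides n)"
    unfolding cube_eq continuous_map_top_of_set
    using fold_sides_in[of _ n] continuous_fold_sides by auto
  ultimately have "continuous_map (cube (Suc n)) (prod_topology unit_interval (cube n)) ?\<psi>"
    by (simp add: continuous_map_paired)
  from continuous_map_compose[OF this N(1)] have "continuous_map (cube (Suc n)) Y (N \<circ> ?\<psi>)" .
  moreover have "(N \<circ> ?\<psi>) s = k s" if s: "s \<in> cube_boundary (Suc n)" for s
  proof (cases "s 0 = 0")
    case True
    have sc: "s \<in> cube_set (Suc n)" using s bs by blast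
    have "N (?\<psi> s) = y"
      using fold_sides_bottom[OF n sc True] N(3,4) fold_time_in[OF sc] by auto
    then show ?thesis using k0[OF s True] by simp
  next
    case False
    then show ?thesis using unfold_fold_sides[OF s False] N(2) by simp
  qed
  ultimately show thesis by (rule that)
qed

section \<open>Extending maps over simplices\<close>

text \<open>The cube maps onto the simplex by a map that is injective in the interior.\<close>

definition collapse :: "(nat \<Rightarrow> real) \<Rightarrow> nat \<Rightarrow> real" where
  "collapse s i = (\<Prod>l<i. s l) * (1 - s i)"

lemma sum_collapse: "(\<Sum>i\<le>m. collapse s i) = 1 - (\<Prod>l<Suc m. s l)"
  by (induction m) (auto simp: collapse_def algebra_simps)

lemma collapse_in: "s \<in> cube_set m \<Longrightarrow> collapse s \<in> standard_simplex m"
proof -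
  assume s: "s \<in> cube_set m"
  then have s01: "0 \<le> s i \<and> s i \<le> 1" for i
    by (cases "i < m") (auto simp: cube_set_def)
  have p: "0 \<le> (\<Prod>l<i. s l)" "(\<Prod>l<i. s l) \<le> 1" for i
    using s01 by (auto intro!: prod_nonneg prod_le_1)
  have "0 \<le> collapse s i \<and> collapse s i \<le> 1" for i
    using p[of i] s01[of i] by (auto simp: collapse_def intro!: mult_le_one)
  moreover have "s m = 0" using s by (simp add: cube_set_def)
  then have z: "(\<Prod>l<i. s l) = 0" if "m < i" for i
    using that by (intro prod_zero) auto
  then have "(\<Sum>i\<le>m. collapse s i) = 1"
    by (simp only: sum_collapse lessI diff_zero)
  moreover have "collapse s i = 0" if "m < i" for i
    using z[OF that] by (simp add: collapse_def)
  ultimately show ?thesis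
    by (auto simp: standard_simplex_def)
qed

lemma continuous_collapse: "continuous_on S collapse"
proof (rule continuous_on_coordinatewise_then_product)
  have c: "continuous_on S (\<lambda>s. s i)" for i
    by (auto intro: continuous_on_product_coordinates continuous_on_subset)
  show "continuous_on S (\<lambda>s. collapse s i)" for i
    unfolding collapse_def by (intro continuous_intros c)
qed

lemma collapse_surj:
  assumes x: "x \<in> standard_simplex m"
  obtains s where "s \<in> cube_set m" "collapse s = x"
proof -
  define T where "T i = (\<Sum>l=i..m. x l)" for i
  \<comment> \<open>The cube coordinates are ratios of successive tail sums. Where
    \<open>T i = 0\<close> the division gives \<open>0\<close>, and
    \<open>T i * s i = T (Suc i)\<close> persists because the later tails vanish too.\<close>
  define s where "s i = T (Suc i) / T i" for i
  have x0: "0 \<le> x i" "i > m \<Longrightarrow> x i = 0" for i using x by (auto simp: standard_simplex_def)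
  have T: "T i = x i + T (Suc i)" for i
    by (cases "i \<le> m") (auto simp: T_def sum.atLeast_Suc_atMost x0)
  have T0: "0 \<le> T i" for i unfolding T_def using x0 by (intro sum_nonneg)
  have T_m: "T i = 0" if "m < i" for i using that by (simp add: T_def)
  have T_1: "T 0 = 1" using x by (simp add: T_def standard_simplex_def atMost_atLeast0)
  have step: "T i * s i = T (Suc i)" for i
    using T[of i] x0(1)[of i] T0[of "Suc i"] by (cases "T i = 0") (auto simp: s_def)
  have prod: "(\<Prod>l<i. s l) = T i" for i
    by (induction i) (auto simp: T_1 step)
  have "0 \<le> s i \<and> s i \<le> 1" for i
    using T[of i] x0(1)[of i] T0[of i] T0[of "Suc i"] by (auto simp: s_def divide_le_eq)
  moreover have "s i = 0" if "m \<le> i" for i using T_m that by (simp add: s_def)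
  ultimately have "s \<in> cube_set m" by (auto simp: cube_set_def)
  moreover have "collapse s = x"
  proof
    fix i
    have "collapse s i = T i - T i * s i"
      by (simp add: collapse_def prod algebra_simps)
    also have "\<dots> = x i"
      unfolding step using T[of i] by simp
    finally show "collapse s i = x i" .
  qed
  ultimately show thesis by (rule that)
qed

definition simplex_boundary :: "nat \<Rightarrow> (nat \<Rightarrow> real) set" where
  "simplex_boundary m = {x \<in> standard_simplex m. \<exists>j\<le>m. x j = 0}"

lemma collapse_boundary_iff:
  assumes s: "s \<in> cube_set m"
  shows "collapse s \<in> simplex_boundary m \<longleftrightarrow> s \<in> cube_boundary m"
proof
  assume "s \<in> cube_boundary m"
  then obtain i where i: "i < m" "s i = 0 \<or> s i = 1" by (auto simp: cube_boundary_eq)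
  \<comment> \<open>The value \<open>1\<close> kills the coordinate \<open>i\<close>, and the value
    \<open>0\<close> kills the coordinate \<open>Suc i\<close> through the product.\<close>
  then have "collapse s i = 0 \<or> collapse s (Suc i) = 0"
    by (auto simp: collapse_def)
  then have "\<exists>j\<le>m. collapse s j = 0"
    using i(1) by (metis Suc_leI less_imp_le)
  then show "collapse s \<in> simplex_boundary m"
    using collapse_in[OF s] by (simp add: simplex_boundary_def)
next
  assume "collapse s \<in> simplex_boundary m"
  then obtain j where j: "j \<le> m" "collapse s j = 0" by (auto simp: simplex_boundary_def)
  then consider "s j = 1" | l where "l < j" "s l = 0"
    by (auto simp: collapse_def prod_zero_iff)
  then show "s \<in> cube_boundary m"
  proof cases
    case 1
    then have "j \<noteq> m" using s by (auto simp: cube_set_def)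
    then show ?thesis using 1 j s by (auto simp: cube_boundary_eq intro!: exI[of _ j])
  next
    case 2
    then show ?thesis using j s by (auto simp: cube_boundary_eq intro!: exI[of _ l])
  qed
qed

lemma collapse_inj:
  assumes s: "s \<in> cube_set m" "s' \<in> cube_set m" and eq: "collapse s = collapse s'" and int: "s \<notin> cube_boundary m"
  shows "s = s'"
proof -
  have *: "(\<forall>l<i. s l = s' l)" if "i \<le> m" for i
    using that
  proof (induction i)
    case (Suc i)
    then have IH: "\<forall>l<i. s l = s' l" by simp
    have "(\<Prod>l<i. s l) \<noteq> 0"
      using s(1) int Suc.prems by (auto simp: cube_boundary_eq prod_zero_iff)
    moreover have "(\<Prod>l<i. s l) * (1 - s i) = (\<Prod>l<i. s l) * (1 - s' i)"
      using fun_cong[OF eq, of i] IH by (simp add: collapse_def)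
    ultimately show ?case using IH by (auto simp: less_Suc_eq)
  qed simp
  show ?thesis
  proof
    show "s i = s' i" for i using *[of m] s by (cases "i < m") (auto simp: cube_set_def)
  qed
qed

definition drop_coordinate :: "nat \<Rightarrow> (nat \<Rightarrow> real) \<Rightarrow> nat \<Rightarrow> real" where
  "drop_coordinate j x i = (if i < j then x i else x (Suc i))"

lemma simplical_face_drop: "x j = 0 \<Longrightarrow> simplical_face j (drop_coordinate j x) = x"
  by (auto simp: simplical_face_def drop_coordinate_def fun_eq_iff)

lemma drop_simplical_face: "drop_coordinate j (simplical_face j x) = x"
  by (auto simp: simplical_face_def drop_coordinate_def fun_eq_iff)

lemma drop_drop: "i \<le> j \<Longrightarrow> drop_coordinate i (drop_coordinate (Suc j) x) = drop_coordinate j (drop_coordinate i x)"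
  by (auto simp: drop_coordinate_def fun_eq_iff)

lemma sum_simplical_face: "j \<le> Suc n \<Longrightarrow> (\<Sum>i\<le>Suc n. simplical_face j x i) = (\<Sum>i\<le>n. x i)" for x :: "nat \<Rightarrow> real"
proof (induction n)
  case 0
  then show ?case by (cases j) (auto simp: simplical_face_def)
next
  case (Suc n)
  show ?case
  proof (cases "j = Suc (Suc n)")
    case True
    then show ?thesis by (simp add: simplical_face_def)
  next
    case False
    then show ?thesis using Suc by (simp add: simplical_face_def)
  qed
qed

lemma drop_in:
  assumes x: "x \<in> standard_simplex (Suc n)" "x j = 0" "j \<le> Suc n"
  shows "drop_coordinate j x \<in> standard_simplex n"
proof -
  have "(\<Sum>i\<le>n. drop_coordinate j x i) = 1"
    using sum_simplical_face[OF x(3), of "drop_coordinate j x"] x by (simp add: simplical_face_drop standard_simplex_def)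
  then show ?thesis
    using x by (auto simp: standard_simplex_def drop_coordinate_def)
qed

lemma simplical_face_boundary: "j \<le> Suc n \<Longrightarrow> t \<in> standard_simplex n \<Longrightarrow> simplical_face j t \<in> simplex_boundary (Suc n)"
  using simplical_face_in_standard_simplex[of "Suc n" j t]
  by (auto simp: simplex_boundary_def simplical_face_def)

text \<open>The faces \<open>x j = 0\<close> are closed, so the pasting lemma applies. A point
  common to two faces comes from a simplex of dimension \<open>n - 1\<close>, on which
  \<open>compat\<close> gives agreement.\<close>

lemma glue_faces:
  assumes fc: "\<And>j. j \<le> Suc n \<Longrightarrow> singular_simplex n Y (fc j)"
    and compat: "\<And>i j. i \<le> j \<Longrightarrow> j \<le> n \<Longrightarrow> singular_face n i (fc (Suc j)) = singular_face n j (fc i)"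
    and n: "0 < n"
  obtains g where "continuous_map (top_of_set (simplex_boundary (Suc n))) Y g"
    "\<And>j t. j \<le> Suc n \<Longrightarrow> t \<in> standard_simplex n \<Longrightarrow> g (simplical_face j t) = fc j t"
proof -
  let ?B = "simplex_boundary (Suc n)"
  let ?T = "\<lambda>j. {x \<in> ?B. x j = 0}"
  have agree: "fc j (drop_coordinate j x) = fc i (drop_coordinate i x)"
    if ij: "i < j" "j \<le> Suc n" "x \<in> ?B" "x i = 0" "x j = 0" for i j x
  proof -
    obtain j' where j': "j = Suc j'" "i \<le> j'" "j' \<le> n" using ij by (cases j) auto
    let ?t = "drop_coordinate i (drop_coordinate j x)"
    have x: "x \<in> standard_simplex (Suc n)" using ij by (simp add: simplex_boundary_def)
    have d: "drop_coordinate j x \<in> standard_simplex (Suc (n - 1))" "drop_coordinate j x i = 0"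
      using drop_in[OF x ij(5,2)] ij n by (auto simp: drop_coordinate_def)
    have d': "drop_coordinate i x j' = 0" using j' ij by (simp add: drop_coordinate_def)
    have t: "?t \<in> standard_simplex (n - 1)"
      using drop_in[OF d] j' n by simp
    have "singular_face n i (fc (Suc j')) ?t = singular_face n j' (fc i) ?t"
      using compat[OF j'(2,3)] by simp
    then have "fc (Suc j') (simplical_face i ?t) = fc i (simplical_face j' ?t)"
      using t by (simp add: singular_face_def)
    moreover have "simplical_face i ?t = drop_coordinate j x"
      using d(2) by (rule simplical_face_drop)
    moreover have "simplical_face j' ?t = drop_coordinate i x"
      unfolding j' drop_drop[OF j'(2)] using d' by (rule simplical_face_drop)
    ultimately show ?thesis by (simp add: j')
  qed
  obtain g where g: "continuous_map (top_of_set ?B) Y g"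
    "\<And>x j. j \<in> {..Suc n} \<Longrightarrow> x \<in> topspace (top_of_set ?B) \<inter> ?T j \<Longrightarrow> g x = fc j (drop_coordinate j x)"
  proof (rule pasting_lemma_exists_closed[of "{..Suc n}" "top_of_set ?B" ?T Y "\<lambda>j x. fc j (drop_coordinate j x)"])
    show "topspace (top_of_set ?B) \<subseteq> \<Union> (?T ` {..Suc n})"
      by (auto simp: simplex_boundary_def)
    fix j assume j: "j \<in> {..Suc n}"
    have coord: "continuous_on S (\<lambda>x::nat \<Rightarrow> real. x i)" for S i
      by (auto intro: continuous_on_product_coordinates continuous_on_subset)
    have "closedin (top_of_set ?B) (?B \<inter> (\<lambda>x. x j) -` {0})"
      by (intro continuous_closedin_preimage coord) simp
    moreover have "?B \<inter> (\<lambda>x. x j) -` {0} = ?T j" by auto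
    ultimately show "closedin (top_of_set ?B) (?T j)" by simp
    have "continuous_on (?T j) (drop_coordinate j)"
    proof (rule continuous_on_coordinatewise_then_product)
      show "continuous_on (?T j) (\<lambda>x. drop_coordinate j x i)" for i
        unfolding drop_coordinate_def by (cases "i < j") (simp_all add: coord)
    qed
    then have "continuous_map (top_of_set (?T j)) (simplex_top n) (drop_coordinate j)"
      using drop_in j unfolding simplex_top_eq continuous_map_top_of_set
      by (auto simp: simplex_boundary_def)
    from continuous_map_compose[OF this, of Y "fc j"]
    have "continuous_map (top_of_set (?T j)) Y (\<lambda>x. fc j (drop_coordinate j x))"
      using fc[of j] j by (simp add: singular_simplex_def o_def)
    moreover have "?B \<inter> ?T j = ?T j" by auto
    ultimately show "continuous_map (subtopology (top_of_set ?B) (?T j)) Y (\<lambda>x. fc j (drop_coordinate j x))"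
      by (simp add: subtopology_subtopology)
  next
    fix i j x assume ij: "i \<in> {..Suc n}" "j \<in> {..Suc n}" "x \<in> topspace (top_of_set ?B) \<inter> ?T i \<inter> ?T j"
    then show "fc i (drop_coordinate i x) = fc j (drop_coordinate j x)"
      using agree[of i j x] agree[of j i x] by (cases i j rule: linorder_cases) auto
  qed auto
  show thesis
  proof (rule that[OF g(1)])
    fix j t assume "j \<le> Suc n" "t \<in> standard_simplex n"
    then show "g (simplical_face j t) = fc j t"
      using g(2)[of j "simplical_face j t"] simplical_face_boundary[of j n t] drop_simplical_face[of j t]
      by (auto simp: simplical_face_def)
  qed
qed

text \<open>The map on the boundary is pulled back to the cube along \<open>collapse\<close>,
  extended there by \<open>cube_extension\<close>, and descends again because
  \<open>collapse\<close> is injective in the interior.\<close>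

lemma fill_simplex:
  assumes n: "0 < n" and null: "null_spheroids n Y y"
    and fc: "\<And>j. j \<le> Suc n \<Longrightarrow> singular_simplex n Y (fc j)"
    and compat: "\<And>i j. i \<le> j \<Longrightarrow> j \<le> n \<Longrightarrow> singular_face n i (fc (Suc j)) = singular_face n j (fc i)"
    and vertex: "fc (Suc n) (basis_vec 0) = y"
  shows "\<exists>g. singular_simplex (Suc n) Y g \<and> (\<forall>j\<le>Suc n. singular_face (Suc n) j g = fc j)"
proof -
  let ?B = "simplex_boundary (Suc n)" and ?C = "cube_boundary (Suc n)"
  obtain g where g: "continuous_map (top_of_set ?B) Y g"
    "\<And>j t. j \<le> Suc n \<Longrightarrow> t \<in> standard_simplex n \<Longrightarrow> g (simplical_face j t) = fc j t"
    using glue_faces[OF fc compat n] by blast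
  have CS: "?C \<subseteq> cube_set (Suc n)" by (auto simp: cube_boundary_eq)
  have "continuous_map (top_of_set ?C) (top_of_set ?B) collapse"
    using collapse_boundary_iff CS by (auto simp: continuous_map_top_of_set continuous_collapse)
  moreover have "subtopology (cube (Suc n)) ?C = top_of_set ?C"
    using CS by (simp add: cube_eq subtopology_subtopology Int_absorb1)
  ultimately have k: "continuous_map (subtopology (cube (Suc n)) ?C) Y (g \<circ> collapse)"
    using continuous_map_compose g(1) by metis
  \<comment> \<open>The whole bottom of the cube collapses to the vertex \<open>0\<close>, so the
    constancy required by \<open>cube_extension\<close> is a condition at that vertex only.\<close>
  have v: "collapse s = simplical_face (Suc n) (basis_vec 0)" if "s \<in> cube_set (Suc n)" "s 0 = 0" for s
  proof
    fix i
    show "collapse s i = simplical_face (Suc n) (basis_vec 0) i"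
      using that by (cases i) (auto simp: collapse_def simplical_face_def basis_vec_def prod.lessThan_Suc_shift
          simp del: prod.lessThan_Suc)
  qed
  have k0: "(g \<circ> collapse) s = y" if "s \<in> ?C" "s 0 = 0" for s
    using v[of s] that CS g(2)[of "Suc n" "basis_vec 0"] vertex by auto
  obtain k' where k': "continuous_map (cube (Suc n)) Y k'" "\<And>s. s \<in> ?C \<Longrightarrow> k' s = (g \<circ> collapse) s"
    using cube_extension[OF n null k k0] by blast
  have q: "continuous_map (cube (Suc n)) (simplex_top (Suc n)) collapse"
    unfolding cube_eq simplex_top_eq using collapse_in by (auto simp: continuous_map_top_of_set continuous_collapse)
  have surj: "collapse ` topspace (cube (Suc n)) = topspace (simplex_top (Suc n))"
    using collapse_in by (auto simp: topspace_cube_set elim!: collapse_surj)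
  have fib: "k' s = k' s'" if "s \<in> topspace (cube (Suc n))" "s' \<in> topspace (cube (Suc n))" "collapse s = collapse s'" for s s'
  proof (cases "s \<in> ?C")
    case True
    then have "s' \<in> ?C"
      using that collapse_boundary_iff[of s "Suc n"] collapse_boundary_iff[of s' "Suc n"] by (simp add: topspace_cube_set)
    then show ?thesis using True k'(2) that by simp
  next
    case False
    then show ?thesis using collapse_inj[of s "Suc n" s'] that by (simp add: topspace_cube_set)
  qed
  obtain G where G: "continuous_map (simplex_top (Suc n)) Y G" "\<And>s. s \<in> topspace (cube (Suc n)) \<Longrightarrow> G (collapse s) = k' s"
    using extend_over_quotient[OF q surj compact_cube Hausdorff_simplex_top k'(1) fib] by blast
  let ?G = "restrict G (standard_simplex (Suc n))"
  have Gf: "G (simplical_face j t) = fc j t" if "j \<le> Suc n" "t \<in> standard_simplex n" for j t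
  proof -
    have b: "simplical_face j t \<in> ?B" using that by (rule simplical_face_boundary)
    then obtain s where s: "s \<in> cube_set (Suc n)" "collapse s = simplical_face j t"
      using collapse_surj[of "simplical_face j t" "Suc n"] by (auto simp: simplex_boundary_def)
    then have "s \<in> ?C" using collapse_boundary_iff[of s "Suc n"] b by simp
    then show ?thesis using G(2)[of s] k'(2) g(2)[OF that] s by (simp add: topspace_cube_set)
  qed
  have "singular_simplex (Suc n) Y ?G"
    using G(1) by (simp add: singular_simplex_def)
  moreover have "singular_face (Suc n) j ?G = fc j" if j: "j \<le> Suc n" for j
  proof (rule extensionalityI[where A = "standard_simplex n"])
    show "fc j \<in> extensional (standard_simplex n)" using fc[OF j] by (simp add: singular_simplex_def)
    show "singular_face (Suc n) j ?G t = fc j t" if "t \<in> standard_simplex n" for t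
      using that Gf[OF j that] simplical_face_in_standard_simplex[of "Suc n" j t] j
      by (simp add: singular_face_def)
  qed (simp add: singular_face_def)
  ultimately show ?thesis by blast
qed

lemma null_spheroidsI:
  assumes "trivial_group (homotopy_group n Y y)" "y \<in> topspace Y"
  shows "null_spheroids n Y y"
  unfolding null_spheroids_def
proof
  fix f assume f: "f \<in> spheroids n Y y"
  have "spheroid_rel n Y y `` {f} \<in> carrier (homotopy_group n Y y)"
    using f by (simp add: homotopy_group_def quotientI)
  then have "spheroid_rel n Y y `` {f} = spheroid_rel n Y y `` {\<lambda>_. y}"
    using assms(1) by (auto simp: trivial_group_def homotopy_group_def)
  moreover have "(\<lambda>_. y) \<in> spheroids n Y y"
    using assms(2) by (simp add: spheroids_def)
  ultimately have "(f, \<lambda>_. y) \<in> spheroid_rel n Y y"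
    using f eq_equiv_class_iff[OF equiv_spheroid_rel] by metis
  then show "homotopic_with (\<lambda>h. \<forall>s\<in>cube_boundary n. h s = y) (cube n) Y f (\<lambda>_. y)"
    by (simp add: spheroid_rel_def)
qed

section \<open>Filling triangles by homotopies of paths\<close>

definition edge :: "real \<Rightarrow> nat \<Rightarrow> real" where
  "edge s i = (if i = 0 then 1 - s else if i = 1 then s else 0)"

lemma edge_in: "s \<in> {0..1} \<Longrightarrow> edge s \<in> standard_simplex 1"
  by (auto simp: standard_simplex_def edge_def)

lemma simplex_1_eq_edge:
  assumes "z \<in> standard_simplex 1"
  shows "z = edge (z 1)" "z 1 \<in> {0..1}"
proof -
  have "z 0 + z 1 = 1" "z 1 \<in> {0..1}" "\<forall>i>1. z i = 0" using assms by (auto simp: standard_simplex_def)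
  then show "z = edge (z 1)" "z 1 \<in> {0..1}" by (auto simp: edge_def fun_eq_iff)
qed

text \<open>A homotopy of paths, seen as a map on the square, is constant on the two sides that this
  quotient map collapses to the vertices \<open>0\<close> and \<open>2\<close> of the triangle.\<close>

definition square_to_triangle :: "real \<times> real \<Rightarrow> nat \<Rightarrow> real" where
  "square_to_triangle = (\<lambda>(t, s) i.
     if i = 0 then (1 - t) * (1 - s) + t * max (1 - 2 * s) 0
     else if i = 1 then t * min (2 * s) (2 - 2 * s)
     else if i = 2 then (1 - t) * s + t * max (2 * s - 1) 0
     else 0)"

text \<open>The parameter \<open>s\<close> can thus be read off from the image, and only
  \<open>t\<close> can vary within a fibre.\<close>

lemma square_to_triangle_diff: "square_to_triangle (t, s) 2 - square_to_triangle (t, s) 0 = 2 * s - 1"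
  by (auto simp: square_to_triangle_def max_def algebra_simps)

lemma square_to_triangle_in:
  assumes "t \<in> {0..1}" "s \<in> {0..1}"
  shows "square_to_triangle (t, s) \<in> standard_simplex 2"
proof -
  let ?x = "square_to_triangle (t, s)"
  have nonneg: "0 \<le> ?x i" for i
    using assms by (auto simp: square_to_triangle_def intro!: add_nonneg_nonneg mult_nonneg_nonneg)
  have sum: "?x 0 + ?x 1 + ?x 2 = 1"
    by (auto simp: square_to_triangle_def max_def min_def algebra_simps)
  have "?x i \<le> 1" for i
  proof -
    consider "i = 0" | "i = 1" | "i = 2" | "i > 2" by linarith
    then show ?thesis
      using nonneg[of 0] nonneg[of 1] nonneg[of 2] sum
      by cases (simp_all add: square_to_triangle_def)
  qed
  moreover have "(\<Sum>i\<le>2. ?x i) = 1" using sum by (simp add: numeral_2_eq_2)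
  moreover have "?x i = 0" if "2 < i" for i using that by (simp add: square_to_triangle_def)
  ultimately show ?thesis using nonneg by (simp add: standard_simplex_def)
qed

lemma square_to_triangle_surj:
  assumes x: "x \<in> standard_simplex 2"
  shows "x \<in> square_to_triangle ` ({0..1} \<times> {0..1})"
proof -
  have x0: "0 \<le> x 0" "0 \<le> x 1" "0 \<le> x 2" "x 0 + x 1 + x 2 = 1" "\<forall>i>2. x i = 0"
    using x by (auto simp: standard_simplex_def numeral_2_eq_2)
  \<comment> \<open>\<open>s\<close> is forced by \<open>square_to_triangle_diff\<close>,
    \<open>c\<close> is the largest middle coordinate possible at this \<open>s\<close>, and
    \<open>t\<close> is the attained fraction of it. If \<open>c = 0\<close>, the middle coordinate
    is \<open>0\<close> and division by zero gives the admissible value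
    \<open>t = 0\<close>.\<close>
  define s where "s = (1 + x 2 - x 0) / 2"
  define c where "c = min (2 * s) (2 - 2 * s)"
  define t where "t = x 1 / c"
  have s: "0 \<le> s" "s \<le> 1" using x0 by (auto simp: s_def)
  have c: "x 1 \<le> c" "0 \<le> c" using x0 by (auto simp: c_def s_def min_def field_simps)
  have t: "0 \<le> t" "t \<le> 1" "t * c = x 1" using c x0 by (auto simp: t_def divide_le_eq)
  have "(1 - t) * (1 - s) + t * max (1 - 2 * s) 0 = 1 - s - t * c / 2"
    "(1 - t) * s + t * max (2 * s - 1) 0 = s - t * c / 2"
  proof -
    define a where "a = \<bar>1 - 2 * s\<bar>"
    have e: "c = 1 - a" "max (1 - 2 * s) 0 = (1 - 2 * s + a) / 2" "max (2 * s - 1) 0 = (2 * s - 1 + a) / 2"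
      by (auto simp: a_def c_def max_def min_def abs_if)
    show "(1 - t) * (1 - s) + t * max (1 - 2 * s) 0 = 1 - s - t * c / 2"
      "(1 - t) * s + t * max (2 * s - 1) 0 = s - t * c / 2"
      unfolding e by (simp_all add: field_simps)
  qed
  note sums = this
  have s2: "2 * s = 1 + x 2 - x 0" by (simp add: s_def)
  have "square_to_triangle (t, s) 0 = 1 - s - t * c / 2" "square_to_triangle (t, s) 1 = t * c"
    "square_to_triangle (t, s) 2 = s - t * c / 2"
    using sums by (simp_all add: square_to_triangle_def c_def)
  then have "square_to_triangle (t, s) 0 = x 0" "square_to_triangle (t, s) 1 = x 1" "square_to_triangle (t, s) 2 = x 2"
    using x0(4) t(3) s2 by linarith+
  moreover have "square_to_triangle (t, s) i = x i" if "2 < i" for i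
    using that x0(5) by (simp add: square_to_triangle_def)
  ultimately have "square_to_triangle (t, s) i = x i" for i
    by (cases "i = 0"; cases "i = 1"; cases "i = 2") auto
  then have "x = square_to_triangle (t, s)" by auto
  then show ?thesis using s t by (auto intro!: image_eqI[of _ _ "(t, s)"])
qed

text \<open>Dimension two is separate from \<open>fill_simplex\<close> because loops need not be
  null homotopic. The edge from vertex \<open>0\<close> to vertex \<open>2\<close> must be homotopic
  to the composite of the other two, and the homotopy itself is the filling.\<close>

lemma fill_triangle:
  assumes fc: "\<And>j. j \<le> 2 \<Longrightarrow> singular_simplex 1 Y (fc j)"
    and htpy: "path_htpy Y (\<lambda>s. fc 1 (edge s)) (path_join (\<lambda>s. fc 2 (edge s)) (\<lambda>s. fc 0 (edge s)))"
    and mid: "fc 2 (edge 1) = fc 0 (edge 0)"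
  shows "\<exists>g. singular_simplex 2 Y g \<and> (\<forall>j\<le>2. singular_face 2 j g = fc j)"
proof -
  let ?I2 = "prod_topology unit_interval unit_interval"
  obtain h where h: "continuous_map ?I2 Y h"
      "\<And>s. s \<in> {0..1} \<Longrightarrow> h (0, s) = fc 1 (edge s)"
      "\<And>s. s \<in> {0..1} \<Longrightarrow> h (1, s) = path_join (\<lambda>s. fc 2 (edge s)) (\<lambda>s. fc 0 (edge s)) s"
      "\<And>t. t \<in> {0..1} \<Longrightarrow> h (t, 0) = fc 1 (edge 0) \<and> h (t, 1) = fc 1 (edge 1)"
    using htpy unfolding path_htpy_iff by blast
  have "continuous_on ({0..1} \<times> {0..1}) square_to_triangle"
  proof (rule continuous_on_coordinatewise_then_product)
    show "continuous_on ({0..1} \<times> {0..1}) (\<lambda>z. square_to_triangle z i)" for i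
      unfolding square_to_triangle_def case_prod_unfold
      by (cases "i = 0"; cases "i = 1"; cases "i = 2") (simp_all, (intro continuous_intros)+)
  qed
  then have q: "continuous_map ?I2 (simplex_top 2) square_to_triangle"
    unfolding unit_square simplex_top_eq continuous_map_top_of_set using square_to_triangle_in by auto
  have surj: "square_to_triangle ` topspace ?I2 = topspace (simplex_top 2)"
    using square_to_triangle_in square_to_triangle_surj by (auto simp: unit_square)
  have comp: "compact_space ?I2"
    unfolding unit_square by (simp add: compact_space_subtopology compact_Times)
  have fib: "h z = h z'" if z: "z \<in> topspace ?I2" "z' \<in> topspace ?I2" and eq: "square_to_triangle z = square_to_triangle z'" for z z'
  proof -
    obtain t s t' s' where ts: "z = (t, s)" "z' = (t', s')" by (cases z, cases z')
    have in01: "t \<in> {0..1}" "s \<in> {0..1}" "t' \<in> {0..1}" "s' \<in> {0..1}"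
      using z ts by (auto simp: unit_square)
    have s: "s = s'"
      using square_to_triangle_diff[of t s] square_to_triangle_diff[of t' s'] eq ts by simp
    show ?thesis
    proof (cases "s = 0 \<or> s = 1")
      case True
      then show ?thesis using h(4) in01 ts s by auto
    next
      case False
      have "t * min (2 * s) (2 - 2 * s) = t' * min (2 * s) (2 - 2 * s)"
        using fun_cong[OF eq, of 1] ts s by (simp add: square_to_triangle_def)
      moreover have "min (2 * s) (2 - 2 * s) \<noteq> 0" using False in01 by (auto simp: min_def)
      ultimately show ?thesis using ts s by simp
    qed
  qed
  obtain G where G: "continuous_map (simplex_top 2) Y G" "\<And>z. z \<in> topspace ?I2 \<Longrightarrow> G (square_to_triangle z) = h z"
    using extend_over_quotient[OF q surj comp Hausdorff_simplex_top h(1) fib] by blast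
  let ?G = "restrict G (standard_simplex 2)"
  have val: "G (simplical_face j z) = fc j z" if j: "j \<le> 2" and z: "z \<in> standard_simplex 1" for j z
  proof -
    define u where "u = z 1"
    have zu: "z = edge u" "u \<in> {0..1}" using simplex_1_eq_edge[OF z] by (simp_all add: u_def)
    consider "j = 0" | "j = 1" | "j = 2" using j by linarith
    then show ?thesis
    proof cases
      case 1
      have "simplical_face 0 (edge u) = square_to_triangle (1, (1 + u) / 2)"
        using zu(2) by (auto simp: fun_eq_iff simplical_face_def edge_def square_to_triangle_def max_def min_def field_simps)
      then have "G (simplical_face 0 (edge u)) = h (1, (1 + u) / 2)"
        using G(2)[of "(1, (1 + u) / 2)"] zu(2) by (simp add: unit_square)
      also have "\<dots> = fc 0 (edge u)"
        using zu(2) mid by (subst h(3)) (auto simp: path_join_def field_simps)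
      finally show ?thesis using 1 zu by simp
    next
      case 2
      have "simplical_face 1 (edge u) = square_to_triangle (0, u)"
        using zu(2) by (auto simp: fun_eq_iff simplical_face_def edge_def square_to_triangle_def)
      then show ?thesis
        using G(2)[of "(0, u)"] zu h(2)[of u] 2 by (simp add: unit_square)
    next
      case 3
      have "simplical_face 2 (edge u) = square_to_triangle (1, u / 2)"
        using zu(2) by (auto simp: fun_eq_iff simplical_face_def edge_def square_to_triangle_def max_def min_def)
      then have "G (simplical_face 2 (edge u)) = h (1, u / 2)"
        using G(2)[of "(1, u / 2)"] zu(2) by (simp add: unit_square)
      also have "\<dots> = fc 2 (edge u)"
        using zu(2) by (subst h(3)) (auto simp: path_join_def)
      finally show ?thesis using 3 zu by simp
    qed
  qed
  have "singular_simplex 2 Y ?G"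
    using G(1) by (simp add: singular_simplex_def)
  moreover have "singular_face 2 j ?G = fc j" if j: "j \<le> 2" for j
  proof (rule extensionalityI[where A = "standard_simplex 1"])
    show "fc j \<in> extensional (standard_simplex 1)" using fc[OF j] by (simp add: singular_simplex_def)
    show "singular_face 2 j ?G z = fc j z" if "z \<in> standard_simplex 1" for z
      using that val[OF j that] simplical_face_in_standard_simplex[of 2 j z] j
      by (simp add: singular_face_def numeral_2_eq_2)
  qed (simp add: singular_face_def)
  ultimately show ?thesis by blast
qed

section \<open>Straight lines and paths in a standard simplex\<close>

lemma simplex_path_htpy:
  assumes p: "pathin (simplex_top m) p" and q: "pathin (simplex_top m) q" and ends: "p 0 = q 0" "p 1 = q 1"
  shows "path_htpy (simplex_top m) p q"
proof -
  let ?k = "\<lambda>(t, s) i. (1 - t) * p s i + t * q s i"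
  have coord: "continuous_on ({0..1} \<times> {0..1}) (\<lambda>z. r (snd z) i)" and r_in: "s \<in> {0..1} \<Longrightarrow> r s \<in> standard_simplex m"
    if "pathin (simplex_top m) r" for r i s
  proof -
    have c: "continuous_on {0..1} r" and *: "r ` {0..1} \<subseteq> standard_simplex m"
      using that unfolding pathin_def simplex_top_eq continuous_map_top_of_set by auto
    from c have "continuous_on {0..1} (\<lambda>s. r s i)"
      by (rule continuous_on_product_then_coordinatewise)
    then show "continuous_on ({0..1} \<times> {0..1}) (\<lambda>z. r (snd z) i)"
      by (rule continuous_on_compose2) (auto intro!: continuous_intros)
    show "s \<in> {0..1} \<Longrightarrow> r s \<in> standard_simplex m" using * by auto
  qed
  have "continuous_on ({0..1} \<times> {0..1}) ?k"
    unfolding case_prod_unfold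
    by (rule continuous_on_coordinatewise_then_product) (intro continuous_intros coord p q)
  moreover have "?k ` ({0..1} \<times> {0..1}) \<subseteq> standard_simplex m"
    using r_in[OF p] r_in[OF q] by (auto intro!: convex_standard_simplex)
  ultimately have "continuous_map (prod_topology unit_interval unit_interval) (simplex_top m) ?k"
    unfolding unit_square simplex_top_eq continuous_map_top_of_set ..
  then show ?thesis
    unfolding path_htpy_iff using ends by (intro exI[of _ ?k]) (auto simp: algebra_simps)
qed

definition line :: "(nat \<Rightarrow> real) \<Rightarrow> (nat \<Rightarrow> real) \<Rightarrow> real \<Rightarrow> nat \<Rightarrow> real" where
  "line a b t i = (1 - t) * a i + t * b i"

lemma line_ends [simp]: "line a b 0 = a" "line a b 1 = b"
  by (simp_all add: line_def fun_eq_iff)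

lemma line_in: "a \<in> standard_simplex m \<Longrightarrow> b \<in> standard_simplex m \<Longrightarrow> t \<in> {0..1} \<Longrightarrow> line a b t \<in> standard_simplex m"
  unfolding line_def[abs_def] by (intro convex_standard_simplex) auto

lemma pathin_line:
  assumes "a \<in> standard_simplex m" "b \<in> standard_simplex m"
  shows "pathin (simplex_top m) (line a b)"
  unfolding pathin_def simplex_top_eq continuous_map_top_of_set
proof
  show "continuous_on {0..1} (line a b)"
    by (rule continuous_on_coordinatewise_then_product) (unfold line_def, intro continuous_intros)
qed (use assms line_in in auto)

lemma simplical_face_line: "simplical_face j (line a b t) = line (simplical_face j a) (simplical_face j b) t"
  by (auto simp: simplical_face_def line_def fun_eq_iff)

lemma simplical_face_basis_vec: "simplical_face j (basis_vec i) = basis_vec (if i < j then i else Suc i)"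
  by (auto simp: simplical_face_def basis_vec_def fun_eq_iff)

section \<open>Mapping the bar complex to an aspherical space\<close>

locale aspherical_labelling = path_labelling +
  assumes aspherical: "\<And>n. 2 \<le> n \<Longrightarrow> null_spheroids n Y y"
begin

definition edge_loop :: "'a \<Rightarrow> real \<Rightarrow> 'b" where
  "edge_loop g = (SOME p. is_loop Y y p \<and> lab p = g)"

lemma edge_loop: "g \<in> carrier P \<Longrightarrow> is_loop Y y (edge_loop g)" "g \<in> carrier P \<Longrightarrow> lab (edge_loop g) = g"
  using someI_ex[of "\<lambda>p. is_loop Y y p \<and> lab p = g"] lab_loop_surj[of g] by (auto simp: edge_loop_def)

text \<open>All vertices go to the base point, and the edge from \<open>g\<close> to \<open>h\<close> goes to a loop labelled \<open>inv g \<otimes> h\<close>, which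
  makes \<open>\<Gamma>\<close> invariant under \<open>P\<close>.\<close>

primrec \<Gamma> :: "nat \<Rightarrow> 'a list \<Rightarrow> (nat \<Rightarrow> real) \<Rightarrow> 'b" where
  "\<Gamma> 0 e = (\<lambda>x\<in>standard_simplex 0. y)"
| "\<Gamma> (Suc m) e = (if m = 0 then (\<lambda>x\<in>standard_simplex 1. edge_loop (inv (e ! 0) \<otimes> e ! 1) (x 1))
     else SOME g. singular_simplex (Suc m) Y g \<and> (\<forall>j\<le>Suc m. singular_face (Suc m) j g = \<Gamma> m (del j e)))"

lemma \<Gamma>_0: "\<Gamma> 0 e = restrict (\<lambda>_. y) (standard_simplex 0)"
  by (rule ext) simp

lemma nth_tuples: "e \<in> tuples P n \<Longrightarrow> i < n \<Longrightarrow> e ! i \<in> carrier P"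
  by (auto simp: tuples_def)

lemma \<Gamma>_edge_simplex:
  assumes e: "e \<in> tuples P 2"
  shows "singular_simplex 1 Y (\<Gamma> 1 e)" "s \<in> {0..1} \<Longrightarrow> \<Gamma> 1 e (edge s) = edge_loop (inv (e ! 0) \<otimes> e ! 1) s"
    "is_loop Y y (edge_loop (inv (e ! 0) \<otimes> e ! 1))" "lab (edge_loop (inv (e ! 0) \<otimes> e ! 1)) = inv (e ! 0) \<otimes> e ! 1"
proof -
  let ?p = "edge_loop (inv (e ! 0) \<otimes> e ! 1)"
  have g: "inv (e ! 0) \<otimes> e ! 1 \<in> carrier P" using nth_tuples[OF e] by simp
  show p: "is_loop Y y ?p" "lab ?p = inv (e ! 0) \<otimes> e ! 1" by (rule edge_loop g)+
  have "continuous_map (simplex_top 1) unit_interval (\<lambda>x. x 1)"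
    unfolding continuous_map_in_subtopology
    using continuous_map_simplex_coordinate simplex_1_eq_edge(2) by (simp add: Pi_iff del: One_nat_def)
  from continuous_map_compose[OF this, of Y ?p] show "singular_simplex 1 Y (\<Gamma> 1 e)"
    using p(1) by (simp add: singular_simplex_def is_loop_def pathin_def o_def)
  show "s \<in> {0..1} \<Longrightarrow> \<Gamma> 1 e (edge s) = ?p s"
    using edge_in[of s] by (simp add: edge_def)
qed

lemma \<Gamma>_properties:
  "e \<in> tuples P (Suc m) \<Longrightarrow> singular_simplex m Y (\<Gamma> m e) \<and> (\<forall>i\<le>m. \<Gamma> m e (basis_vec i) = y) \<and>
     (\<forall>n j. m = Suc n \<longrightarrow> j \<le> m \<longrightarrow> singular_face m j (\<Gamma> m e) = \<Gamma> n (del j e))"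
proof (induction m arbitrary: e)
  case 0
  have "continuous_map (simplex_top 0) Y (restrict (\<lambda>_. y) (standard_simplex 0))"
    by (rule continuous_map_eq[of _ _ "\<lambda>_. y"]) (use base in auto)
  then have "singular_simplex 0 Y (\<Gamma> 0 e)"
    unfolding \<Gamma>_0 singular_simplex_def using restrict_extensional by blast
  moreover have "\<Gamma> 0 e (basis_vec 0) = y" by simp
  ultimately show ?case by (simp del: \<Gamma>.simps)
next
  case (Suc m)
  have del: "del j e \<in> tuples P (Suc m)" if "j \<le> Suc m" for j
    using Suc.prems that by (rule del_in_tuples)
  have faces: "singular_simplex (Suc m) Y (\<Gamma> (Suc m) e) \<and>
      (\<forall>j\<le>Suc m. singular_face (Suc m) j (\<Gamma> (Suc m) e) = \<Gamma> m (del j e))"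
  proof (cases m)
    case 0
    note e = \<Gamma>_edge_simplex[OF Suc.prems[unfolded 0 numeral_2_eq_2[symmetric]]]
    have "singular_face 1 j (\<Gamma> 1 e) = \<Gamma> 0 (del j e)" if "j \<le> 1" for j
    proof (rule extensionalityI[where A = "standard_simplex 0"])
      fix x assume x: "x \<in> standard_simplex 0"
      then have "x = basis_vec 0" by (simp add: standard_simplex_0 basis_vec_def)
      moreover have "simplical_face j (basis_vec 0) = edge (if j = 0 then 1 else 0)"
        using that by (auto simp: simplical_face_def basis_vec_def edge_def fun_eq_iff)
      ultimately have "singular_face 1 j (\<Gamma> 1 e) x = \<Gamma> 1 e (edge (if j = 0 then 1 else 0))"
        using x by (simp add: singular_face_def)
      also have "\<dots> = y"
        using e(2)[of 0] e(2)[of 1] e(3) by (auto simp: is_loop_def)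
      finally show "singular_face 1 j (\<Gamma> 1 e) x = \<Gamma> 0 (del j e) x" using x by simp
    qed (auto simp: singular_face_def)
    then show ?thesis using e(1) 0 by simp
  next
    case (Suc n)
    have fc: "singular_simplex m Y (\<Gamma> m (del j e))" if "j \<le> Suc m" for j
      using Suc.IH[OF del[OF that]] by blast
    have "\<exists>g. singular_simplex (Suc m) Y g \<and> (\<forall>j\<le>Suc m. singular_face (Suc m) j g = \<Gamma> m (del j e))"
    proof (cases "n = 0")
      case True
      then have m: "m = 1" "Suc m = 2" using Suc by auto
      have el: "e \<in> tuples P 3" using Suc.prems m by (simp add: numeral_3_eq_3)
      have d: "del j e \<in> tuples P 2" if "j \<le> 2" for j using del[of j] that m by (simp add: numeral_2_eq_2)
      have ends: "\<Gamma> 1 (del j e) (edge s) = y" if "j \<le> 2" "s = 0 \<or> s = 1" for j s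
        using \<Gamma>_edge_simplex(2)[OF d[OF that(1)], of s] \<Gamma>_edge_simplex(3)[OF d[OF that(1)]] that(2)
        by (auto simp: is_loop_def)
      let ?a = "e ! 0" and ?b = "e ! 1" and ?c = "e ! 2"
      have carr: "?a \<in> carrier P" "?b \<in> carrier P" "?c \<in> carrier P" using nth_tuples[OF el] by auto
      have len: "length e = 3" using el by (simp add: tuples_def)
      have nth: "del 0 e ! 0 = ?b" "del 0 e ! 1 = ?c" "del 1 e ! 0 = ?a" "del 1 e ! 1 = ?c" "del 2 e ! 0 = ?a" "del 2 e ! 1 = ?b"
        using len by (simp_all add: nth_del numeral_2_eq_2)
      let ?p = "\<lambda>j. edge_loop (inv (del j e ! 0) \<otimes> del j e ! 1)"
      have p: "is_loop Y y (?p j)" "lab (?p j) = inv (del j e ! 0) \<otimes> del j e ! 1" if "j \<le> 2" for j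
        using \<Gamma>_edge_simplex(3,4)[OF d[OF that]] by auto
      have "lab (path_join (?p 2) (?p 0)) = lab (?p 2) \<otimes> lab (?p 0)"
        using p[of 0] p[of 2] reach_base by (intro lab_join) (auto simp: is_loop_def)
      \<comment> \<open>The triangle closes up because the differences from \<open>?a\<close> to
        \<open>?b\<close> and from \<open>?b\<close> to \<open>?c\<close> multiply to the difference
        from \<open>?a\<close> to \<open>?c\<close>.\<close>
      also have "\<dots> = lab (?p 1)"
      proof -
        have l: "lab (?p 2) = inv ?a \<otimes> ?b" "lab (?p 0) = inv ?b \<otimes> ?c" "lab (?p 1) = inv ?a \<otimes> ?c"
          using p(2)[of 2] p(2)[of 0] p(2)[of 1] unfolding nth by auto
        have "?b \<otimes> (inv ?b \<otimes> ?c) = ?c"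
          using carr by (simp add: m_assoc[symmetric] del: One_nat_def)
        then show ?thesis
          unfolding l using carr by (simp add: m_assoc del: One_nat_def)
      qed
      finally have "path_htpy Y (?p 1) (path_join (?p 2) (?p 0))"
        using p by (intro lab_loop_inj is_loop_join) auto
      moreover have "path_htpy Y (\<lambda>s. \<Gamma> 1 (del j e) (edge s)) (?p j)" if "j \<le> 2" for j
        by (rule path_htpy_sym, rule path_htpy_cong)
          (use p[OF that] \<Gamma>_edge_simplex(2)[OF d[OF that]] in \<open>auto simp: is_loop_def\<close>)
      note c = this
      have "path_htpy Y (path_join (?p 2) (?p 0)) (path_join (\<lambda>s. \<Gamma> 1 (del 2 e) (edge s)) (\<lambda>s. \<Gamma> 1 (del 0 e) (edge s)))"
        using p[of 0] p[of 2] by (intro path_htpy_join path_htpy_sym[OF c]) (auto simp: is_loop_def)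
      ultimately have "path_htpy Y (\<lambda>s. \<Gamma> 1 (del 1 e) (edge s))
          (path_join (\<lambda>s. \<Gamma> 1 (del 2 e) (edge s)) (\<lambda>s. \<Gamma> 1 (del 0 e) (edge s)))"
        using c[of 1] path_htpy_trans by (meson one_le_numeral)
      then have "\<exists>g. singular_simplex 2 Y g \<and> (\<forall>j\<le>2. singular_face 2 j g = \<Gamma> 1 (del j e))"
        using fc[unfolded m] ends[of 2 1] ends[of 0 0] m
        by (intro fill_triangle) (simp_all del: \<Gamma>.simps One_nat_def)
      then show ?thesis unfolding m(2) by (simp only: m(1))
    next
      case False
      show ?thesis
      proof (rule fill_simplex)
        show "0 < m" using Suc by simp
        show "null_spheroids m Y y" using False Suc by (intro aspherical) simp
        show "\<Gamma> m (del (Suc m) e) (basis_vec 0) = y" using Suc.IH[OF del[of "Suc m"]] by simp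
        show "singular_face m i (\<Gamma> m (del (Suc j) e)) = singular_face m j (\<Gamma> m (del i e))"
          if "i \<le> j" "j \<le> m" for i j
        proof -
          have "singular_face m i (\<Gamma> m (del (Suc j) e)) = \<Gamma> n (del i (del (Suc j) e))"
            "singular_face m j (\<Gamma> m (del i e)) = \<Gamma> n (del j (del i e))"
            using Suc.IH[OF del[of "Suc j"]] Suc.IH[OF del[of i]] that Suc by auto
          moreover have "del i (del (Suc j) e) = del j (del i e)"
            using that Suc.prems by (intro del_del) (auto simp: tuples_def)
          ultimately show ?thesis by simp
        qed
      qed (rule fc)
    qed
    then have "singular_simplex (Suc m) Y (SOME g. singular_simplex (Suc m) Y g \<and> (\<forall>j\<le>Suc m. singular_face (Suc m) j g = \<Gamma> m (del j e)))
      \<and> (\<forall>j\<le>Suc m. singular_face (Suc m) j (SOME g. singular_simplex (Suc m) Y g \<and> (\<forall>j\<le>Suc m. singular_face (Suc m) j g = \<Gamma> m (del j e))) = \<Gamma> m (del j e))"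
      by (rule someI_ex)
    then show ?thesis using Suc by simp
  qed
  have "\<Gamma> (Suc m) e (basis_vec i) = y" if i: "i \<le> Suc m" for i
  proof -
    \<comment> \<open>Every vertex lies in a face already treated: vertex \<open>0\<close> in the
      last face, any other vertex in the zeroth.\<close>
    define j i' where "j = (if i = 0 then Suc m else 0)" and "i' = (if i = 0 then 0 else i - 1)"
    have ij: "j \<le> Suc m" "i' \<le> m" "simplical_face j (basis_vec i') = basis_vec i"
      using i by (auto simp: j_def i'_def simplical_face_basis_vec)
    have "\<Gamma> (Suc m) e (basis_vec i) = singular_face (Suc m) j (\<Gamma> (Suc m) e) (basis_vec i')"
      using ij by (simp add: singular_face_def del: \<Gamma>.simps)
    also have "\<dots> = \<Gamma> m (del j e) (basis_vec i')"
      using faces ij by simp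
    also have "\<dots> = y" using Suc.IH[OF del[OF ij(1)]] ij by blast
    finally show ?thesis .
  qed
  then show ?case using faces by blast
qed

lemma \<Gamma>_singular: "e \<in> tuples P (Suc m) \<Longrightarrow> singular_simplex m Y (\<Gamma> m e)"
  and \<Gamma>_vertex: "e \<in> tuples P (Suc m) \<Longrightarrow> i \<le> m \<Longrightarrow> \<Gamma> m e (basis_vec i) = y"
  using \<Gamma>_properties by blast+

lemma \<Gamma>_continuous: "e \<in> tuples P (Suc m) \<Longrightarrow> continuous_map (simplex_top m) Y (\<Gamma> m e)"
  using \<Gamma>_singular by (auto simp: singular_simplex_def)

lemma \<Gamma>_face:
  assumes "e \<in> tuples P (Suc (Suc m))" "j \<le> Suc m" "x \<in> standard_simplex m"
  shows "\<Gamma> (Suc m) e (simplical_face j x) = \<Gamma> m (del j e) x"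
proof -
  have "singular_face (Suc m) j (\<Gamma> (Suc m) e) = \<Gamma> m (del j e)"
    using \<Gamma>_properties[OF assms(1)] assms(2) by blast
  from fun_cong[OF this, of x] show ?thesis using assms(3) by (simp add: singular_face_def del: \<Gamma>.simps)
qed

text \<open>Edges depend only on differences, and each higher choice only on the maps chosen for the
  faces, so \<open>SOME\<close> meets the same predicate for the translated tuple.\<close>

lemma \<Gamma>_act: "h \<in> carrier P \<Longrightarrow> e \<in> tuples P (Suc m) \<Longrightarrow> \<Gamma> m (map ((\<otimes>) h) e) = \<Gamma> m e"
proof (induction m arbitrary: e)
  case (Suc m)
  have "\<Gamma> m (del j (map ((\<otimes>) h) e)) = \<Gamma> m (del j e)" if "j \<le> Suc m" for j
    using Suc.IH[OF Suc.prems(1) del_in_tuples[OF Suc.prems(2) that]] by (simp add: del_map)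
  then have some: "(\<lambda>g. singular_simplex (Suc m) Y g \<and> (\<forall>j\<le>Suc m. singular_face (Suc m) j g = \<Gamma> m (del j (map ((\<otimes>) h) e))))
    = (\<lambda>g. singular_simplex (Suc m) Y g \<and> (\<forall>j\<le>Suc m. singular_face (Suc m) j g = \<Gamma> m (del j e)))"
    by auto
  have "inv (map ((\<otimes>) h) e ! 0) \<otimes> map ((\<otimes>) h) e ! 1 = inv (e ! 0) \<otimes> e ! 1" if "m = 0"
  proof -
    have "e ! 0 \<in> carrier P" "e ! 1 \<in> carrier P" "length e = 2"
      using Suc.prems nth_tuples[OF Suc.prems(2)] that by (auto simp: tuples_def)
    then show ?thesis using Suc.prems(1) by (simp add: inv_mult_group m_assoc inv_solve_left')
  qed
  then show ?case unfolding \<Gamma>.simps some by (cases "m = 0") (simp_all add: restrict_def)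
qed simp

lemma pathin_\<Gamma>: "e \<in> tuples P (Suc m) \<Longrightarrow> pathin (simplex_top m) \<phi> \<Longrightarrow> pathin Y (\<Gamma> m e \<circ> \<phi>)"
  using \<Gamma>_continuous pathin_compose by blast

lemma reach_\<Gamma>:
  assumes e: "e \<in> tuples P (Suc m)" and x: "x \<in> standard_simplex m"
  shows "reach (\<Gamma> m e x)"
  using reach_path[OF pathin_\<Gamma>[OF e pathin_line[OF _ x, of "basis_vec 0"]]] \<Gamma>_vertex[OF e, of 0] reach_base by simp

text \<open>\<open>\<Gamma> m e x\<close> and \<open>label m e x\<close> together are the image of \<open>x\<close> in the universal covering, whose points are
  encoded as pairs of a point of \<open>Y\<close> and an element of \<open>P\<close>.\<close>

definition label :: "nat \<Rightarrow> 'a list \<Rightarrow> (nat \<Rightarrow> real) \<Rightarrow> 'a" where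
  "label m e x = e ! 0 \<otimes> lab (\<Gamma> m e \<circ> line (basis_vec 0) x)"

lemma lab_\<Gamma>_line_closed:
  assumes e: "e \<in> tuples P (Suc m)" and \<phi>: "pathin (simplex_top m) \<phi>"
  shows "lab (\<Gamma> m e \<circ> \<phi>) \<in> carrier P"
proof -
  have "\<phi> 0 \<in> standard_simplex m" using path_start_in_topspace[OF \<phi>] by simp
  then show ?thesis using reach_\<Gamma>[OF e] pathin_\<Gamma>[OF e \<phi>] by (intro lab_closed) auto
qed

lemma label_closed: "e \<in> tuples P (Suc m) \<Longrightarrow> x \<in> standard_simplex m \<Longrightarrow> label m e x \<in> carrier P"
  unfolding label_def by (intro m_closed lab_\<Gamma>_line_closed pathin_line) (auto intro: nth_tuples)

text \<open>In the convex simplex the line to the start of \<open>\<phi>\<close> followed by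
  \<open>\<phi>\<close> is homotopic to the line to its end. So the pairs of image and label move
  along lifted paths, as the functions from \<open>section_label\<close> require.\<close>

lemma label_path:
  assumes e: "e \<in> tuples P (Suc m)" and \<phi>: "pathin (simplex_top m) \<phi>"
  shows "label m e (\<phi> 1) = label m e (\<phi> 0) \<otimes> lab (\<Gamma> m e \<circ> \<phi>)"
proof -
  have ends: "\<phi> 0 \<in> standard_simplex m" "\<phi> 1 \<in> standard_simplex m"
    using path_start_in_topspace[OF \<phi>] path_finish_in_topspace[OF \<phi>] by simp_all
  let ?l = "\<lambda>x. line (basis_vec 0) x"
  have l: "pathin (simplex_top m) (?l x)" if "x \<in> standard_simplex m" for x
    using that by (intro pathin_line) auto
  have "path_htpy (simplex_top m) (path_join (?l (\<phi> 0)) \<phi>) (?l (\<phi> 1))"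
    using ends l \<phi> by (intro simplex_path_htpy pathin_join) auto
  from path_htpy_compose[OF this \<Gamma>_continuous[OF e]]
  have "path_htpy Y (path_join (\<Gamma> m e \<circ> ?l (\<phi> 0)) (\<Gamma> m e \<circ> \<phi>)) (\<Gamma> m e \<circ> ?l (\<phi> 1))"
    by (simp add: path_join_compose)
  then have "lab (path_join (\<Gamma> m e \<circ> ?l (\<phi> 0)) (\<Gamma> m e \<circ> \<phi>)) = lab (\<Gamma> m e \<circ> ?l (\<phi> 1))"
    using reach_\<Gamma>[OF e, of "basis_vec 0"] by (intro lab_cong) auto
  then have "lab (\<Gamma> m e \<circ> ?l (\<phi> 0)) \<otimes> lab (\<Gamma> m e \<circ> \<phi>) = lab (\<Gamma> m e \<circ> ?l (\<phi> 1))"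
    using reach_\<Gamma>[OF e, of "basis_vec 0"] pathin_\<Gamma>[OF e l[OF ends(1)]] pathin_\<Gamma>[OF e \<phi>]
    by (subst (asm) lab_join) auto
  then show ?thesis
    using nth_tuples[OF e, of 0] lab_\<Gamma>_line_closed[OF e l[OF ends(1)]] lab_\<Gamma>_line_closed[OF e \<phi>]
    by (simp add: label_def m_assoc)
qed

lemma lab_\<Gamma>_edge:
  "e \<in> tuples P (Suc m) \<Longrightarrow> j \<le> m \<Longrightarrow> lab (\<Gamma> m e \<circ> line (basis_vec 0) (basis_vec j)) = inv (e ! 0) \<otimes> e ! j"
proof (induction m arbitrary: e j)
  case (0 e j)
  have "line (basis_vec 0) (basis_vec 0) = (\<lambda>_. basis_vec 0)"
    by (auto simp: line_def fun_eq_iff algebra_simps)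
  then have "\<Gamma> 0 e \<circ> line (basis_vec 0) (basis_vec 0) = (\<lambda>_. y)"
    unfolding \<Gamma>_0 by (simp add: o_def)
  then show ?case
    using 0 nth_tuples[OF 0(1), of 0] lab_const[OF reach_base] by (simp del: \<Gamma>.simps)
next
  case (Suc m e j)
  note e = Suc.prems(1)
  let ?e = "\<Gamma> (Suc m) e \<circ> line (basis_vec 0) (basis_vec j)"
  have pe: "pathin Y ?e" using Suc.prems by (intro pathin_\<Gamma> pathin_line) auto
  have re: "reach (?e 0)" using \<Gamma>_vertex[OF e, of 0] reach_base by simp
  show ?case
  proof (cases "m = 0 \<and> j = 1")
    case True
    have e2: "e \<in> tuples P 2" using e True by (simp add: numeral_2_eq_2)
    have "line (basis_vec 0) (basis_vec 1) s = edge s" for s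
      by (auto simp: line_def basis_vec_def edge_def fun_eq_iff)
    then have "path_htpy Y ?e (edge_loop (inv (e ! 0) \<otimes> e ! 1))"
      using True pe \<Gamma>_edge_simplex(2)[OF e2] by (intro path_htpy_cong) auto
    from lab_cong[OF this re] show ?thesis using True \<Gamma>_edge_simplex(4)[OF e2] by simp
  next
    case False
    \<comment> \<open>A face that keeps both vertex \<open>0\<close> and vertex \<open>j\<close>:
      the last vertex is removed, or vertex \<open>1\<close> if \<open>j\<close> is the last one.
      \<open>j'\<close> is the position of vertex \<open>j\<close> in that face.\<close>
    define i j' where "i = (if j = Suc m then 1 else Suc m)" and "j' = (if j = Suc m then m else j)"
    have ij: "0 < i" "i \<le> Suc m" "j' \<le> m" "simplical_face i (basis_vec 0) = basis_vec 0"
        "simplical_face i (basis_vec j') = basis_vec j" "del i e ! j' = e ! j" "del i e ! 0 = e ! 0"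
      using False Suc.prems by (auto simp: i_def j'_def simplical_face_basis_vec nth_del tuples_def)
    have "?e t = (\<Gamma> m (del i e) \<circ> line (basis_vec 0) (basis_vec j')) t" if "t \<in> {0..1}" for t
      using \<Gamma>_face[OF e ij(2), of "line (basis_vec 0) (basis_vec j') t"] ij(3-5) that
      by (simp add: simplical_face_line line_in del: \<Gamma>.simps)
    then have "path_htpy Y ?e (\<Gamma> m (del i e) \<circ> line (basis_vec 0) (basis_vec j'))"
      using pe by (intro path_htpy_cong)
    from lab_cong[OF this re] show ?thesis
      using Suc.IH[OF del_in_tuples[OF e ij(2)] ij(3)] ij by simp
  qed
qed

lemma label_vertex:
  assumes e: "e \<in> tuples P (Suc m)" and j: "j \<le> m"
  shows "label m e (basis_vec j) = e ! j"
  using nth_tuples[OF e, of 0] nth_tuples[OF e, of j] j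
  by (simp add: label_def lab_\<Gamma>_edge[OF e j] m_assoc[symmetric])

text \<open>The face may start at a different vertex of \<open>e\<close>. The label in the large
  simplex is transported along the image of the line in the face, which starts at a vertex, where
  \<open>label_vertex\<close> evaluates it.\<close>

lemma label_face:
  assumes e: "e \<in> tuples P (Suc (Suc m))" and j: "j \<le> Suc m" and x: "x \<in> standard_simplex m"
  shows "label (Suc m) e (simplical_face j x) = label m (del j e) x"
proof -
  let ?\<phi> = "\<lambda>t. simplical_face j (line (basis_vec 0) x t)"
  have l: "pathin (simplex_top m) (line (basis_vec 0) x)"
    using x by (intro pathin_line) auto
  have \<phi>: "pathin (simplex_top (Suc m)) ?\<phi>"
    using pathin_compose[OF l continuous_simplical_face[OF j]] by (simp add: o_def)
  note d = del_in_tuples[OF e j]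
  have "path_htpy Y (\<Gamma> (Suc m) e \<circ> ?\<phi>) (\<Gamma> m (del j e) \<circ> line (basis_vec 0) x)"
    using \<Gamma>_face[OF e j] line_in[OF _ x, of "basis_vec 0"]
    by (intro path_htpy_cong pathin_\<Gamma>[OF e \<phi>]) (simp del: \<Gamma>.simps)
  then have "lab (\<Gamma> (Suc m) e \<circ> ?\<phi>) = lab (\<Gamma> m (del j e) \<circ> line (basis_vec 0) x)"
    using reach_\<Gamma>[OF e, of "?\<phi> 0"] path_start_in_topspace[OF \<phi>]
    by (intro lab_cong) (simp_all del: \<Gamma>.simps)
  moreover have "label (Suc m) e (?\<phi> 0) = del j e ! 0"
    using label_vertex[OF e, of "if 0 < j then 0 else 1"] e j
    by (auto simp: simplical_face_basis_vec nth_del tuples_def)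
  ultimately show ?thesis
    using label_path[OF e \<phi>] by (simp add: label_def[of m])
qed

lemma label_act:
  assumes h: "h \<in> carrier P" and e: "e \<in> tuples P (Suc m)" and x: "x \<in> standard_simplex m"
  shows "label m (map ((\<otimes>) h) e) x = h \<otimes> label m e x"
proof -
  have "lab (\<Gamma> m e \<circ> line (basis_vec 0) x) \<in> carrier P"
    using x by (intro lab_\<Gamma>_line_closed[OF e] pathin_line) auto
  moreover have "map ((\<otimes>) h) e ! 0 = h \<otimes> e ! 0"
    using e by (auto simp: tuples_def)
  ultimately show ?thesis
    using h nth_tuples[OF e, of 0] by (simp add: label_def \<Gamma>_act[OF h e] m_assoc)
qed

text \<open>The cover is pulled back along \<open>\<Gamma>\<close>, and the functions from
  \<open>section_label\<close> are evaluated at the lifted points; \<open>HH\<close> acts on the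
  lifted points through \<open>label_act\<close>. This is the input of \<open>simplex_cover\<close>
  for the group \<open>HH\<close>.\<close>

lemma cd_subgroup_le:
  assumes HH: "subgroup HH P" and open_U: "\<And>i. i \<le> k \<Longrightarrow> openin Y (U i)" and cover: "(\<Union>i\<le>k. U i) = topspace Y"
    and free: "\<And>i \<gamma> t. i \<le> k \<Longrightarrow> pathin (subtopology Y (U i)) \<gamma> \<Longrightarrow> \<gamma> 1 = \<gamma> 0 \<Longrightarrow> reach (\<gamma> 0) \<Longrightarrow>
      t \<in> carrier P \<Longrightarrow> t \<otimes> lab \<gamma> \<otimes> inv t \<in> HH \<Longrightarrow> lab \<gamma> = \<one>"
  shows "cd TYPE('m) (P\<lparr>carrier := HH\<rparr>) \<le> enat k"
proof -
  let ?H = "P\<lparr>carrier := HH\<rparr>"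
  \<comment> \<open>The conclusions of \<open>section_label\<close> as one predicate, so that a
    function can be chosen for each \<open>i\<close> at once.\<close>
  define good where "good i l \<longleftrightarrow>
    (\<forall>v p. v \<in> U i \<longrightarrow> reach v \<longrightarrow> p \<in> carrier P \<longrightarrow> l (v, p) \<in> HH) \<and>
    (\<forall>v p h. v \<in> U i \<longrightarrow> reach v \<longrightarrow> p \<in> carrier P \<longrightarrow> h \<in> HH \<longrightarrow> l (v, h \<otimes> p) = h \<otimes> l (v, p)) \<and>
    (\<forall>\<gamma> p. pathin (subtopology Y (U i)) \<gamma> \<longrightarrow> reach (\<gamma> 0) \<longrightarrow> p \<in> carrier P \<longrightarrow> l (\<gamma> 1, p \<otimes> lab \<gamma>) = l (\<gamma> 0, p))"
    for i and l :: "'b \<times> 'a \<Rightarrow> 'a"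
  define l where "l i = (SOME f. good i f)" for i
  have good: "good i (l i)" if i: "i \<le> k" for i
    unfolding l_def
  proof (rule someI_ex[of "good i"], rule section_label[OF HH free[OF i]])
    show "\<exists>f. good i f"
      if "\<And>v p. v \<in> U i \<Longrightarrow> reach v \<Longrightarrow> p \<in> carrier P \<Longrightarrow> f (v, p) \<in> HH"
        "\<And>v p h. v \<in> U i \<Longrightarrow> reach v \<Longrightarrow> p \<in> carrier P \<Longrightarrow> h \<in> HH \<Longrightarrow> f (v, h \<otimes> p) = h \<otimes> f (v, p)"
        "\<And>\<gamma> p. pathin (subtopology Y (U i)) \<gamma> \<Longrightarrow> reach (\<gamma> 0) \<Longrightarrow> p \<in> carrier P \<Longrightarrow> f (\<gamma> 1, p \<otimes> lab \<gamma>) = f (\<gamma> 0, p)"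
      for f
      unfolding good_def using that by (intro exI[of _ f]) simp
  qed
  have l: "v \<in> U i \<Longrightarrow> reach v \<Longrightarrow> p \<in> carrier P \<Longrightarrow> l i (v, p) \<in> HH"
    "v \<in> U i \<Longrightarrow> reach v \<Longrightarrow> p \<in> carrier P \<Longrightarrow> h \<in> HH \<Longrightarrow> l i (v, h \<otimes> p) = h \<otimes> l i (v, p)"
    "pathin (subtopology Y (U i)) \<gamma> \<Longrightarrow> reach (\<gamma> 0) \<Longrightarrow> p \<in> carrier P \<Longrightarrow> l i (\<gamma> 1, p \<otimes> lab \<gamma>) = l i (\<gamma> 0, p)"
    if "i \<le> k" for i v p h \<gamma>
    using good[OF that] unfolding good_def by simp_all
  \<comment> \<open>\<open>simplex_cover\<close> passes only the tuple to the cover and the labels,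
    so the dimension has to be recovered from its length.\<close>
  define dim where "dim e = length e - 1" for e :: "'a list"
  define V where "V e i = {x \<in> standard_simplex (dim e). \<Gamma> (dim e) e x \<in> U i}" for e i
  define lam where "lam e i x = l i (\<Gamma> (dim e) e x, label (dim e) e x)" for e i x
  have HP: "h \<in> carrier P" if "h \<in> HH" for h using subgroup.subset[OF HH] that by blast
  have tup: "e \<in> tuples P n" if "e \<in> tuples ?H n" for e n
    using that HP by (auto simp: tuples_def)
  have dim: "dim e = m" if "e \<in> tuples ?H (Suc m)" for e m
    using that by (simp add: dim_def tuples_def)
  have del: "del j e \<in> tuples ?H (Suc m)" if "e \<in> tuples ?H (Suc (Suc m))" "j \<le> Suc m" for e j m
    using del_in_tuples[OF that] .
  have "simplex_cover ?H k V lam"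
  proof (intro simplex_cover.intro plain_group.intro simplex_cover_axioms.intro)
    show "group ?H" using subgroup.subgroup_is_group[OF HH is_group] .
  next
    fix e m i assume e: "e \<in> tuples ?H (Suc m)" and i: "i \<le> k"
    show "openin (simplex_top m) (V e i)"
      using openin_continuous_map_preimage[OF \<Gamma>_continuous[OF tup[OF e]] open_U[OF i]]
      by (simp add: V_def dim[OF e])
  next
    fix e m assume e: "e \<in> tuples ?H (Suc m)"
    show "standard_simplex m \<subseteq> (\<Union>i\<le>k. V e i)"
    proof
      fix x assume x: "x \<in> standard_simplex m"
      then have "\<Gamma> m e x \<in> topspace Y"
        using \<Gamma>_continuous[OF tup[OF e]] by (auto simp: continuous_map_def)
      then show "x \<in> (\<Union>i\<le>k. V e i)"
        using x by (auto simp: V_def dim[OF e] cover[symmetric])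
    qed
  next
    fix e m j i x
    assume e: "e \<in> tuples ?H (Suc (Suc m))" and j: "j \<le> Suc m" and x: "x \<in> standard_simplex m"
    show "simplical_face j x \<in> V e i \<longleftrightarrow> x \<in> V (del j e) i"
      using \<Gamma>_face[OF tup[OF e] j x] simplical_face_in_standard_simplex[of "Suc m" j x] j x
      by (simp add: V_def dim[OF e] dim[OF del[OF e j]] del: \<Gamma>.simps)
  next
    fix h e m assume h: "h \<in> carrier ?H" and e: "e \<in> tuples ?H (Suc m)"
    have "dim (map ((\<otimes>) h) e) = m" using dim[OF e] by (simp add: dim_def)
    then show "V (map ((\<otimes>\<^bsub>?H\<^esub>) h) e) = V e"
      using \<Gamma>_act[OF HP tup[OF e], of h] h by (auto simp: V_def dim[OF e] fun_eq_iff)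
  next
    fix e m i x assume e: "e \<in> tuples ?H (Suc m)" and i: "i \<le> k" and x: "x \<in> V e i"
    then have "x \<in> standard_simplex m" "\<Gamma> m e x \<in> U i" by (auto simp: V_def dim[OF e])
    then show "lam e i x \<in> carrier ?H"
      using l(1)[OF i] reach_\<Gamma>[OF tup[OF e]] label_closed[OF tup[OF e]] by (simp add: lam_def dim[OF e])
  next
    fix e m j i x
    assume e: "e \<in> tuples ?H (Suc (Suc m))" and j: "j \<le> Suc m" and x: "x \<in> standard_simplex m"
    show "lam e i (simplical_face j x) = lam (del j e) i x"
      using \<Gamma>_face[OF tup[OF e] j x] label_face[OF tup[OF e] j x]
      by (simp add: lam_def dim[OF e] dim[OF del[OF e j]] del: \<Gamma>.simps)
  next
    fix h e m i x
    assume h: "h \<in> carrier ?H" and e: "e \<in> tuples ?H (Suc m)" and i: "i \<le> k" and x: "x \<in> V e i"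
    have d: "dim (map ((\<otimes>) h) e) = m" using dim[OF e] by (simp add: dim_def)
    have x': "x \<in> standard_simplex m" "\<Gamma> m e x \<in> U i" using x by (auto simp: V_def dim[OF e])
    have "h \<in> HH" using h by simp
    then show "lam (map ((\<otimes>\<^bsub>?H\<^esub>) h) e) i x = h \<otimes>\<^bsub>?H\<^esub> lam e i x"
      using \<Gamma>_act[OF HP tup[OF e], of h] label_act[OF HP tup[OF e] x'(1), of h] d
        l(2)[OF i x'(2) reach_\<Gamma>[OF tup[OF e] x'(1)] label_closed[OF tup[OF e] x'(1)]]
      by (simp add: lam_def dim[OF e])
  next
    fix e m i \<gamma>
    assume e: "e \<in> tuples ?H (Suc m)" and i: "i \<le> k" and \<gamma>: "pathin (subtopology (simplex_top m) (V e i)) \<gamma>"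
    have \<gamma>': "pathin (simplex_top m) \<gamma>" "\<And>t. t \<in> {0..1} \<Longrightarrow> \<gamma> t \<in> V e i"
      using \<gamma> by (auto simp: pathin_subtopology)
    then have "pathin (subtopology Y (U i)) (\<Gamma> m e \<circ> \<gamma>)"
      using pathin_\<Gamma>[OF tup[OF e] \<gamma>'(1)] unfolding pathin_subtopology[of Y] by (auto simp: V_def dim[OF e])
    moreover have "\<gamma> 0 \<in> standard_simplex m" using path_start_in_topspace[OF \<gamma>'(1)] by simp
    then have "reach ((\<Gamma> m e \<circ> \<gamma>) 0)" "label m e (\<gamma> 0) \<in> carrier P"
      using reach_\<Gamma>[OF tup[OF e]] label_closed[OF tup[OF e]] by simp_all
    ultimately have "l i ((\<Gamma> m e \<circ> \<gamma>) 1, label m e (\<gamma> 0) \<otimes> lab (\<Gamma> m e \<circ> \<gamma>)) = l i ((\<Gamma> m e \<circ> \<gamma>) 0, label m e (\<gamma> 0))"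
      by (rule l(3)[OF i])
    then show "lam e i (\<gamma> 0) = lam e i (\<gamma> 1)"
      using label_path[OF tup[OF e] \<gamma>'(1)] by (simp add: lam_def dim[OF e])
  qed
  then show ?thesis by (rule simplex_cover.cd_le_cover)
qed

end

section \<open>Fibre products\<close>

lemma fibre_product_simps:
  "carrier (fibre_product G \<phi> H \<psi>) = {(g, h). g \<in> carrier G \<and> h \<in> carrier H \<and> \<phi> g = \<psi> h}"
  "(g, h) \<otimes>\<^bsub>fibre_product G \<phi> H \<psi>\<^esub> (g', h') = (g \<otimes>\<^bsub>G\<^esub> g', h \<otimes>\<^bsub>H\<^esub> h')"
  "\<one>\<^bsub>fibre_product G \<phi> H \<psi>\<^esub> = (\<one>\<^bsub>G\<^esub>, \<one>\<^bsub>H\<^esub>)"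
  by (simp_all add: fibre_product_def)

lemma subgroup_fibre_product:
  assumes "group G" "group H" "group Q" and \<phi>: "\<phi> \<in> hom G Q" and \<psi>: "\<psi> \<in> hom H Q"
    and A: "subgroup A G" and B: "subgroup B H"
  shows "subgroup {(g, h). g \<in> A \<and> h \<in> B \<and> \<phi> g = \<psi> h} (G \<times>\<times> H)"
proof -
  interpret G: group G by fact
  interpret H: group H by fact
  interpret Q: group Q by fact
  interpret \<phi>: group_hom G Q \<phi> using \<phi> by unfold_locales
  interpret \<psi>: group_hom H Q \<psi> using \<psi> by unfold_locales
  interpret GH: group "G \<times>\<times> H" by (rule DirProd_group) fact+
  note AG = subgroup.mem_carrier[OF A] and BH = subgroup.mem_carrier[OF B]
  show ?thesis
  proof (rule GH.subgroupI)
    show "{(g, h). g \<in> A \<and> h \<in> B \<and> \<phi> g = \<psi> h} \<subseteq> carrier (G \<times>\<times> H)"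
      using AG BH by auto
    have "(\<one>\<^bsub>G\<^esub>, \<one>\<^bsub>H\<^esub>) \<in> {(g, h). g \<in> A \<and> h \<in> B \<and> \<phi> g = \<psi> h}"
      using subgroup.one_closed[OF A] subgroup.one_closed[OF B] by simp
    then show "{(g, h). g \<in> A \<and> h \<in> B \<and> \<phi> g = \<psi> h} \<noteq> {}" by blast
    show "inv\<^bsub>G \<times>\<times> H\<^esub> z \<in> {(g, h). g \<in> A \<and> h \<in> B \<and> \<phi> g = \<psi> h}"
      if "z \<in> {(g, h). g \<in> A \<and> h \<in> B \<and> \<phi> g = \<psi> h}" for z
      using that AG BH subgroup.m_inv_closed[OF A] subgroup.m_inv_closed[OF B]
      by (auto simp: inv_DirProd[OF G.is_group H.is_group])
    show "z \<otimes>\<^bsub>G \<times>\<times> H\<^esub> w \<in> {(g, h). g \<in> A \<and> h \<in> B \<and> \<phi> g = \<psi> h}"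
      if "z \<in> {(g, h). g \<in> A \<and> h \<in> B \<and> \<phi> g = \<psi> h}" "w \<in> {(g, h). g \<in> A \<and> h \<in> B \<and> \<phi> g = \<psi> h}" for z w
      using that AG BH subgroup.m_closed[OF A] subgroup.m_closed[OF B] by auto
  qed
qed

theorem theorem4p1:
  fixes G :: "'g monoid" and Q :: "'q monoid" and \<rho> :: "'g \<Rightarrow> 'q" and A B :: "'g set"
  assumes "group G" and "group Q" and "\<rho> \<in> epi G Q"
    and "subgroup A G" and "subgroup B G"
    and "\<And>g. g \<in> kernel G Q \<rho> \<Longrightarrow> (\<lambda>a. g \<otimes>\<^bsub>G\<^esub> a \<otimes>\<^bsub>G\<^esub> inv\<^bsub>G\<^esub> g) ` A \<inter> B = {\<one>\<^bsub>G\<^esub>}"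
  shows "cd TYPE('m) (fibre_product (G\<lparr>carrier := A\<rparr>) \<rho> (G\<lparr>carrier := B\<rparr>) \<rho>)
           \<le> TC TYPE('u) G \<rho>"
  unfolding TC_def le_secat_hom_iff
proof (intro allI impI)
  fix X :: "'u topology" and x and Y :: "'u topology" and y f
  let ?P = "fibre_product G \<rho> G \<rho>"
  assume real: "realizes X x Y y f G ?P (\<lambda>g. (g, g))"
  interpret G: group G by fact
  have \<rho>: "\<rho> \<in> hom G Q" using assms(3) by (simp add: epi_def)
  interpret Q: group Q by fact
  interpret \<rho>: group_hom G Q \<rho> using \<rho> by unfold_locales
  have GG: "group (G \<times>\<times> G)" by (rule DirProd_group) fact+
  have P_eq: "?P = (G \<times>\<times> G)\<lparr>carrier := {(g, h). g \<in> carrier G \<and> h \<in> carrier G \<and> \<rho> g = \<rho> h}\<rparr>"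
    by (simp add: fibre_product_def)
  have P_sub: "subgroup {(g, h). g \<in> carrier G \<and> h \<in> carrier G \<and> \<rho> g = \<rho> h} (G \<times>\<times> G)"
    using assms \<rho> by (intro subgroup_fibre_product G.subgroup_self) auto
  have P: "group ?P"
    unfolding P_eq using subgroup.subgroup_is_group[OF P_sub GG] .
  have inv_P: "inv\<^bsub>?P\<^esub> (g, h) = (inv\<^bsub>G\<^esub> g, inv\<^bsub>G\<^esub> h)" if "(g, h) \<in> carrier ?P" for g h
    using group.m_inv_consistent[OF GG P_sub] that assms(1)
    by (simp add: P_eq[symmetric] fibre_product_simps inv_DirProd)
  define HH where "HH = {(a, b). a \<in> A \<and> b \<in> B \<and> \<rho> a = \<rho> b}"
  have HH: "subgroup HH ?P"
  proof -
    have "subgroup HH (G \<times>\<times> G)"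
      unfolding HH_def using assms \<rho> by (intro subgroup_fibre_product) auto
    then show ?thesis
      unfolding P_eq using assms(4,5)
      by (intro group.subgroup_incl[OF GG _ P_sub]) (auto simp: HH_def dest: subgroup.mem_carrier)
  qed
  have H_eq: "fibre_product (G\<lparr>carrier := A\<rparr>) \<rho> (G\<lparr>carrier := B\<rparr>) \<rho> = ?P\<lparr>carrier := HH\<rparr>"
    by (simp add: fibre_product_def DirProd_def HH_def)
  obtain \<alpha> \<beta> where KX: "K_pi_1 G X x" and KY: "K_pi_1 ?P Y y" and f: "continuous_map X Y f" "f x = y"
    and \<alpha>: "\<alpha> \<in> iso G (fundamental_group X x)" and \<beta>: "\<beta> \<in> iso ?P (fundamental_group Y y)"
    and comm: "\<And>g. g \<in> carrier G \<Longrightarrow> pi1_map Y y f (\<alpha> g) = \<beta> (g, g)"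
    using real unfolding realizes_def by blast
  \<comment> \<open>Path-connectedness lets loops in \<open>X\<close> with arbitrary start be
    compared with elements of \<open>G\<close>.\<close>
  have X: "path_connected_space X" "x \<in> topspace X"
    using KX CW_homotopy_type_path_connected by (auto simp: K_pi_1_def)
  have y: "y \<in> topspace Y" using KY by (simp add: K_pi_1_def)
  interpret aspherical_labelling ?P Y y \<beta>
  proof (intro aspherical_labelling.intro path_labelling.intro plain_group.intro P
      path_labelling_axioms.intro y \<beta> aspherical_labelling_axioms.intro)
    show "null_spheroids n Y y" if "2 \<le> n" for n
      using KY that y by (intro null_spheroidsI) (auto simp: K_pi_1_def)
  qed
  show "cd TYPE('m) (fibre_product (G\<lparr>carrier := A\<rparr>) \<rho> (G\<lparr>carrier := B\<rparr>) \<rho>) \<le> secat X Y f"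
    unfolding secat_def H_eq
  proof (rule INF_greatest, clarify)
    fix k and U :: "nat \<Rightarrow> 'u set"
    assume cover: "(\<Union>i\<le>k. U i) = topspace Y"
      and U: "\<forall>i\<le>k. openin Y (U i) \<and> (\<exists>\<sigma>. continuous_map (subtopology Y (U i)) X \<sigma> \<and>
        homotopic_with (\<lambda>_. True) (subtopology Y (U i)) Y (f \<circ> \<sigma>) id)"
    show "cd TYPE('m) (?P\<lparr>carrier := HH\<rparr>) \<le> enat k"
    proof (rule cd_subgroup_le[OF HH _ cover])
      show "openin Y (U i)" if "i \<le> k" for i using U that by blast
      fix i \<gamma> t
      assume i: "i \<le> k" and \<gamma>: "pathin (subtopology Y (U i)) \<gamma>" "\<gamma> 1 = \<gamma> 0" "reach (\<gamma> 0)"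
        and t: "t \<in> carrier ?P" and conj: "t \<otimes>\<^bsub>?P\<^esub> lab \<gamma> \<otimes>\<^bsub>?P\<^esub> inv\<^bsub>?P\<^esub> t \<in> HH"
      obtain \<sigma> where \<sigma>: "continuous_map (subtopology Y (U i)) X \<sigma>"
          "homotopic_with (\<lambda>_. True) (subtopology Y (U i)) Y (f \<circ> \<sigma>) id"
        using U i by blast
      have \<phi>: "(g, g) \<in> carrier ?P \<and> pi1_map Y y f (\<alpha> g) = \<beta> (g, g)" if "g \<in> carrier G" for g
        using that comm by (simp add: fibre_product_simps)
      obtain g s where g: "g \<in> carrier G" and s: "s \<in> carrier ?P"
          and lab: "lab \<gamma> = inv\<^bsub>?P\<^esub> s \<otimes>\<^bsub>?P\<^esub> (g, g) \<otimes>\<^bsub>?P\<^esub> s"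
        using loop_lab_conjugate[OF X f \<alpha> \<phi> \<sigma> \<gamma>] by blast
      \<comment> \<open>The two conjugations, by \<open>t\<close> from the covering and by
        \<open>s\<close> from the free homotopy, combine into one conjugation of the diagonal
        element.\<close>
      define u where "u = t \<otimes>\<^bsub>?P\<^esub> inv\<^bsub>?P\<^esub> s"
      have u: "u \<in> carrier ?P" using t s by (simp add: u_def)
      have gg: "(g, g) \<in> carrier ?P" using \<phi>[OF g] by blast
      have "t \<otimes>\<^bsub>?P\<^esub> lab \<gamma> \<otimes>\<^bsub>?P\<^esub> inv\<^bsub>?P\<^esub> t = u \<otimes>\<^bsub>?P\<^esub> (g, g) \<otimes>\<^bsub>?P\<^esub> inv\<^bsub>?P\<^esub> u"
        using t s gg by (simp add: lab u_def m_assoc inv_mult_group)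
      moreover obtain u1 u2 where u12: "u = (u1, u2)" by (cases u)
      ultimately have ab: "u1 \<otimes>\<^bsub>G\<^esub> g \<otimes>\<^bsub>G\<^esub> inv\<^bsub>G\<^esub> u1 \<in> A" "u2 \<otimes>\<^bsub>G\<^esub> g \<otimes>\<^bsub>G\<^esub> inv\<^bsub>G\<^esub> u2 \<in> B"
        using conj inv_P[of u1 u2] u by (simp_all add: HH_def fibre_product_simps)
      have u_in: "u1 \<in> carrier G" "u2 \<in> carrier G" "\<rho> u1 = \<rho> u2"
        using u u12 by (simp_all add: fibre_product_simps)
      \<comment> \<open>Since \<open>u\<close> lies in the fibre product, its components have equal
        image and \<open>n\<close> is in the kernel. Conjugation by \<open>n\<close> carries the
        element of \<open>A\<close> to the element of \<open>B\<close>, so the hypothesis on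
        \<open>A\<close> and \<open>B\<close> makes both trivial.\<close>
      define n where "n = u2 \<otimes>\<^bsub>G\<^esub> inv\<^bsub>G\<^esub> u1"
      have n: "n \<in> kernel G Q \<rho>"
        using u_in by (simp add: n_def kernel_def)
      have cancel: "inv\<^bsub>G\<^esub> u1 \<otimes>\<^bsub>G\<^esub> (u1 \<otimes>\<^bsub>G\<^esub> z) = z" if "z \<in> carrier G" for z
        using u_in that by (simp add: G.m_assoc[symmetric])
      have "n \<otimes>\<^bsub>G\<^esub> (u1 \<otimes>\<^bsub>G\<^esub> g \<otimes>\<^bsub>G\<^esub> inv\<^bsub>G\<^esub> u1) \<otimes>\<^bsub>G\<^esub> inv\<^bsub>G\<^esub> n = u2 \<otimes>\<^bsub>G\<^esub> g \<otimes>\<^bsub>G\<^esub> inv\<^bsub>G\<^esub> u2"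
        using u_in g by (simp add: n_def G.m_assoc G.inv_mult_group cancel)
      then have "u2 \<otimes>\<^bsub>G\<^esub> g \<otimes>\<^bsub>G\<^esub> inv\<^bsub>G\<^esub> u2 \<in> (\<lambda>a. n \<otimes>\<^bsub>G\<^esub> a \<otimes>\<^bsub>G\<^esub> inv\<^bsub>G\<^esub> n) ` A \<inter> B"
        using ab by (metis IntI image_eqI)
      then have "u2 \<otimes>\<^bsub>G\<^esub> g \<otimes>\<^bsub>G\<^esub> inv\<^bsub>G\<^esub> u2 = \<one>\<^bsub>G\<^esub>"
        using assms(6)[OF n] by simp
      then have "u2 \<otimes>\<^bsub>G\<^esub> g = u2"
        using u_in g by (metis G.inv_closed G.inv_equality G.inv_inv G.m_closed)
      then have "g = \<one>\<^bsub>G\<^esub>"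
        using u_in g by simp
      then show "lab \<gamma> = \<one>\<^bsub>?P\<^esub>"
        using s \<open>g = \<one>\<^bsub>G\<^esub>\<close> fibre_product_simps(3)[of G \<rho> G \<rho>]
        by (metis lab l_inv r_one inv_closed)
    qed
  qed
qed

end
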